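(* Let $\mathcal{Q}$ be a small quantaloid. The quantaloid homomorphisms $\hat{\mathsf K}_{\mathsf d}:\mathbf{D}(\mathcal{Q}\text{-}\mathbf{Dist})\to(\mathcal{Q}\text{-}\mathbf{IntDist})_{\mathsf o}$ and $\hat{\mathsf I}_{\mathsf d}:(\mathcal{Q}\text{-}\mathbf{IntDist})_{\mathsf o}\to\mathbf{D}(\mathcal{Q}\text{-}\mathbf{Dist})$ establish an equivalence of quantaloids; hence $\mathbf{D}(\mathcal{Q}\text{-}\mathbf{Dist})$ and $(\mathcal{Q}\text{-}\mathbf{IntDist})_{\mathsf o}$ are equivalent quantaloids.
   Context: **Quantaloids.** A quantaloid is a (possibly large) category whose hom-sets are complete lattices and whose composition preserves arbitrary joins in each variable. For arrows $u:p\to q$, $v:q\to r$, $w:p\to r$ the arrows $w\swarrow u:q\to r$ and $v\searrow w:p\to q$ are determined by $v\circ u\le w\iff v\le w\swarrow u\iff u\le v\searrow w$. A homomorphism of quantaloids is a functor preserving joins of arrows; it is an equivalence of quantaloids if the underlying functor is an equivalence of categories. A congruence on a quantaloid is a family of equivalence relations on the hom-sets compatible with composition and arbitrary joins; it induces a quotient quantaloid with the same objects and with equivalence classes as arrows. A quantaloid is small if its objects form a set. Throughout, $\mathcal{Q}$ is a small quantaloid. **$\mathcal{Q}$-categories and $\mathcal{Q}$-distributors.** A $\mathcal{Q}$-category $X$ is a set $X$ with a type map $|\cdot|:X\to\mathrm{ob}\,\mathcal{Q}$ and hom-arrows $1_X^\natural(x,y)\in\mathcal{Q}(|x|,|y|)$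 with $1_{|x|}\le 1_X^\natural(x,x)$ and $1_X^\natural(y,z)\circ 1_X^\natural(x,y)\le 1_X^\natural(x,z)$. Its underlying preorder is $x\le y\iff |x|=|y|$ and $1_{|x|}\le 1_X^\natural(x,y)$. A $\mathcal{Q}$-functor $f:X\to Y$ is a type-preserving map with $1_X^\natural(x,y)\le 1_Y^\natural(fx,fy)$; $\mathcal{Q}$-functors are ordered pointwise. A $\mathcal{Q}$-distributor $\phi:X\nrightarrow Y$ is a family $\phi(x,y)\in\mathcal{Q}(|x|,|y|)$ with $1_Y^\natural(y,y')\circ\phi(x,y)\circ 1_X^\natural(x',x)\le\phi(x',y')$. $\mathcal{Q}$-categories and $\mathcal{Q}$-distributors form a quantaloid $\mathcal{Q}\text{-}\mathbf{Dist}$ with pointwise order, $(\psi\circ\phi)(x,z)=\bigvee_y\psi(y,z)\circ\phi(x,y)$, identities $1_X^\natural$, and $(\xi\swarrow\phi)(y,z)=\bigwedge_x\xi(x,z)\swarrow\phi(x,y)$. The cograph of a $\mathcal{Q}$-functor $f:X\to Y$ is $f^\natural:Y\nrightarrow X$, $f^\natural(y,x)=1_Y^\natural(y,fx)$. **Presheaves and Kan adjunctions.** $\{q\}$ is the one-object $\mathcal{Q}$-category of type $q$ with hom $1_q$. $\mathsf{P}X$ is the $\mathcal{Q}$-category of all $\mathcal{Q}$-distributors $\mu:X\nrightarrow\{q\}$ (of type $q$; $q\in\mathrm{ob}\,\mathcal{Q}$), with $1_{\mathsf{P}X}^\natural(\mu,\mu')=\mu'\swarrow\mu$; write $\mu(x)$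 for its values. Each $\phi:X\nrightarrow Y$ induces an adjunction $\phi^*\dashv\phi_*$ of $\mathcal{Q}$-functors, $\phi^*:\mathsf{P}Y\to\mathsf{P}X$, $\phi^*\lambda=\lambda\circ\phi$, and $\phi_*:\mathsf{P}X\to\mathsf{P}Y$, $\phi_*\mu=\mu\swarrow\phi$. **Interior spaces.** A $\mathcal{Q}$-interior space $(X,a)$ is a $\mathcal{Q}$-category $X$ with a $\mathcal{Q}$-functor $a:\mathsf{P}X\to\mathsf{P}X$ such that $a\le 1_{\mathsf{P}X}$ and $aa=a$. $\mathcal{O}(X,a)=\{\mu\in\mathsf{P}X\mid a\mu=\mu\}$ is regarded as a full $\mathcal{Q}$-subcategory of $\mathsf{P}X$. A continuous $\mathcal{Q}$-distributor $\zeta:(X,a)\nrightarrow(Y,b)$ is a $\mathcal{Q}$-distributor $\zeta:X\nrightarrow Y$ with $\zeta^*b\le a\zeta^*$. $\mathcal{Q}\text{-}\mathbf{IntDist}$ is the quantaloid of $\mathcal{Q}$-interior spaces and continuous $\mathcal{Q}$-distributors (order, composition and identities as in $\mathcal{Q}\text{-}\mathbf{Dist}$). For continuous $\zeta,\zeta':(X,a)\nrightarrow(Y,b)$ put $\zeta\sim\zeta'$ iff $\zeta^*b=\zeta'^*b$; this is a congruence, and $(\mathcal{Q}\text{-}\mathbf{IntDist})_{\mathsf o}:=\mathcal{Q}\text{-}\mathbf{IntDist}/\!\sim$. **Diagonals.** $\mathbf{Arr}(\mathcal{Q}\text{-}\mathbf{Dist})$ has $\mathcal{Q}$-distributors as objects;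 arrows from $\phi:X\nrightarrow Y$ to $\psi:X'\nrightarrow Y'$ are pairs $(\zeta:X\nrightarrow X',\eta:Y\nrightarrow Y')$ with $\psi\circ\zeta=\eta\circ\phi$, ordered componentwise. Put $(\zeta,\eta)\sim(\zeta',\eta')$ iff $\psi\circ\zeta=\psi\circ\zeta'$ (equivalently $\eta\circ\phi=\eta'\circ\phi$); this is a congruence, and $\mathbf{D}(\mathcal{Q}\text{-}\mathbf{Dist}):=\mathbf{Arr}(\mathcal{Q}\text{-}\mathbf{Dist})/\!\sim$. **The two homomorphisms.** $\hat{\mathsf K}_{\mathsf d}$ sends $\phi:X\nrightarrow Y$ to $(X,\phi^*\phi_* )$ and the class of $(\zeta,\eta):\phi\to\psi$ to the class of $\zeta:(X,\phi^*\phi_* )\nrightarrow(X',\psi^*\psi_* )$. $\hat{\mathsf I}_{\mathsf d}$ sends $(X,a)$ to the $\mathcal{Q}$-distributor $\kappa_a:X\nrightarrow\mathcal{O}(X,a)$, $\kappa_a(x,\mu)=\mu(x)$, and the class of $\zeta:(X,a)\nrightarrow(Y,b)$ to the class of $(\zeta,(\zeta^* )^\natural|_{\mathcal{O}(X,a),\mathcal{O}(Y,b)}):\kappa_a\to\kappa_b$, where $(\zeta^* )^\natural:\mathsf{P}X\nrightarrow\mathsf{P}Y$ is the cograph of $\zeta^*:\mathsf{P}Y\to\mathsf{P}X$, restricted to the indicated subcategories. *)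

theory Defs
  imports "HOL-Algebra.Complete_Lattice" "HOL-Library.FuncSet" "HOL-Library.Nat_Bijection"
begin

section \<open>Sets and classes\<close>

text \<open>
  The category of all \<open>Q\<close>-categories is large, and it has to be closed under the formation of
  presheaf \<open>Q\<close>-categories, so its objects cannot be the structures on subsets of a fixed HOL type.
  The distinction between sets and classes is modelled by a type \<open>'u\<close> of all sets: a class is an
  \<open>'u set\<close>, \<open>small\<close> singles out the classes that are sets, and \<open>code\<close> turns a small class into
  the corresponding element of \<open>'u\<close>.  Closure is required under separation, replacement, union,
  power set and finite classes; infinity is not required.  The type \<open>V\<close> of ZFC in HOL is an
  instance, and so are the hereditarily finite sets (see the lemma below).
\<close>

locale set_universe =
  fixes small :: "'u set \<Rightarrow> bool" and code :: "'u set \<Rightarrow> 'u"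
  assumes code_inj: "inj_on code (Collect small)"
    and small_finite: "finite A \<Longrightarrow> small A"
    and small_subset: "small A \<Longrightarrow> B \<subseteq> A \<Longrightarrow> small B"
    and small_image: "small A \<Longrightarrow> small (f ` A)"
    and small_UN: "small A \<Longrightarrow> (\<And>x. x \<in> A \<Longrightarrow> small (F x)) \<Longrightarrow> small (\<Union>x\<in>A. F x)"
    and small_Pow: "small A \<Longrightarrow> small (code ` Pow A)"

lemma set_universe_hereditarily_finite: "set_universe finite set_encode"
  by unfold_locales (auto simp: inj_on_set_encode intro: finite_subset)

definition kpair :: "('u set \<Rightarrow> 'u) \<Rightarrow> 'u \<Rightarrow> 'u \<Rightarrow> 'u" where
  "kpair code x y = code {code {x}, code {x, y}}"


section \<open>Quantaloids\<close>

text \<open>\<open>Cmp Q p q r v u\<close> is the composite \<open>v \<circ> u\<close> of \<open>u : p \<rightarrow> q\<close> and \<open>v : q \<rightarrow> r\<close>.  The objects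
  are arguments because hom-sets are not required to be disjoint.\<close>

record ('o, 'a) qtld =
  Obj :: "'o set"
  Hom :: "'o \<Rightarrow> 'o \<Rightarrow> 'a gorder"
  Idn :: "'o \<Rightarrow> 'a"
  Cmp :: "'o \<Rightarrow> 'o \<Rightarrow> 'o \<Rightarrow> 'a \<Rightarrow> 'a \<Rightarrow> 'a"

abbreviation arrows :: "('o, 'a) qtld \<Rightarrow> 'o \<Rightarrow> 'o \<Rightarrow> 'a set" where
  "arrows Q p q \<equiv> carrier (Hom Q p q)"

locale quantaloid =
  fixes Q :: "('o, 'a) qtld"
  assumes hom_complete_lattice:
      "p \<in> Obj Q \<Longrightarrow> q \<in> Obj Q \<Longrightarrow> complete_lattice (Hom Q p q)"
    and idn_arrow: "p \<in> Obj Q \<Longrightarrow> Idn Q p \<in> arrows Q p p"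
    and cmp_arrow: "\<lbrakk>p \<in> Obj Q; q \<in> Obj Q; r \<in> Obj Q; u \<in> arrows Q p q; v \<in> arrows Q q r\<rbrakk>
      \<Longrightarrow> Cmp Q p q r v u \<in> arrows Q p r"
    and cmp_idn_right: "\<lbrakk>p \<in> Obj Q; q \<in> Obj Q; u \<in> arrows Q p q\<rbrakk>
      \<Longrightarrow> Cmp Q p p q u (Idn Q p) = u"
    and cmp_idn_left: "\<lbrakk>p \<in> Obj Q; q \<in> Obj Q; u \<in> arrows Q p q\<rbrakk>
      \<Longrightarrow> Cmp Q p q q (Idn Q q) u = u"
    and cmp_assoc: "\<lbrakk>p \<in> Obj Q; q \<in> Obj Q; r \<in> Obj Q; s \<in> Obj Q;
        u \<in> arrows Q p q; v \<in> arrows Q q r; w \<in> arrows Q r s\<rbrakk>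
      \<Longrightarrow> Cmp Q p q s (Cmp Q q r s w v) u = Cmp Q p r s w (Cmp Q p q r v u)"
    and cmp_Sup_right: "\<lbrakk>p \<in> Obj Q; q \<in> Obj Q; r \<in> Obj Q; A \<subseteq> arrows Q p q; v \<in> arrows Q q r\<rbrakk>
      \<Longrightarrow> Cmp Q p q r v (\<Squnion>\<^bsub>Hom Q p q\<^esub> A) = \<Squnion>\<^bsub>Hom Q p r\<^esub> ((\<lambda>u. Cmp Q p q r v u) ` A)"
    and cmp_Sup_left: "\<lbrakk>p \<in> Obj Q; q \<in> Obj Q; r \<in> Obj Q; u \<in> arrows Q p q; B \<subseteq> arrows Q q r\<rbrakk>
      \<Longrightarrow> Cmp Q p q r (\<Squnion>\<^bsub>Hom Q q r\<^esub> B) u = \<Squnion>\<^bsub>Hom Q p r\<^esub> ((\<lambda>v. Cmp Q p q r v u) ` B)"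

definition small_quantaloid :: "('u set \<Rightarrow> bool) \<Rightarrow> ('u, 'u) qtld \<Rightarrow> bool" where
  "small_quantaloid small Q \<longleftrightarrow> quantaloid Q \<and> small (Obj Q) \<and>
     (\<forall>p\<in>Obj Q. \<forall>q\<in>Obj Q. small (arrows Q p q))"

text \<open>The arrow \<open>w \<swarrow> u : q \<rightarrow> r\<close> for \<open>u : p \<rightarrow> q\<close> and \<open>w : p \<rightarrow> r\<close>.\<close>

definition lres :: "('o, 'a) qtld \<Rightarrow> 'o \<Rightarrow> 'o \<Rightarrow> 'o \<Rightarrow> 'a \<Rightarrow> 'a \<Rightarrow> 'a" where
  "lres Q p q r w u = (THE e. e \<in> arrows Q q r \<and>
     (\<forall>v\<in>arrows Q q r. Cmp Q p q r v u \<sqsubseteq>\<^bsub>Hom Q p r\<^esub> w \<longleftrightarrow> v \<sqsubseteq>\<^bsub>Hom Q q r\<^esub> e))"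


subsection \<open>Homomorphisms and equivalences\<close>

record ('o, 'a, 'p, 'b) qmap =
  on_obj :: "'o \<Rightarrow> 'p"
  on_arr :: "'o \<Rightarrow> 'o \<Rightarrow> 'a \<Rightarrow> 'b"

definition is_functor ::
  "('o, 'a) qtld \<Rightarrow> ('p, 'b) qtld \<Rightarrow> ('o, 'a, 'p, 'b) qmap \<Rightarrow> bool" where
  "is_functor C D F \<longleftrightarrow>
     (\<forall>p\<in>Obj C. on_obj F p \<in> Obj D) \<and>
     (\<forall>p\<in>Obj C. \<forall>q\<in>Obj C. \<forall>u\<in>arrows C p q.
        on_arr F p q u \<in> arrows D (on_obj F p) (on_obj F q)) \<and>
     (\<forall>p\<in>Obj C. on_arr F p p (Idn C p) = Idn D (on_obj F p)) \<and>
     (\<forall>p\<in>Obj C. \<forall>q\<in>Obj C. \<forall>r\<in>Obj C. \<forall>u\<in>arrows C p q. \<forall>v\<in>arrows C q r.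
        on_arr F p r (Cmp C p q r v u) =
        Cmp D (on_obj F p) (on_obj F q) (on_obj F r) (on_arr F q r v) (on_arr F p q u))"

definition quantaloid_hom ::
  "('o, 'a) qtld \<Rightarrow> ('p, 'b) qtld \<Rightarrow> ('o, 'a, 'p, 'b) qmap \<Rightarrow> bool" where
  "quantaloid_hom C D F \<longleftrightarrow> quantaloid C \<and> quantaloid D \<and> is_functor C D F \<and>
     (\<forall>p\<in>Obj C. \<forall>q\<in>Obj C. \<forall>A. A \<subseteq> arrows C p q \<longrightarrow>
        on_arr F p q (\<Squnion>\<^bsub>Hom C p q\<^esub> A) =
        \<Squnion>\<^bsub>Hom D (on_obj F p) (on_obj F q)\<^esub> (on_arr F p q ` A))"

definition id_map :: "('o, 'a, 'o, 'a) qmap" where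
  "id_map = \<lparr>on_obj = (\<lambda>p. p), on_arr = (\<lambda>p q u. u)\<rparr>"

definition comp_map ::
  "('p, 'b, 'r, 'c) qmap \<Rightarrow> ('o, 'a, 'p, 'b) qmap \<Rightarrow> ('o, 'a, 'r, 'c) qmap" where
  "comp_map G F = \<lparr>on_obj = (\<lambda>p. on_obj G (on_obj F p)),
     on_arr = (\<lambda>p q u. on_arr G (on_obj F p) (on_obj F q) (on_arr F p q u))\<rparr>"

definition is_iso :: "('o, 'a) qtld \<Rightarrow> 'o \<Rightarrow> 'o \<Rightarrow> 'a \<Rightarrow> bool" where
  "is_iso C p q u \<longleftrightarrow> u \<in> arrows C p q \<and>
     (\<exists>v\<in>arrows C q p. Cmp C p q p v u = Idn C p \<and> Cmp C q p q u v = Idn C q)"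

definition naturally_isomorphic ::
  "('o, 'a) qtld \<Rightarrow> ('p, 'b) qtld \<Rightarrow> ('o, 'a, 'p, 'b) qmap \<Rightarrow> ('o, 'a, 'p, 'b) qmap \<Rightarrow> bool" where
  "naturally_isomorphic C D F G \<longleftrightarrow> (\<exists>\<tau>.
     (\<forall>p\<in>Obj C. is_iso D (on_obj F p) (on_obj G p) (\<tau> p)) \<and>
     (\<forall>p\<in>Obj C. \<forall>q\<in>Obj C. \<forall>u\<in>arrows C p q.
        Cmp D (on_obj F p) (on_obj F q) (on_obj G q) (\<tau> q) (on_arr F p q u) =
        Cmp D (on_obj F p) (on_obj G p) (on_obj G q) (on_arr G p q u) (\<tau> p)))"

definition category_equivalence ::
  "('o, 'a) qtld \<Rightarrow> ('p, 'b) qtld \<Rightarrow> ('o, 'a, 'p, 'b) qmap \<Rightarrow> ('p, 'b, 'o, 'a) qmap \<Rightarrow> bool" where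
  "category_equivalence C D F G \<longleftrightarrow> is_functor C D F \<and> is_functor D C G \<and>
     naturally_isomorphic C C (comp_map G F) id_map \<and>
     naturally_isomorphic D D (comp_map F G) id_map"

definition quantaloid_equivalence ::
  "('o, 'a) qtld \<Rightarrow> ('p, 'b) qtld \<Rightarrow> ('o, 'a, 'p, 'b) qmap \<Rightarrow> bool" where
  "quantaloid_equivalence C D F \<longleftrightarrow>
     quantaloid_hom C D F \<and> (\<exists>G. category_equivalence C D F G)"

definition equivalent_quantaloids :: "('o, 'a) qtld \<Rightarrow> ('p, 'b) qtld \<Rightarrow> bool" where
  "equivalent_quantaloids C D \<longleftrightarrow> (\<exists>F. quantaloid_equivalence C D F)"


subsection \<open>Quotients\<close>

text \<open>For a congruence \<open>R\<close> the unions defining \<open>Cmp\<close> are single equivalence classes.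
  As the quotient map preserves joins, the class of \<open>f\<close> is below that of \<open>g\<close> iff the join of \<open>f\<close>
  and \<open>g\<close> is congruent to \<open>g\<close>, i.e. iff some members of the two classes are comparable.\<close>

definition quotient_qtld ::
  "('o, 'a) qtld \<Rightarrow> ('o \<Rightarrow> 'o \<Rightarrow> ('a \<times> 'a) set) \<Rightarrow> ('o, 'a set) qtld" where
  "quotient_qtld C R = \<lparr>
     Obj = Obj C,
     Hom = (\<lambda>p q. \<lparr>carrier = arrows C p q // R p q, eq = (=),
                   le = (\<lambda>A B. \<exists>f\<in>A. \<exists>g\<in>B. f \<sqsubseteq>\<^bsub>Hom C p q\<^esub> g)\<rparr>),
     Idn = (\<lambda>p. R p p `` {Idn C p}),
     Cmp = (\<lambda>p q r B A. \<Union>g\<in>B. \<Union>f\<in>A. R p r `` {Cmp C p q r g f})\<rparr>"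


subsection \<open>Arrows and diagonals\<close>

text \<open>An arrow \<open>\<phi> : X \<rightarrow> Y\<close> of \<open>C\<close>, as an object, is the triple \<open>(X, \<phi>, Y)\<close>.\<close>

definition arr_qtld :: "('o, 'a) qtld \<Rightarrow> ('o \<times> 'a \<times> 'o, 'a \<times> 'a) qtld" where
  "arr_qtld C = \<lparr>
     Obj = {(X, \<phi>, Y). X \<in> Obj C \<and> Y \<in> Obj C \<and> \<phi> \<in> arrows C X Y},
     Hom = (\<lambda>(X, \<phi>, Y) (X', \<psi>, Y'). \<lparr>
        carrier = {(\<zeta>, \<eta>). \<zeta> \<in> arrows C X X' \<and> \<eta> \<in> arrows C Y Y' \<and>
                     Cmp C X X' Y' \<psi> \<zeta> = Cmp C X Y Y' \<eta> \<phi>},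
        eq = (=),
        le = (\<lambda>(\<zeta>, \<eta>) (\<zeta>', \<eta>'). \<zeta> \<sqsubseteq>\<^bsub>Hom C X X'\<^esub> \<zeta>' \<and> \<eta> \<sqsubseteq>\<^bsub>Hom C Y Y'\<^esub> \<eta>')\<rparr>),
     Idn = (\<lambda>(X, \<phi>, Y). (Idn C X, Idn C Y)),
     Cmp = (\<lambda>(X, \<phi>, Y) (X', \<psi>, Y') (X'', \<chi>, Y'') (\<zeta>', \<eta>') (\<zeta>, \<eta>).
        (Cmp C X X' X'' \<zeta>' \<zeta>, Cmp C Y Y' Y'' \<eta>' \<eta>))\<rparr>"

definition diag_rel :: "('o, 'a) qtld \<Rightarrow> 'o \<times> 'a \<times> 'o \<Rightarrow> 'o \<times> 'a \<times> 'o \<Rightarrow>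
    (('a \<times> 'a) \<times> ('a \<times> 'a)) set" where
  "diag_rel C = (\<lambda>(X, \<phi>, Y) (X', \<psi>, Y').
     {((\<zeta>, \<eta>), (\<zeta>', \<eta>')).
        (\<zeta>, \<eta>) \<in> arrows (arr_qtld C) (X, \<phi>, Y) (X', \<psi>, Y') \<and>
        (\<zeta>', \<eta>') \<in> arrows (arr_qtld C) (X, \<phi>, Y) (X', \<psi>, Y') \<and>
        Cmp C X X' Y' \<psi> \<zeta> = Cmp C X X' Y' \<psi> \<zeta>'})"

definition diag_qtld :: "('o, 'a) qtld \<Rightarrow> ('o \<times> 'a \<times> 'o, ('a \<times> 'a) set) qtld" where
  "diag_qtld C = quotient_qtld (arr_qtld C) (diag_rel C)"


section \<open>\<open>Q\<close>-categories, \<open>Q\<close>-distributors, \<open>Q\<close>-functors\<close>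

text \<open>\<open>Q\<close>-categories may have points of any type \<open>'v\<close>; only the objects of \<open>Q\<close>-Dist are confined to
  the universe \<open>'u\<close>.  All functions are extensional, so that equality is equality of structures.\<close>

record ('v, 'o, 'a) qcat =
  pts :: "'v set"
  tp :: "'v \<Rightarrow> 'o"
  hm :: "'v \<times> 'v \<Rightarrow> 'a"

definition qcategory :: "('o, 'a) qtld \<Rightarrow> ('v, 'o, 'a) qcat \<Rightarrow> bool" where
  "qcategory Q X \<longleftrightarrow>
     tp X \<in> pts X \<rightarrow>\<^sub>E Obj Q \<and>
     hm X \<in> (\<Pi>\<^sub>E (x, y) \<in> pts X \<times> pts X. arrows Q (tp X x) (tp X y)) \<and>
     (\<forall>x\<in>pts X. Idn Q (tp X x) \<sqsubseteq>\<^bsub>Hom Q (tp X x) (tp X x)\<^esub> hm X (x, x)) \<and>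
     (\<forall>x\<in>pts X. \<forall>y\<in>pts X. \<forall>z\<in>pts X.
        Cmp Q (tp X x) (tp X y) (tp X z) (hm X (y, z)) (hm X (x, y))
          \<sqsubseteq>\<^bsub>Hom Q (tp X x) (tp X z)\<^esub> hm X (x, z))"

definition qle :: "('o, 'a) qtld \<Rightarrow> ('v, 'o, 'a) qcat \<Rightarrow> 'v \<Rightarrow> 'v \<Rightarrow> bool" where
  "qle Q X x y \<longleftrightarrow> tp X x = tp X y \<and> Idn Q (tp X x) \<sqsubseteq>\<^bsub>Hom Q (tp X x) (tp X x)\<^esub> hm X (x, y)"

definition qfunctor ::
  "('o, 'a) qtld \<Rightarrow> ('v, 'o, 'a) qcat \<Rightarrow> ('w, 'o, 'a) qcat \<Rightarrow> ('v \<Rightarrow> 'w) \<Rightarrow> bool" where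
  "qfunctor Q X Y f \<longleftrightarrow>
     f \<in> pts X \<rightarrow>\<^sub>E pts Y \<and>
     (\<forall>x\<in>pts X. tp Y (f x) = tp X x) \<and>
     (\<forall>x\<in>pts X. \<forall>x'\<in>pts X. hm X (x, x') \<sqsubseteq>\<^bsub>Hom Q (tp X x) (tp X x')\<^esub> hm Y (f x, f x'))"

definition qfunctor_le ::
  "('o, 'a) qtld \<Rightarrow> ('v, 'o, 'a) qcat \<Rightarrow> ('w, 'o, 'a) qcat \<Rightarrow> ('v \<Rightarrow> 'w) \<Rightarrow> ('v \<Rightarrow> 'w) \<Rightarrow> bool" where
  "qfunctor_le Q X Y f g \<longleftrightarrow> (\<forall>x\<in>pts X. qle Q Y (f x) (g x))"

definition dist ::
  "('o, 'a) qtld \<Rightarrow> ('v, 'o, 'a) qcat \<Rightarrow> ('w, 'o, 'a) qcat \<Rightarrow> ('v \<times> 'w \<Rightarrow> 'a) set" where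
  "dist Q X Y = {\<phi> \<in> (\<Pi>\<^sub>E (x, y) \<in> pts X \<times> pts Y. arrows Q (tp X x) (tp Y y)).
     \<forall>x\<in>pts X. \<forall>x'\<in>pts X. \<forall>y\<in>pts Y. \<forall>y'\<in>pts Y.
       Cmp Q (tp X x') (tp X x) (tp Y y')
           (Cmp Q (tp X x) (tp Y y) (tp Y y') (hm Y (y, y')) (\<phi> (x, y)))
           (hm X (x', x))
         \<sqsubseteq>\<^bsub>Hom Q (tp X x') (tp Y y')\<^esub> \<phi> (x', y')}"

definition dist_comp ::
  "('o, 'a) qtld \<Rightarrow> ('v, 'o, 'a) qcat \<Rightarrow> ('w, 'o, 'a) qcat \<Rightarrow> ('z, 'o, 'a) qcat \<Rightarrow>
   ('w \<times> 'z \<Rightarrow> 'a) \<Rightarrow> ('v \<times> 'w \<Rightarrow> 'a) \<Rightarrow> ('v \<times> 'z \<Rightarrow> 'a)" where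
  "dist_comp Q X Y Z \<psi> \<phi> = (\<lambda>(x, z)\<in>pts X \<times> pts Z.
     \<Squnion>\<^bsub>Hom Q (tp X x) (tp Z z)\<^esub>
       ((\<lambda>y. Cmp Q (tp X x) (tp Y y) (tp Z z) (\<psi> (y, z)) (\<phi> (x, y))) ` pts Y))"

text \<open>\<open>\<xi> \<swarrow> \<phi> : Y \<rightarrow> Z\<close> for \<open>\<phi> : X \<rightarrow> Y\<close> and \<open>\<xi> : X \<rightarrow> Z\<close>.\<close>

definition dist_lres ::
  "('o, 'a) qtld \<Rightarrow> ('v, 'o, 'a) qcat \<Rightarrow> ('w, 'o, 'a) qcat \<Rightarrow> ('z, 'o, 'a) qcat \<Rightarrow>
   ('v \<times> 'z \<Rightarrow> 'a) \<Rightarrow> ('v \<times> 'w \<Rightarrow> 'a) \<Rightarrow> ('w \<times> 'z \<Rightarrow> 'a)" where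
  "dist_lres Q X Y Z \<xi> \<phi> = (\<lambda>(y, z)\<in>pts Y \<times> pts Z.
     \<Sqinter>\<^bsub>Hom Q (tp Y y) (tp Z z)\<^esub>
       ((\<lambda>x. lres Q (tp X x) (tp Y y) (tp Z z) (\<xi> (x, z)) (\<phi> (x, y))) ` pts X))"

definition cograph ::
  "('v, 'o, 'a) qcat \<Rightarrow> ('w, 'o, 'a) qcat \<Rightarrow> ('v \<Rightarrow> 'w) \<Rightarrow> ('w \<times> 'v \<Rightarrow> 'a)" where
  "cograph X Y f = (\<lambda>(y, x)\<in>pts Y \<times> pts X. hm Y (y, f x))"

definition full_subcat :: "('v, 'o, 'a) qcat \<Rightarrow> 'v set \<Rightarrow> ('v, 'o, 'a) qcat" where
  "full_subcat X S = \<lparr>pts = S, tp = restrict (tp X) S, hm = restrict (hm X) (S \<times> S)\<rparr>"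

definition qdist_qtld ::
  "('u set \<Rightarrow> bool) \<Rightarrow> ('u, 'u) qtld \<Rightarrow> (('u, 'u, 'u) qcat, 'u \<times> 'u \<Rightarrow> 'u) qtld" where
  "qdist_qtld small Q = \<lparr>
     Obj = {X. qcategory Q X \<and> small (pts X)},
     Hom = (\<lambda>X Y. \<lparr>carrier = dist Q X Y, eq = (=),
        le = (\<lambda>\<phi> \<psi>. \<forall>x\<in>pts X. \<forall>y\<in>pts Y. \<phi> (x, y) \<sqsubseteq>\<^bsub>Hom Q (tp X x) (tp Y y)\<^esub> \<psi> (x, y))\<rparr>),
     Idn = hm,
     Cmp = dist_comp Q\<rparr>"


section \<open>Presheaves and Kan adjunctions\<close>

definition one_cat :: "('o, 'a) qtld \<Rightarrow> 'o \<Rightarrow> (unit, 'o, 'a) qcat" where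
  "one_cat Q q = \<lparr>pts = {()}, tp = (\<lambda>_. q), hm = (\<lambda>_. Idn Q q)\<rparr>"

text \<open>A presheaf of type \<open>q\<close> is a pair \<open>(q, \<mu>)\<close> with \<open>\<mu>\<close> a distributor to \<open>one_cat Q q\<close>;
  its value at \<open>x\<close> is \<open>\<mu> (x, ())\<close>.\<close>

type_synonym ('v, 'o, 'a) presheaf = "'o \<times> ('v \<times> unit \<Rightarrow> 'a)"

definition psh_pts :: "('o, 'a) qtld \<Rightarrow> ('v, 'o, 'a) qcat \<Rightarrow> ('v, 'o, 'a) presheaf set" where
  "psh_pts Q X = {(q, \<mu>). q \<in> Obj Q \<and> \<mu> \<in> dist Q X (one_cat Q q)}"

definition psh ::
  "('o, 'a) qtld \<Rightarrow> ('v, 'o, 'a) qcat \<Rightarrow> (('v, 'o, 'a) presheaf, 'o, 'a) qcat" where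
  "psh Q X = \<lparr>
     pts = psh_pts Q X,
     tp = restrict fst (psh_pts Q X),
     hm = (\<lambda>((q, \<mu>), (q', \<mu>'))\<in>psh_pts Q X \<times> psh_pts Q X.
        dist_lres Q X (one_cat Q q) (one_cat Q q') \<mu>' \<mu> ((), ()))\<rparr>"

text \<open>\<open>kan_pull\<close> and \<open>kan_push\<close> are \<open>\<phi>\<^sup>* : PY \<rightarrow> PX\<close> and its right adjoint \<open>\<phi>\<^sub>* : PX \<rightarrow> PY\<close>.\<close>

definition kan_pull ::
  "('o, 'a) qtld \<Rightarrow> ('v, 'o, 'a) qcat \<Rightarrow> ('w, 'o, 'a) qcat \<Rightarrow> ('v \<times> 'w \<Rightarrow> 'a) \<Rightarrow>
   ('w, 'o, 'a) presheaf \<Rightarrow> ('v, 'o, 'a) presheaf" where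
  "kan_pull Q X Y \<phi> = (\<lambda>(q, \<nu>)\<in>psh_pts Q Y. (q, dist_comp Q X Y (one_cat Q q) \<nu> \<phi>))"

definition kan_push ::
  "('o, 'a) qtld \<Rightarrow> ('v, 'o, 'a) qcat \<Rightarrow> ('w, 'o, 'a) qcat \<Rightarrow> ('v \<times> 'w \<Rightarrow> 'a) \<Rightarrow>
   ('v, 'o, 'a) presheaf \<Rightarrow> ('w, 'o, 'a) presheaf" where
  "kan_push Q X Y \<phi> = (\<lambda>(q, \<mu>)\<in>psh_pts Q X. (q, dist_lres Q X Y (one_cat Q q) \<mu> \<phi>))"


section \<open>Interior spaces\<close>

type_synonym ('v, 'o, 'a) psh_op = "('v, 'o, 'a) presheaf \<Rightarrow> ('v, 'o, 'a) presheaf"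

definition interior_space ::
  "('o, 'a) qtld \<Rightarrow> ('v, 'o, 'a) qcat \<Rightarrow> ('v, 'o, 'a) psh_op \<Rightarrow> bool" where
  "interior_space Q X a \<longleftrightarrow>
     qcategory Q X \<and>
     qfunctor Q (psh Q X) (psh Q X) a \<and>
     qfunctor_le Q (psh Q X) (psh Q X) a (\<lambda>\<mu>. \<mu>) \<and>
     (\<forall>\<mu>\<in>psh_pts Q X. a (a \<mu>) = a \<mu>)"

definition open_pts ::
  "('o, 'a) qtld \<Rightarrow> ('v, 'o, 'a) qcat \<Rightarrow> ('v, 'o, 'a) psh_op \<Rightarrow> ('v, 'o, 'a) presheaf set" where
  "open_pts Q X a = {\<mu> \<in> psh_pts Q X. a \<mu> = \<mu>}"

definition open_cat ::
  "('o, 'a) qtld \<Rightarrow> ('v, 'o, 'a) qcat \<Rightarrow> ('v, 'o, 'a) psh_op \<Rightarrow>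
   (('v, 'o, 'a) presheaf, 'o, 'a) qcat" where
  "open_cat Q X a = full_subcat (psh Q X) (open_pts Q X a)"

definition cont_dist ::
  "('o, 'a) qtld \<Rightarrow> ('v, 'o, 'a) qcat \<Rightarrow> ('v, 'o, 'a) psh_op \<Rightarrow>
   ('w, 'o, 'a) qcat \<Rightarrow> ('w, 'o, 'a) psh_op \<Rightarrow> ('v \<times> 'w \<Rightarrow> 'a) set" where
  "cont_dist Q X a Y b = {\<zeta> \<in> dist Q X Y.
     qfunctor_le Q (psh Q Y) (psh Q X)
       (compose (psh_pts Q Y) (kan_pull Q X Y \<zeta>) b)
       (compose (psh_pts Q Y) a (kan_pull Q X Y \<zeta>))}"

definition intdist_qtld ::
  "('u set \<Rightarrow> bool) \<Rightarrow> ('u, 'u) qtld \<Rightarrow>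
   (('u, 'u, 'u) qcat \<times> ('u, 'u, 'u) psh_op, 'u \<times> 'u \<Rightarrow> 'u) qtld" where
  "intdist_qtld small Q = \<lparr>
     Obj = {(X, a). interior_space Q X a \<and> small (pts X)},
     Hom = (\<lambda>(X, a) (Y, b). (Hom (qdist_qtld small Q) X Y)\<lparr>carrier := cont_dist Q X a Y b\<rparr>),
     Idn = (\<lambda>(X, a). Idn (qdist_qtld small Q) X),
     Cmp = (\<lambda>(X, a) (Y, b) (Z, c). Cmp (qdist_qtld small Q) X Y Z)\<rparr>"

definition open_rel ::
  "('o, 'a) qtld \<Rightarrow> ('v, 'o, 'a) qcat \<times> ('v, 'o, 'a) psh_op \<Rightarrow>
   ('w, 'o, 'a) qcat \<times> ('w, 'o, 'a) psh_op \<Rightarrow> (('v \<times> 'w \<Rightarrow> 'a) \<times> ('v \<times> 'w \<Rightarrow> 'a)) set" where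
  "open_rel Q = (\<lambda>(X, a) (Y, b).
     {(\<zeta>, \<zeta>'). \<zeta> \<in> cont_dist Q X a Y b \<and> \<zeta>' \<in> cont_dist Q X a Y b \<and>
        compose (psh_pts Q Y) (kan_pull Q X Y \<zeta>) b = compose (psh_pts Q Y) (kan_pull Q X Y \<zeta>') b})"

definition intdist_o_qtld ::
  "('u set \<Rightarrow> bool) \<Rightarrow> ('u, 'u) qtld \<Rightarrow>
   (('u, 'u, 'u) qcat \<times> ('u, 'u, 'u) psh_op, ('u \<times> 'u \<Rightarrow> 'u) set) qtld" where
  "intdist_o_qtld small Q = quotient_qtld (intdist_qtld small Q) (open_rel Q)"


section \<open>The two homomorphisms\<close>

text \<open>A map on equivalence classes is given as the union of the classes assigned to the
  representatives.  It takes values in a quotient hom-set, as a functor must, only if it is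
  independent of the representative.\<close>

type_synonym 'u arr_obj = "('u, 'u, 'u) qcat \<times> ('u \<times> 'u \<Rightarrow> 'u) \<times> ('u, 'u, 'u) qcat"
type_synonym 'u int_obj = "('u, 'u, 'u) qcat \<times> ('u, 'u, 'u) psh_op"

definition Khat_obj :: "('u, 'u) qtld \<Rightarrow> 'u arr_obj \<Rightarrow> 'u int_obj" where
  "Khat_obj Q = (\<lambda>(X, \<phi>, Y). (X, compose (psh_pts Q X) (kan_pull Q X Y \<phi>) (kan_push Q X Y \<phi>)))"

definition Khat :: "('u, 'u) qtld \<Rightarrow>
    ('u arr_obj, (('u \<times> 'u \<Rightarrow> 'u) \<times> ('u \<times> 'u \<Rightarrow> 'u)) set,
     'u int_obj, ('u \<times> 'u \<Rightarrow> 'u) set) qmap" where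
  "Khat Q = \<lparr>
     on_obj = Khat_obj Q,
     on_arr = (\<lambda>P P' A. \<Union>(\<zeta>, \<eta>)\<in>A. open_rel Q (Khat_obj Q P) (Khat_obj Q P') `` {\<zeta>})\<rparr>"

text \<open>The points of \<open>open_cat Q X a\<close> are presheaves.  To obtain an object of \<open>Q\<close>-Dist they are
  replaced by the sets in the universe \<open>'u\<close> that represent them, namely the pair of the type and
  the graph of the presheaf; \<open>relabel_cat\<close> and \<open>relabel_dist\<close> transport the structure along this
  injection.\<close>

definition psh_code ::
  "('u set \<Rightarrow> 'u) \<Rightarrow> ('u, 'u, 'u) qcat \<Rightarrow> ('u, 'u, 'u) presheaf \<Rightarrow> 'u" where
  "psh_code code X = (\<lambda>(q, \<mu>). kpair code q (code ((\<lambda>x. kpair code x (\<mu> (x, ()))) ` pts X)))"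

definition relabel_cat :: "('v \<Rightarrow> 'w) \<Rightarrow> ('v, 'o, 'a) qcat \<Rightarrow> ('w, 'o, 'a) qcat" where
  "relabel_cat e Z = (let S = pts Z; d = inv_into S e in
     \<lparr>pts = e ` S, tp = (\<lambda>u\<in>e ` S. tp Z (d u)),
      hm = (\<lambda>(u, v)\<in>e ` S \<times> e ` S. hm Z (d u, d v))\<rparr>)"

definition relabel_dist ::
  "'v set \<Rightarrow> ('v \<Rightarrow> 'w) \<Rightarrow> 'x set \<Rightarrow> ('x \<Rightarrow> 'y) \<Rightarrow> ('v \<times> 'x \<Rightarrow> 'a) \<Rightarrow> ('w \<times> 'y \<Rightarrow> 'a)" where
  "relabel_dist S e T e' \<phi> =
     (\<lambda>(u, v)\<in>e ` S \<times> e' ` T. \<phi> (inv_into S e u, inv_into T e' v))"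

definition kappa ::
  "('o, 'a) qtld \<Rightarrow> ('v, 'o, 'a) qcat \<Rightarrow> ('v, 'o, 'a) psh_op \<Rightarrow>
   ('v \<times> ('v, 'o, 'a) presheaf \<Rightarrow> 'a)" where
  "kappa Q X a = (\<lambda>(x, (q, \<mu>))\<in>pts X \<times> open_pts Q X a. \<mu> (x, ()))"

definition restricted_cograph ::
  "('o, 'a) qtld \<Rightarrow> ('v, 'o, 'a) qcat \<Rightarrow> ('v, 'o, 'a) psh_op \<Rightarrow>
   ('w, 'o, 'a) qcat \<Rightarrow> ('w, 'o, 'a) psh_op \<Rightarrow> ('v \<times> 'w \<Rightarrow> 'a) \<Rightarrow>
   (('v, 'o, 'a) presheaf \<times> ('w, 'o, 'a) presheaf \<Rightarrow> 'a)" where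
  "restricted_cograph Q X a Y b \<zeta> =
     restrict (cograph (psh Q Y) (psh Q X) (kan_pull Q X Y \<zeta>)) (open_pts Q X a \<times> open_pts Q Y b)"

definition Ihat_obj :: "('u set \<Rightarrow> 'u) \<Rightarrow> ('u, 'u) qtld \<Rightarrow> 'u int_obj \<Rightarrow> 'u arr_obj" where
  "Ihat_obj code Q = (\<lambda>(X, a).
     (X, relabel_dist (pts X) (\<lambda>x. x) (open_pts Q X a) (psh_code code X) (kappa Q X a),
      relabel_cat (psh_code code X) (open_cat Q X a)))"

definition Ihat_rep :: "('u set \<Rightarrow> 'u) \<Rightarrow> ('u, 'u) qtld \<Rightarrow> 'u int_obj \<Rightarrow> 'u int_obj \<Rightarrow>
    ('u \<times> 'u \<Rightarrow> 'u) \<Rightarrow> ('u \<times> 'u \<Rightarrow> 'u) \<times> ('u \<times> 'u \<Rightarrow> 'u)" where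
  "Ihat_rep code Q = (\<lambda>(X, a) (Y, b) \<zeta>.
     (\<zeta>, relabel_dist (open_pts Q X a) (psh_code code X) (open_pts Q Y b) (psh_code code Y)
           (restricted_cograph Q X a Y b \<zeta>)))"

definition Ihat :: "('u set \<Rightarrow> bool) \<Rightarrow> ('u set \<Rightarrow> 'u) \<Rightarrow> ('u, 'u) qtld \<Rightarrow>
    ('u int_obj, ('u \<times> 'u \<Rightarrow> 'u) set,
     'u arr_obj, (('u \<times> 'u \<Rightarrow> 'u) \<times> ('u \<times> 'u \<Rightarrow> 'u)) set) qmap" where
  "Ihat small code Q = \<lparr>
     on_obj = Ihat_obj code Q,
     on_arr = (\<lambda>P P' A. \<Union>\<zeta>\<in>A.
        diag_rel (qdist_qtld small Q) (Ihat_obj code Q P) (Ihat_obj code Q P')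
          `` {Ihat_rep code Q P P' \<zeta>})\<rparr>"

end

theory Submission
  imports Defs
begin

text \<open>
  The class of a diagonal \<open>(\<zeta>, \<eta>)\<close> depends only on \<open>\<zeta>\<close>, and a distributor \<open>\<zeta>\<close> is continuous iff \<open>\<zeta>\<^sup>*\<close> maps
  open presheaves to open ones, its class being the restriction of \<open>\<zeta>\<^sup>*\<close> to them.  The open presheaves of
  \<open>\<phi>\<^sup>* \<phi>\<^sub>*\<close> are the \<open>\<phi>\<^sup>* \<nu>\<close>, and \<open>\<psi> \<circ> \<zeta> = \<eta> \<circ> \<phi>\<close> gives \<open>\<zeta>\<^sup>* \<psi>\<^sup>* = \<phi>\<^sup>* \<eta>\<^sup>*\<close>; in the other direction
  \<open>(\<kappa> \<circ> \<zeta>)(x, \<nu>) = (\<zeta>\<^sup>* \<nu>)(x)\<close>.  As an interior operator is determined by its open presheaves, and those of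
  \<open>\<kappa>\<^sup>* \<kappa>\<^sub>*\<close> for \<open>\<kappa> = \<kappa>\<^sub>a\<close> are those of \<open>a\<close>, the composite \<open>K I\<close> is the identity on objects.  For
  \<open>\<phi> : X \<rightarrow> Y\<close> and \<open>a = \<phi>\<^sup>* \<phi>\<^sub>*\<close> the distributors \<open>\<kappa>\<^sub>a\<close> and \<open>\<phi>\<close> factor through each other, via
  \<open>\<mu>, y \<mapsto> 1(\<mu>, \<phi>(-, y))\<close> and \<open>y, \<mu> \<mapsto> (\<phi>\<^sub>* \<mu>)(y)\<close>, so the identity of \<open>X\<close> underlies an isomorphism of
  diagonals from \<open>\<kappa>\<^sub>a\<close> to \<open>\<phi>\<close>.
\<close>

section \<open>Complete lattices and quantaloids\<close>

text \<open>Two points shape the proof. First, the open presheaves of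
  \<open>\<kappa>\<^sup>* \<kappa>\<^sub>*\<close> are those of \<open>a\<close> because
  \<open>a\<close> is a Q-functor and not merely monotone: k = \<open>\<kappa>\<^sup>* \<nu>\<close>
  is the join of the presheaves v \<circ> \<mu> with \<mu> open and v = \<nu>(\<mu>) an arrow of Q,
  and v \<le> 1(\<mu>, k) \<le> 1(a \<mu>, a k) = 1(\<mu>, a k) puts v \<circ> \<mu> below a k.
  Secondly, second components are awkward: passing from \<zeta> to its restricted cograph does not
  preserve joins in general. Therefore all laws are stated for representatives and only up to the
  congruence. They become statements about first components, on which both homomorphisms act as the
  identity; second components contribute no more than the commutativity of the squares. Since
  \<kappa> has to be an arrow between Q-categories inside the universe, open presheaves are coded as
  elements of it; their codes form a set because Q is small.\<close>

lemma complete_lattice_if_lubs: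
  fixes L :: "'a gorder"
  assumes eq: "eq L = (=)"
    and refl: "\<And>x. x \<in> carrier L \<Longrightarrow> x \<sqsubseteq>\<^bsub>L\<^esub> x"
    and antisym: "\<And>x y. \<lbrakk>x \<in> carrier L; y \<in> carrier L; x \<sqsubseteq>\<^bsub>L\<^esub> y; y \<sqsubseteq>\<^bsub>L\<^esub> x\<rbrakk> \<Longrightarrow> x = y"
    and trans: "\<And>x y z. \<lbrakk>x \<in> carrier L; y \<in> carrier L; z \<in> carrier L; x \<sqsubseteq>\<^bsub>L\<^esub> y; y \<sqsubseteq>\<^bsub>L\<^esub> z\<rbrakk>
      \<Longrightarrow> x \<sqsubseteq>\<^bsub>L\<^esub> z"
    and lub: "\<And>A. A \<subseteq> carrier L \<Longrightarrow>
      \<exists>s\<in>carrier L. \<forall>b\<in>carrier L. s \<sqsubseteq>\<^bsub>L\<^esub> b \<longleftrightarrow> (\<forall>a\<in>A. a \<sqsubseteq>\<^bsub>L\<^esub> b)"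
  shows "complete_lattice L"
proof -
  interpret partial_order L
    by unfold_locales (auto simp: eq intro: refl antisym trans)
  show ?thesis
  proof
    fix A assume A: "A \<subseteq> carrier L"
    obtain s where s: "s \<in> carrier L" "\<forall>b\<in>carrier L. s \<sqsubseteq>\<^bsub>L\<^esub> b \<longleftrightarrow> (\<forall>a\<in>A. a \<sqsubseteq>\<^bsub>L\<^esub> b)"
      using lub[OF A] by blast
    then have "\<forall>a\<in>A. a \<sqsubseteq>\<^bsub>L\<^esub> s"
      using refl by blast
    with s A show "\<exists>s. least L s (Upper L A)"
      by (intro exI[of _ s] least_UpperI) (auto simp: Upper_def)
  next
    fix A assume A: "A \<subseteq> carrier L"
    \<comment> \<open>The infimum of \<open>A\<close> is obtained as the supremum of its lower
      bounds.\<close>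
    have low: "Lower L A \<subseteq> carrier L"
      by simp
    obtain s where s: "s \<in> carrier L" "\<forall>b\<in>carrier L. s \<sqsubseteq>\<^bsub>L\<^esub> b \<longleftrightarrow> (\<forall>a\<in>Lower L A. a \<sqsubseteq>\<^bsub>L\<^esub> b)"
      using lub[OF low] by blast
    have "\<forall>a\<in>Lower L A. a \<sqsubseteq>\<^bsub>L\<^esub> s"
      using s refl by blast
    moreover have "\<forall>a\<in>A. s \<sqsubseteq>\<^bsub>L\<^esub> a"
      using s A by (auto simp: Lower_def)
    ultimately show "\<exists>i. greatest L i (Lower L A)"
      using s A by (intro exI[of _ s] greatest_LowerI) auto
  qed
qed

context complete_lattice
begin

lemma sup_le_iff:
  assumes "A \<subseteq> carrier L" "b \<in> carrier L"
  shows "\<Squnion>A \<sqsubseteq> b \<longleftrightarrow> (\<forall>a\<in>A. a \<sqsubseteq> b)"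
  using assms sup_upper sup_least sup_closed le_trans by (meson subsetD)

lemma le_inf_iff:
  assumes "A \<subseteq> carrier L" "b \<in> carrier L"
  shows "b \<sqsubseteq> \<Sqinter>A \<longleftrightarrow> (\<forall>a\<in>A. b \<sqsubseteq> a)"
  using assms inf_lower inf_greatest inf_closed le_trans by (meson subsetD)

text \<open>The join and \<open>s\<close> have the same elements above them, so each lies below the
  other. Joins in all derived hom-lattices are identified by this rule.\<close>

lemma sup_eqI:
  assumes "A \<subseteq> carrier L" "s \<in> carrier L" "\<And>b. b \<in> carrier L \<Longrightarrow> s \<sqsubseteq> b \<longleftrightarrow> (\<forall>a\<in>A. a \<sqsubseteq> b)"
  shows "\<Squnion>A = s"
  using assms sup_le_iff[OF assms(1)] sup_closed[OF assms(1)] le_refl le_antisym by metis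

end

context quantaloid
begin

lemma hom_refl: "\<lbrakk>p \<in> Obj Q; q \<in> Obj Q; u \<in> arrows Q p q\<rbrakk> \<Longrightarrow> u \<sqsubseteq>\<^bsub>Hom Q p q\<^esub> u"
proof -
  assume a: "p \<in> Obj Q" "q \<in> Obj Q" "u \<in> arrows Q p q"
  interpret complete_lattice "Hom Q p q" using a by (simp add: hom_complete_lattice)
  show ?thesis using a by simp
qed

lemma hom_antisym:
  assumes "p \<in> Obj Q" "q \<in> Obj Q" "u \<in> arrows Q p q" "v \<in> arrows Q p q"
    and "u \<sqsubseteq>\<^bsub>Hom Q p q\<^esub> v" "v \<sqsubseteq>\<^bsub>Hom Q p q\<^esub> u"
  shows "u = v"
proof -
  interpret complete_lattice "Hom Q p q" using assms by (simp add: hom_complete_lattice)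
  show ?thesis using assms by (auto intro: le_antisym)
qed

lemma hom_trans:
  assumes "p \<in> Obj Q" "q \<in> Obj Q" "u \<in> arrows Q p q" "v \<in> arrows Q p q" "w \<in> arrows Q p q"
    and "u \<sqsubseteq>\<^bsub>Hom Q p q\<^esub> v" "v \<sqsubseteq>\<^bsub>Hom Q p q\<^esub> w"
  shows "u \<sqsubseteq>\<^bsub>Hom Q p q\<^esub> w"
proof -
  interpret complete_lattice "Hom Q p q" using assms by (simp add: hom_complete_lattice)
  show ?thesis using assms le_trans by blast
qed

text \<open>Take \<open>b\<close> to be \<open>v\<close> and then \<open>u\<close>. The point of
  this form is that "a join lies below \<open>b\<close>" unfolds to a condition on the joinands, so
  equations between iterated joins become equivalences of quantified statements.\<close>

lemma hom_eqI:
  assumes "p \<in> Obj Q" "q \<in> Obj Q" "u \<in> arrows Q p q" "v \<in> arrows Q p q"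
    and "\<And>b. b \<in> arrows Q p q \<Longrightarrow> u \<sqsubseteq>\<^bsub>Hom Q p q\<^esub> b \<longleftrightarrow> v \<sqsubseteq>\<^bsub>Hom Q p q\<^esub> b"
  shows "u = v"
  using assms hom_refl hom_antisym by metis

lemma Sup_arrow [simp]:
  assumes "p \<in> Obj Q" "q \<in> Obj Q" "A \<subseteq> arrows Q p q"
  shows "\<Squnion>\<^bsub>Hom Q p q\<^esub> A \<in> arrows Q p q"
proof -
  interpret complete_lattice "Hom Q p q" using assms by (simp add: hom_complete_lattice)
  show ?thesis using assms by simp
qed

lemma Inf_arrow [simp]:
  assumes "p \<in> Obj Q" "q \<in> Obj Q" "A \<subseteq> arrows Q p q"
  shows "\<Sqinter>\<^bsub>Hom Q p q\<^esub> A \<in> arrows Q p q"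
proof -
  interpret complete_lattice "Hom Q p q" using assms by (simp add: hom_complete_lattice)
  show ?thesis using assms by simp
qed

lemma Sup_le_iff:
  assumes "p \<in> Obj Q" "q \<in> Obj Q" "A \<subseteq> arrows Q p q" "b \<in> arrows Q p q"
  shows "\<Squnion>\<^bsub>Hom Q p q\<^esub> A \<sqsubseteq>\<^bsub>Hom Q p q\<^esub> b \<longleftrightarrow> (\<forall>a\<in>A. a \<sqsubseteq>\<^bsub>Hom Q p q\<^esub> b)"
proof -
  interpret complete_lattice "Hom Q p q" using assms by (simp add: hom_complete_lattice)
  show ?thesis using assms sup_le_iff by simp
qed

lemma le_Inf_iff:
  assumes "p \<in> Obj Q" "q \<in> Obj Q" "A \<subseteq> arrows Q p q" "b \<in> arrows Q p q"
  shows "b \<sqsubseteq>\<^bsub>Hom Q p q\<^esub> \<Sqinter>\<^bsub>Hom Q p q\<^esub> A \<longleftrightarrow> (\<forall>a\<in>A. b \<sqsubseteq>\<^bsub>Hom Q p q\<^esub> a)"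
proof -
  interpret complete_lattice "Hom Q p q" using assms by (simp add: hom_complete_lattice)
  show ?thesis using assms le_inf_iff by simp
qed

lemma Sup_upper:
  assumes "p \<in> Obj Q" "q \<in> Obj Q" "A \<subseteq> arrows Q p q" "a \<in> A"
  shows "a \<sqsubseteq>\<^bsub>Hom Q p q\<^esub> \<Squnion>\<^bsub>Hom Q p q\<^esub> A"
  using assms Sup_le_iff[OF assms(1-3) Sup_arrow[OF assms(1-3)]] hom_refl[OF assms(1,2)] Sup_arrow[OF assms(1-3)]
  by blast

lemma Sup_eqI:
  assumes "p \<in> Obj Q" "q \<in> Obj Q" "A \<subseteq> arrows Q p q" "s \<in> arrows Q p q"
    and "\<And>b. b \<in> arrows Q p q \<Longrightarrow> s \<sqsubseteq>\<^bsub>Hom Q p q\<^esub> b \<longleftrightarrow> (\<forall>a\<in>A. a \<sqsubseteq>\<^bsub>Hom Q p q\<^esub> b)"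
  shows "\<Squnion>\<^bsub>Hom Q p q\<^esub> A = s"
  using assms by (intro hom_eqI[of p q]) (auto simp: Sup_le_iff)

text \<open>Turns an inequality into an equation between joins, to which preservation of joins
  applies.\<close>

lemma le_iff_Sup:
  assumes "p \<in> Obj Q" "q \<in> Obj Q" "u \<in> arrows Q p q" "v \<in> arrows Q p q"
  shows "u \<sqsubseteq>\<^bsub>Hom Q p q\<^esub> v \<longleftrightarrow> \<Squnion>\<^bsub>Hom Q p q\<^esub> {u, v} = v"
proof
  assume uv: "u \<sqsubseteq>\<^bsub>Hom Q p q\<^esub> v"
  show "\<Squnion>\<^bsub>Hom Q p q\<^esub> {u, v} = v"
    using assms uv by (intro Sup_eqI) (auto intro: hom_trans[of p q u v])
next
  assume "\<Squnion>\<^bsub>Hom Q p q\<^esub> {u, v} = v"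
  then show "u \<sqsubseteq>\<^bsub>Hom Q p q\<^esub> v"
    using Sup_upper[of p q "{u, v}" u] assms by simp
qed

text \<open>Monotonicity in each variable is preservation of the joins of \<open>{u, u'}\<close> and
  of \<open>{v, v'}\<close>; the two are then chained.\<close>

lemma cmp_mono:
  assumes obj: "p \<in> Obj Q" "q \<in> Obj Q" "r \<in> Obj Q"
    and u: "u \<in> arrows Q p q" "u' \<in> arrows Q p q" "u \<sqsubseteq>\<^bsub>Hom Q p q\<^esub> u'"
    and v: "v \<in> arrows Q q r" "v' \<in> arrows Q q r" "v \<sqsubseteq>\<^bsub>Hom Q q r\<^esub> v'"
  shows "Cmp Q p q r v u \<sqsubseteq>\<^bsub>Hom Q p r\<^esub> Cmp Q p q r v' u'"
proof -
  have "Cmp Q p q r v u \<sqsubseteq>\<^bsub>Hom Q p r\<^esub> Cmp Q p q r v u'"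
  proof -
    have "\<Squnion>\<^bsub>Hom Q p q\<^esub> {u, u'} = u'"
      using le_iff_Sup[OF obj(1,2) u(1,2)] u(3) by simp
    then have "\<Squnion>\<^bsub>Hom Q p r\<^esub> {Cmp Q p q r v u, Cmp Q p q r v u'} = Cmp Q p q r v u'"
      using cmp_Sup_right[OF obj, of "{u, u'}" v] u v by simp
    then show ?thesis
      using obj u v by (subst le_iff_Sup) (auto intro: cmp_arrow)
  qed
  moreover have "Cmp Q p q r v u' \<sqsubseteq>\<^bsub>Hom Q p r\<^esub> Cmp Q p q r v' u'"
  proof -
    have "\<Squnion>\<^bsub>Hom Q q r\<^esub> {v, v'} = v'"
      using le_iff_Sup[OF obj(2,3) v(1,2)] v(3) by simp
    then have "\<Squnion>\<^bsub>Hom Q p r\<^esub> {Cmp Q p q r v u', Cmp Q p q r v' u'} = Cmp Q p q r v' u'"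
      using cmp_Sup_left[OF obj, of u' "{v, v'}"] u v by simp
    then show ?thesis
      using obj u v by (subst le_iff_Sup) (auto intro: cmp_arrow)
  qed
  ultimately show ?thesis
    by (rule hom_trans[OF obj(1,3) cmp_arrow[OF obj u(1) v(1)] cmp_arrow[OF obj u(2) v(1)]
          cmp_arrow[OF obj u(2) v(2)]])
qed

lemma cmp_le_trans:
  assumes "p \<in> Obj Q" "q \<in> Obj Q" "r \<in> Obj Q"
    and "u \<in> arrows Q p q" "u' \<in> arrows Q p q" "u \<sqsubseteq>\<^bsub>Hom Q p q\<^esub> u'"
    and "v \<in> arrows Q q r" "v' \<in> arrows Q q r" "v \<sqsubseteq>\<^bsub>Hom Q q r\<^esub> v'"
    and "w \<in> arrows Q p r" "Cmp Q p q r v' u' \<sqsubseteq>\<^bsub>Hom Q p r\<^esub> w"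
  shows "Cmp Q p q r v u \<sqsubseteq>\<^bsub>Hom Q p r\<^esub> w"
  using assms cmp_mono[of p q r u u' v v']
  by (intro hom_trans[of p r "Cmp Q p q r v u" "Cmp Q p q r v' u'" w]) (auto intro: cmp_arrow)

lemma cmp_Sup_right_le_iff:
  assumes "p \<in> Obj Q" "q \<in> Obj Q" "r \<in> Obj Q" "A \<subseteq> arrows Q p q" "v \<in> arrows Q q r"
    and "w \<in> arrows Q p r"
  shows "Cmp Q p q r v (\<Squnion>\<^bsub>Hom Q p q\<^esub> A) \<sqsubseteq>\<^bsub>Hom Q p r\<^esub> w \<longleftrightarrow>
    (\<forall>u\<in>A. Cmp Q p q r v u \<sqsubseteq>\<^bsub>Hom Q p r\<^esub> w)"
proof -
  have "(\<lambda>u. Cmp Q p q r v u) ` A \<subseteq> arrows Q p r"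
    using assms by (auto intro: cmp_arrow)
  then show ?thesis
    using assms by (simp add: cmp_Sup_right Sup_le_iff)
qed

lemma cmp_Sup_left_le_iff:
  assumes "p \<in> Obj Q" "q \<in> Obj Q" "r \<in> Obj Q" "u \<in> arrows Q p q" "B \<subseteq> arrows Q q r"
    and "w \<in> arrows Q p r"
  shows "Cmp Q p q r (\<Squnion>\<^bsub>Hom Q q r\<^esub> B) u \<sqsubseteq>\<^bsub>Hom Q p r\<^esub> w \<longleftrightarrow>
    (\<forall>v\<in>B. Cmp Q p q r v u \<sqsubseteq>\<^bsub>Hom Q p r\<^esub> w)"
proof -
  have "(\<lambda>v. Cmp Q p q r v u) ` B \<subseteq> arrows Q p r"
    using assms by (auto intro: cmp_arrow)
  then show ?thesis
    using assms by (simp add: cmp_Sup_left Sup_le_iff)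
qed

text \<open>The definite description is met by the join of all v with v \<circ> u \<le> w. This join
  satisfies the inequality itself, as composition preserves joins in its left argument.\<close>

lemma lres_spec:
  assumes obj: "p \<in> Obj Q" "q \<in> Obj Q" "r \<in> Obj Q" and u: "u \<in> arrows Q p q"
    and w: "w \<in> arrows Q p r"
  shows "lres Q p q r w u \<in> arrows Q q r \<and>
    (\<forall>v\<in>arrows Q q r. Cmp Q p q r v u \<sqsubseteq>\<^bsub>Hom Q p r\<^esub> w \<longleftrightarrow> v \<sqsubseteq>\<^bsub>Hom Q q r\<^esub> lres Q p q r w u)"
proof -
  let ?P = "\<lambda>e. e \<in> arrows Q q r \<and>
     (\<forall>v\<in>arrows Q q r. Cmp Q p q r v u \<sqsubseteq>\<^bsub>Hom Q p r\<^esub> w \<longleftrightarrow> v \<sqsubseteq>\<^bsub>Hom Q q r\<^esub> e)"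
  let ?B = "{v \<in> arrows Q q r. Cmp Q p q r v u \<sqsubseteq>\<^bsub>Hom Q p r\<^esub> w}"
  let ?s = "\<Squnion>\<^bsub>Hom Q q r\<^esub> ?B"
  have B: "?B \<subseteq> arrows Q q r"
    by auto
  have s: "?s \<in> arrows Q q r"
    using obj B by simp
  have le: "Cmp Q p q r ?s u \<sqsubseteq>\<^bsub>Hom Q p r\<^esub> w"
    using cmp_Sup_left_le_iff[OF obj u B w] by simp
  have P: "?P ?s"
  proof (intro conjI ballI iffI)
    fix v assume v: "v \<in> arrows Q q r" "Cmp Q p q r v u \<sqsubseteq>\<^bsub>Hom Q p r\<^esub> w"
    then show "v \<sqsubseteq>\<^bsub>Hom Q q r\<^esub> ?s"
      using Sup_upper[OF obj(2,3) B] by simp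
  next
    fix v assume "v \<in> arrows Q q r" "v \<sqsubseteq>\<^bsub>Hom Q q r\<^esub> ?s"
    then show "Cmp Q p q r v u \<sqsubseteq>\<^bsub>Hom Q p r\<^esub> w"
      using obj u w s le cmp_le_trans[of p q r u u v ?s w] hom_refl by auto
  qed (use s in simp)
  have "e = ?s" if "?P e" for e
    using P that obj hom_refl hom_antisym[of q r e ?s] by blast
  with P have "\<exists>!e. ?P e"
    by (rule ex1I)
  from theI'[OF this] show ?thesis
    unfolding lres_def .
qed

lemmas lres_arrow = lres_spec[THEN conjunct1]

lemma le_lres_iff:
  assumes "p \<in> Obj Q" "q \<in> Obj Q" "r \<in> Obj Q" "u \<in> arrows Q p q" "w \<in> arrows Q p r"
    and "v \<in> arrows Q q r"
  shows "v \<sqsubseteq>\<^bsub>Hom Q q r\<^esub> lres Q p q r w u \<longleftrightarrow> Cmp Q p q r v u \<sqsubseteq>\<^bsub>Hom Q p r\<^esub> w"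
  using lres_spec[OF assms(1-5)] assms(6) by simp

end

section \<open>Quotients by congruences\<close>

text \<open>The join clause takes a set of related pairs instead of two families, which avoids
  quantifying over an index type; \<open>congruence_Sup\<close> recovers the form with
  families.\<close>

definition congruence :: "('o, 'a) qtld \<Rightarrow> ('o \<Rightarrow> 'o \<Rightarrow> ('a \<times> 'a) set) \<Rightarrow> bool" where
  "congruence C R \<longleftrightarrow>
     (\<forall>p\<in>Obj C. \<forall>q\<in>Obj C. equiv (arrows C p q) (R p q)) \<and>
     (\<forall>p\<in>Obj C. \<forall>q\<in>Obj C. \<forall>r\<in>Obj C. \<forall>u u' v v'.
        (u, u') \<in> R p q \<longrightarrow> (v, v') \<in> R q r \<longrightarrow>
        (Cmp C p q r v u, Cmp C p q r v' u') \<in> R p r) \<and>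
     (\<forall>p\<in>Obj C. \<forall>q\<in>Obj C. \<forall>A\<subseteq>R p q.
        (\<Squnion>\<^bsub>Hom C p q\<^esub> (fst ` A), \<Squnion>\<^bsub>Hom C p q\<^esub> (snd ` A)) \<in> R p q)"

lemma congruence_equiv:
  "congruence C R \<Longrightarrow> p \<in> Obj C \<Longrightarrow> q \<in> Obj C \<Longrightarrow> equiv (arrows C p q) (R p q)"
  by (simp add: congruence_def)

lemma congruence_cmp:
  assumes "congruence C R" "p \<in> Obj C" "q \<in> Obj C" "r \<in> Obj C" "(u, u') \<in> R p q" "(v, v') \<in> R q r"
  shows "(Cmp C p q r v u, Cmp C p q r v' u') \<in> R p r"
  using assms by (simp add: congruence_def)

lemma congruence_Sup_pairs:
  "congruence C R \<Longrightarrow> p \<in> Obj C \<Longrightarrow> q \<in> Obj C \<Longrightarrow> A \<subseteq> R p q \<Longrightarrow>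
    (\<Squnion>\<^bsub>Hom C p q\<^esub> (fst ` A), \<Squnion>\<^bsub>Hom C p q\<^esub> (snd ` A)) \<in> R p q"
  by (simp add: congruence_def)

lemma congruence_Sup:
  assumes "congruence C R" "p \<in> Obj C" "q \<in> Obj C"
    and "\<And>i. i \<in> I \<Longrightarrow> (f i, g i) \<in> R p q"
  shows "(\<Squnion>\<^bsub>Hom C p q\<^esub> (f ` I), \<Squnion>\<^bsub>Hom C p q\<^esub> (g ` I)) \<in> R p q"
proof -
  have "(\<lambda>i. (f i, g i)) ` I \<subseteq> R p q"
    using assms by auto
  then have "(\<Squnion>\<^bsub>Hom C p q\<^esub> (fst ` (\<lambda>i. (f i, g i)) ` I), \<Squnion>\<^bsub>Hom C p q\<^esub> (snd ` (\<lambda>i. (f i, g i)) ` I)) \<in> R p q"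
    using assms(1-3) by (intro congruence_Sup_pairs)
  then show ?thesis
    by (simp add: image_image)
qed

locale quotient_quantaloid = quantaloid C for C :: "('o, 'a) qtld" +
  fixes R :: "'o \<Rightarrow> 'o \<Rightarrow> ('a \<times> 'a) set"
  assumes congruence: "congruence C R"
begin

abbreviation CR :: "('o, 'a set) qtld" where
  "CR \<equiv> quotient_qtld C R"

abbreviation cls :: "'o \<Rightarrow> 'o \<Rightarrow> 'a \<Rightarrow> 'a set" where
  "cls p q f \<equiv> R p q `` {f}"

lemma rel_equiv: "p \<in> Obj C \<Longrightarrow> q \<in> Obj C \<Longrightarrow> equiv (arrows C p q) (R p q)"
  using congruence by (rule congruence_equiv)

lemma rel_arrow: "p \<in> Obj C \<Longrightarrow> q \<in> Obj C \<Longrightarrow> (f, g) \<in> R p q \<Longrightarrow> f \<in> arrows C p q \<and> g \<in> arrows C p q"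
  using rel_equiv equiv_type by blast

lemma rel_refl: "p \<in> Obj C \<Longrightarrow> q \<in> Obj C \<Longrightarrow> f \<in> arrows C p q \<Longrightarrow> (f, f) \<in> R p q"
  using rel_equiv equivE refl_onD by metis

lemma rel_sym: "p \<in> Obj C \<Longrightarrow> q \<in> Obj C \<Longrightarrow> (f, g) \<in> R p q \<Longrightarrow> (g, f) \<in> R p q"
  using rel_equiv equivE symD by metis

lemma rel_trans: "p \<in> Obj C \<Longrightarrow> q \<in> Obj C \<Longrightarrow> (f, g) \<in> R p q \<Longrightarrow> (g, h) \<in> R p q \<Longrightarrow> (f, h) \<in> R p q"
  using rel_equiv equivE transD by metis

lemma cls_eq_iff:
  "p \<in> Obj C \<Longrightarrow> q \<in> Obj C \<Longrightarrow> f \<in> arrows C p q \<Longrightarrow> g \<in> arrows C p q \<Longrightarrow>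
    cls p q f = cls p q g \<longleftrightarrow> (f, g) \<in> R p q"
  using rel_equiv eq_equiv_class_iff by metis

lemma cls_eqI: "p \<in> Obj C \<Longrightarrow> q \<in> Obj C \<Longrightarrow> (f, g) \<in> R p q \<Longrightarrow> cls p q f = cls p q g"
  using rel_equiv equiv_class_eq by metis

lemma Obj_quotient [simp]: "Obj CR = Obj C"
  by (simp add: quotient_qtld_def)

lemma cls_arrow: "f \<in> arrows C p q \<Longrightarrow> cls p q f \<in> arrows CR p q"
  by (simp add: quotient_qtld_def quotientI)

lemma arrow_quotientE:
  assumes "U \<in> arrows CR p q"
  obtains f where "f \<in> arrows C p q" "U = cls p q f"
  using assms by (auto simp: quotient_qtld_def elim: quotientE)

lemma Idn_quotient: "Idn CR p = cls p p (Idn C p)"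
  by (simp add: quotient_qtld_def)

text \<open>The double union in the definition of the quotient is taken over equal classes, and it
  is not empty because \<open>f\<close> and \<open>g\<close> represent their own classes.\<close>

lemma Cmp_quotient:
  assumes "p \<in> Obj C" "q \<in> Obj C" "r \<in> Obj C" "f \<in> arrows C p q" "g \<in> arrows C q r"
  shows "Cmp CR p q r (cls q r g) (cls p q f) = cls p r (Cmp C p q r g f)"
proof -
  have "cls p r (Cmp C p q r g' f') = cls p r (Cmp C p q r g f)"
    if "f' \<in> cls p q f" "g' \<in> cls q r g" for f' g'
  proof -
    have "(Cmp C p q r g f, Cmp C p q r g' f') \<in> R p r"
      using that congruence_cmp[OF congruence assms(1-3), of f f' g g'] by auto
    then show ?thesis
      using rel_equiv[OF assms(1,3)] equiv_class_eq by metis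
  qed
  moreover have "f \<in> cls p q f" "g \<in> cls q r g"
    using assms rel_refl by auto
  ultimately have "(\<Union>g'\<in>cls q r g. \<Union>f'\<in>cls p q f. cls p r (Cmp C p q r g' f')) =
      cls p r (Cmp C p q r g f)"
    by (metis (no_types, lifting) SUP_eq_const empty_iff)
  then show ?thesis
    by (simp add: quotient_qtld_def)
qed

text \<open>If f \<sim> f', g \<sim> g' and f' \<le> g', then joining the two relations gives f
  \<squnion> g \<sim> f' \<squnion> g' = g' \<sim> g. Conversely f \<squnion> g is a representative
  of the class of g that lies above f.\<close>

lemma le_quotient:
  assumes p: "p \<in> Obj C" and q: "q \<in> Obj C" and f: "f \<in> arrows C p q" and g: "g \<in> arrows C p q"
  shows "cls p q f \<sqsubseteq>\<^bsub>Hom CR p q\<^esub> cls p q g \<longleftrightarrow> (\<Squnion>\<^bsub>Hom C p q\<^esub> {f, g}, g) \<in> R p q"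
proof
  assume "cls p q f \<sqsubseteq>\<^bsub>Hom CR p q\<^esub> cls p q g"
  then obtain f' g' where fg: "(f, f') \<in> R p q" "(g, g') \<in> R p q" "f' \<sqsubseteq>\<^bsub>Hom C p q\<^esub> g'"
    by (auto simp: quotient_qtld_def)
  \<comment> \<open>The two related pairs are presented as a family indexed by the booleans, to fit
    \<open>congruence_Sup\<close>.\<close>
  have "(\<Squnion>\<^bsub>Hom C p q\<^esub> ((\<lambda>b. if b then f else g) ` UNIV), \<Squnion>\<^bsub>Hom C p q\<^esub> ((\<lambda>b. if b then f' else g') ` UNIV)) \<in> R p q"
    using fg by (intro congruence_Sup[OF congruence p q]) auto
  then have "(\<Squnion>\<^bsub>Hom C p q\<^esub> {f, g}, \<Squnion>\<^bsub>Hom C p q\<^esub> {f', g'}) \<in> R p q"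
    by (simp add: UNIV_bool insert_commute)
  moreover have "\<Squnion>\<^bsub>Hom C p q\<^esub> {f', g'} = g'"
    using fg rel_arrow[OF p q] p q le_iff_Sup by blast
  ultimately show "(\<Squnion>\<^bsub>Hom C p q\<^esub> {f, g}, g) \<in> R p q"
    using fg rel_sym[OF p q] rel_trans[OF p q] by metis
next
  assume *: "(\<Squnion>\<^bsub>Hom C p q\<^esub> {f, g}, g) \<in> R p q"
  have "f \<in> cls p q f" "\<Squnion>\<^bsub>Hom C p q\<^esub> {f, g} \<in> cls p q g" "f \<sqsubseteq>\<^bsub>Hom C p q\<^esub> \<Squnion>\<^bsub>Hom C p q\<^esub> {f, g}"
    using * f g p q rel_refl[OF p q] rel_sym[OF p q] Sup_upper[of p q "{f, g}" f] by auto
  then show "cls p q f \<sqsubseteq>\<^bsub>Hom CR p q\<^esub> cls p q g"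
    by (auto simp: quotient_qtld_def)
qed

lemma Sup_insert_Sup:
  assumes "p \<in> Obj C" "q \<in> Obj C" "A \<subseteq> arrows C p q" "g \<in> arrows C p q"
  shows "\<Squnion>\<^bsub>Hom C p q\<^esub> {\<Squnion>\<^bsub>Hom C p q\<^esub> A, g} = \<Squnion>\<^bsub>Hom C p q\<^esub> (insert g A)"
  using assms by (intro Sup_eqI) (auto simp: Sup_le_iff)

text \<open>This is the source of all joins in the quotient: transitivity of its order, completeness
  of its hom-sets and \<open>Sup_quotient\<close> are read off from it.\<close>

lemma Sup_quotient_le_iff:
  assumes p: "p \<in> Obj C" and q: "q \<in> Obj C" and A: "A \<subseteq> arrows C p q" and g: "g \<in> arrows C p q"
  shows "cls p q (\<Squnion>\<^bsub>Hom C p q\<^esub> A) \<sqsubseteq>\<^bsub>Hom CR p q\<^esub> cls p q g \<longleftrightarrow>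
    (\<forall>f\<in>A. cls p q f \<sqsubseteq>\<^bsub>Hom CR p q\<^esub> cls p q g)"
proof -
  let ?S = "\<lambda>A. \<Squnion>\<^bsub>Hom C p q\<^esub> A"
  have "(?S {?S A, g}, g) \<in> R p q \<longleftrightarrow> (\<forall>f\<in>A. (?S {f, g}, g) \<in> R p q)"
  proof
    assume L: "(?S {?S A, g}, g) \<in> R p q"
    show "\<forall>f\<in>A. (?S {f, g}, g) \<in> R p q"
    proof
      fix f assume f: "f \<in> A"
      \<comment> \<open>\<open>f \<squnion> g \<sim> f \<squnion> (\<Squnion>A \<squnion> g) = \<Squnion>A \<squnion> g \<sim> g\<close>\<close>
      have fa: "f \<in> arrows C p q" and ia: "insert g A \<subseteq> arrows C p q"
        using f A g by auto
      have "(?S ((\<lambda>b. if b then f else ?S {?S A, g}) ` UNIV), ?S ((\<lambda>b. if b then f else g) ` UNIV)) \<in> R p q"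
        using L fa rel_refl[OF p q] by (intro congruence_Sup[OF congruence p q]) auto
      then have "(?S {f, ?S (insert g A)}, ?S {f, g}) \<in> R p q"
        using Sup_insert_Sup[OF p q A g] by (simp add: UNIV_bool insert_commute)
      moreover have "?S {f, ?S (insert g A)} = ?S (insert g A)"
        using le_iff_Sup[OF p q fa Sup_arrow[OF p q ia]] Sup_upper[OF p q ia] f by simp
      ultimately show "(?S {f, g}, g) \<in> R p q"
        using L Sup_insert_Sup[OF p q A g] rel_sym[OF p q] rel_trans[OF p q] by metis
    qed
  next
    assume r: "\<forall>f\<in>A. (?S {f, g}, g) \<in> R p q"
    \<comment> \<open>The relations f \<squnion> g \<sim> g are joined over all f in
      \<open>A\<close>. The index set also contains \<open>g\<close>, so that the join of the
      constant family is \<open>g\<close> even if \<open>A\<close> is empty.\<close>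
    have "(?S ((\<lambda>f. ?S {f, g}) ` (insert g A)), ?S ((\<lambda>f. g) ` (insert g A))) \<in> R p q"
    proof (rule congruence_Sup[OF congruence p q])
      fix i assume "i \<in> insert g A"
      moreover have "?S {g, g} = g"
        using le_iff_Sup[OF p q g g] hom_refl[OF p q g] by simp
      ultimately show "(?S {i, g}, g) \<in> R p q"
        using r rel_refl[OF p q g] by auto
    qed
    moreover have "?S ((\<lambda>f. ?S {f, g}) ` (insert g A)) = ?S {?S A, g}"
      unfolding Sup_insert_Sup[OF p q A g]
      using A g p q by (intro Sup_eqI) (auto simp: Sup_le_iff subset_iff)
    moreover have "?S ((\<lambda>f. g) ` (insert g A)) = g"
      using le_iff_Sup[OF p q g g] hom_refl[OF p q g] by (simp add: image_constant_conv)
    ultimately show "(?S {?S A, g}, g) \<in> R p q"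
      by simp
  qed
  moreover have "f \<in> arrows C p q" if "f \<in> A" for f
    using that A by auto
  ultimately show ?thesis
    using le_quotient p q g A Sup_arrow[OF p q A] by (simp cong: ball_cong)
qed

text \<open>Collecting all representatives of the members of \<A> makes a choice of one for each
  class unnecessary.\<close>

lemma image_cls:
  assumes "\<A> \<subseteq> arrows CR p q"
  obtains A where "A \<subseteq> arrows C p q" "\<A> = cls p q ` A"
proof
  show "{f \<in> arrows C p q. cls p q f \<in> \<A>} \<subseteq> arrows C p q"
    by auto
  show "\<A> = cls p q ` {f \<in> arrows C p q. cls p q f \<in> \<A>}"
    using assms by (auto elim!: arrow_quotientE)
qed

lemma hom_quotient_complete_lattice:
  assumes p: "p \<in> Obj C" and q: "q \<in> Obj C"
  shows "complete_lattice (Hom CR p q)"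
proof (rule complete_lattice_if_lubs)
  show "eq (Hom CR p q) = (=)"
    by (simp add: quotient_qtld_def)
next
  fix U assume "U \<in> arrows CR p q"
  then show "U \<sqsubseteq>\<^bsub>Hom CR p q\<^esub> U"
    using p q le_quotient le_iff_Sup hom_refl rel_refl by (auto elim!: arrow_quotientE)
next
  fix U V assume *: "U \<in> arrows CR p q" "V \<in> arrows CR p q" "U \<sqsubseteq>\<^bsub>Hom CR p q\<^esub> V" "V \<sqsubseteq>\<^bsub>Hom CR p q\<^esub> U"
  then obtain f g where fg: "f \<in> arrows C p q" "g \<in> arrows C p q" "U = cls p q f" "V = cls p q g"
    by (metis arrow_quotientE)
  then have "(\<Squnion>\<^bsub>Hom C p q\<^esub> {f, g}, g) \<in> R p q" "(\<Squnion>\<^bsub>Hom C p q\<^esub> {g, f}, f) \<in> R p q"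
    using * le_quotient[OF p q] by auto
  \<comment> \<open>Both are congruent to the join of f and g, which is symmetric in them.\<close>
  then have "(f, g) \<in> R p q"
    using rel_sym[OF p q] rel_trans[OF p q] by (subst (asm) (2) insert_commute) blast
  then show "U = V"
    using fg cls_eq_iff[OF p q] by simp
next
  fix U V W
  assume *: "U \<in> arrows CR p q" "V \<in> arrows CR p q" "W \<in> arrows CR p q"
    "U \<sqsubseteq>\<^bsub>Hom CR p q\<^esub> V" "V \<sqsubseteq>\<^bsub>Hom CR p q\<^esub> W"
  then obtain f g h where fgh: "f \<in> arrows C p q" "g \<in> arrows C p q" "h \<in> arrows C p q"
    "U = cls p q f" "V = cls p q g" "W = cls p q h"
    by (metis arrow_quotientE)
  have le: "(\<Squnion>\<^bsub>Hom C p q\<^esub> {f, g}, g) \<in> R p q"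
    using * fgh le_quotient[OF p q] by auto
  have fg: "{f, g} \<subseteq> arrows C p q"
    using fgh by simp
  \<comment> \<open>\<open>V\<close> is the class of the join of \<open>f\<close> and
    \<open>g\<close>; whatever lies above it lies above the class of \<open>f\<close>, by
    \<open>Sup_quotient_le_iff\<close>.\<close>
  have "cls p q (\<Squnion>\<^bsub>Hom C p q\<^esub> {f, g}) = V"
    using le fgh p q cls_eq_iff[OF p q Sup_arrow[OF p q fg]] by simp
  then show "U \<sqsubseteq>\<^bsub>Hom CR p q\<^esub> W"
    using * fgh Sup_quotient_le_iff[OF p q fg, of h] by simp
next
  fix \<A> assume "\<A> \<subseteq> arrows CR p q"
  then obtain A where A: "A \<subseteq> arrows C p q" "\<A> = cls p q ` A"
    by (rule image_cls)
  have "\<forall>U\<in>arrows CR p q. cls p q (\<Squnion>\<^bsub>Hom C p q\<^esub> A) \<sqsubseteq>\<^bsub>Hom CR p q\<^esub> U \<longleftrightarrow>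
      (\<forall>V\<in>\<A>. V \<sqsubseteq>\<^bsub>Hom CR p q\<^esub> U)"
    using Sup_quotient_le_iff[OF p q A(1)] A(2) by (auto elim!: arrow_quotientE)
  then show "\<exists>s\<in>arrows CR p q. \<forall>b\<in>arrows CR p q.
      s \<sqsubseteq>\<^bsub>Hom CR p q\<^esub> b \<longleftrightarrow> (\<forall>a\<in>\<A>. a \<sqsubseteq>\<^bsub>Hom CR p q\<^esub> b)"
    using cls_arrow[OF Sup_arrow[OF p q A(1)]] by blast
qed

lemma Sup_quotient:
  assumes p: "p \<in> Obj C" and q: "q \<in> Obj C" and A: "A \<subseteq> arrows C p q"
  shows "\<Squnion>\<^bsub>Hom CR p q\<^esub> (cls p q ` A) = cls p q (\<Squnion>\<^bsub>Hom C p q\<^esub> A)"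
proof (rule complete_lattice.sup_eqI[OF hom_quotient_complete_lattice[OF p q]])
  show "cls p q ` A \<subseteq> arrows CR p q"
    using A cls_arrow by auto
  show "cls p q (\<Squnion>\<^bsub>Hom C p q\<^esub> A) \<in> arrows CR p q"
    using cls_arrow Sup_arrow[OF p q A] by auto
  show "cls p q (\<Squnion>\<^bsub>Hom C p q\<^esub> A) \<sqsubseteq>\<^bsub>Hom CR p q\<^esub> U \<longleftrightarrow> (\<forall>V\<in>cls p q ` A. V \<sqsubseteq>\<^bsub>Hom CR p q\<^esub> U)"
    if "U \<in> arrows CR p q" for U
    using that Sup_quotient_le_iff[OF p q A] by (auto elim!: arrow_quotientE)
qed

lemma quantaloid_quotient: "quantaloid CR"
proof (rule quantaloid.intro)
  fix p q assume "p \<in> Obj CR" "q \<in> Obj CR"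
  then show "complete_lattice (Hom CR p q)"
    by (simp add: hom_quotient_complete_lattice)
next
  fix p assume "p \<in> Obj CR"
  then show "Idn CR p \<in> arrows CR p p"
    by (simp add: Idn_quotient cls_arrow idn_arrow)
next
  fix p q r U V assume "p \<in> Obj CR" "q \<in> Obj CR" "r \<in> Obj CR" "U \<in> arrows CR p q" "V \<in> arrows CR q r"
  then show "Cmp CR p q r V U \<in> arrows CR p r"
    by (auto elim!: arrow_quotientE simp: Cmp_quotient cls_arrow cmp_arrow)
next
  fix p q U assume "p \<in> Obj CR" "q \<in> Obj CR" "U \<in> arrows CR p q"
  then show "Cmp CR p p q U (Idn CR p) = U" "Cmp CR p q q (Idn CR q) U = U"
    by (auto elim!: arrow_quotientE simp: Cmp_quotient Idn_quotient idn_arrow cmp_idn_right cmp_idn_left)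
next
  fix p q r s U V W
  assume "p \<in> Obj CR" "q \<in> Obj CR" "r \<in> Obj CR" "s \<in> Obj CR"
    "U \<in> arrows CR p q" "V \<in> arrows CR q r" "W \<in> arrows CR r s"
  then show "Cmp CR p q s (Cmp CR q r s W V) U = Cmp CR p r s W (Cmp CR p q r V U)"
    by (auto elim!: arrow_quotientE simp: Cmp_quotient cmp_arrow cmp_assoc)
next
  fix p q r \<A> V
  assume *: "p \<in> Obj CR" "q \<in> Obj CR" "r \<in> Obj CR" "\<A> \<subseteq> arrows CR p q" "V \<in> arrows CR q r"
  obtain A where A: "A \<subseteq> arrows C p q" "\<A> = cls p q ` A"
    using *(4) by (rule image_cls)
  obtain g where g: "g \<in> arrows C q r" "V = cls q r g"
    using *(5) by (rule arrow_quotientE)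
  have im: "(\<lambda>f. Cmp C p q r g f) ` A \<subseteq> arrows C p r"
    using A g * by (auto intro: cmp_arrow)
  have eq: "(\<lambda>U. Cmp CR p q r V U) ` \<A> = cls p r ` (\<lambda>f. Cmp C p q r g f) ` A"
    using A g * by (auto simp: Cmp_quotient image_image subset_iff intro!: image_cong)
  show "Cmp CR p q r V (\<Squnion>\<^bsub>Hom CR p q\<^esub> \<A>) = \<Squnion>\<^bsub>Hom CR p r\<^esub> ((\<lambda>U. Cmp CR p q r V U) ` \<A>)"
    using * A g im unfolding eq by (simp add: Sup_quotient Cmp_quotient cmp_Sup_right)
next
  fix p q r U \<B>
  assume *: "p \<in> Obj CR" "q \<in> Obj CR" "r \<in> Obj CR" "U \<in> arrows CR p q" "\<B> \<subseteq> arrows CR q r"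
  obtain B where B: "B \<subseteq> arrows C q r" "\<B> = cls q r ` B"
    using *(5) by (rule image_cls)
  obtain f where f: "f \<in> arrows C p q" "U = cls p q f"
    using *(4) by (rule arrow_quotientE)
  have im: "(\<lambda>g. Cmp C p q r g f) ` B \<subseteq> arrows C p r"
    using B f * by (auto intro: cmp_arrow)
  have eq: "(\<lambda>V. Cmp CR p q r V U) ` \<B> = cls p r ` (\<lambda>g. Cmp C p q r g f) ` B"
    using B f * by (auto simp: Cmp_quotient image_image subset_iff intro!: image_cong)
  show "Cmp CR p q r (\<Squnion>\<^bsub>Hom CR q r\<^esub> \<B>) U = \<Squnion>\<^bsub>Hom CR p r\<^esub> ((\<lambda>V. Cmp CR p q r V U) ` \<B>)"
    using * B f im unfolding eq by (simp add: Sup_quotient Cmp_quotient cmp_Sup_left)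
qed

end

text \<open>Both homomorphisms are instances. The laws are asked of the map \<open>f\<close> on
  representatives only up to \<open>S\<close>, because related pairs of distributors may well differ
  in their second components.\<close>

locale quotient_hom =
  C: quotient_quantaloid C R + D: quotient_quantaloid D S
  for C :: "('o, 'a) qtld" and R and D :: "('p, 'b) qtld" and S +
  fixes F :: "('o, 'a set, 'p, 'b set) qmap" and f :: "'o \<Rightarrow> 'o \<Rightarrow> 'a \<Rightarrow> 'b"
  assumes on_obj: "p \<in> Obj C \<Longrightarrow> on_obj F p \<in> Obj D"
    and on_arr: "on_arr F p q U = (\<Union>u\<in>U. S (on_obj F p) (on_obj F q) `` {f p q u})"
    and rep_rel: "\<lbrakk>p \<in> Obj C; q \<in> Obj C; (u, u') \<in> R p q\<rbrakk> \<Longrightarrow>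
      (f p q u, f p q u') \<in> S (on_obj F p) (on_obj F q)"
    and rep_Idn: "p \<in> Obj C \<Longrightarrow>
      (f p p (Idn C p), Idn D (on_obj F p)) \<in> S (on_obj F p) (on_obj F p)"
    and rep_Cmp: "\<lbrakk>p \<in> Obj C; q \<in> Obj C; r \<in> Obj C; u \<in> arrows C p q; v \<in> arrows C q r\<rbrakk> \<Longrightarrow>
      (f p r (Cmp C p q r v u), Cmp D (on_obj F p) (on_obj F q) (on_obj F r) (f q r v) (f p q u))
        \<in> S (on_obj F p) (on_obj F r)"
    and rep_Sup: "\<lbrakk>p \<in> Obj C; q \<in> Obj C; A \<subseteq> arrows C p q\<rbrakk> \<Longrightarrow>
      (f p q (\<Squnion>\<^bsub>Hom C p q\<^esub> A), \<Squnion>\<^bsub>Hom D (on_obj F p) (on_obj F q)\<^esub> (f p q ` A))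
        \<in> S (on_obj F p) (on_obj F q)"
begin

lemma rep_arrow:
  assumes "p \<in> Obj C" "q \<in> Obj C" "u \<in> arrows C p q"
  shows "f p q u \<in> arrows D (on_obj F p) (on_obj F q)"
  using rep_rel[OF assms(1,2) C.rel_refl[OF assms]] D.rel_arrow on_obj assms(1,2) by blast

lemma on_arr_cls:
  assumes p: "p \<in> Obj C" and q: "q \<in> Obj C" and u: "u \<in> arrows C p q"
  shows "on_arr F p q (C.cls p q u) = D.cls (on_obj F p) (on_obj F q) (f p q u)"
proof -
  have "D.cls (on_obj F p) (on_obj F q) (f p q u') = D.cls (on_obj F p) (on_obj F q) (f p q u)"
    if "u' \<in> C.cls p q u" for u'
    using that D.cls_eqI[OF on_obj[OF p] on_obj[OF q] rep_rel[OF p q]] by simp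
  moreover have "u \<in> C.cls p q u"
    using C.rel_refl[OF p q u] by simp
  ultimately show ?thesis
    unfolding on_arr by (metis (no_types, lifting) SUP_eq_const empty_iff)
qed

lemma is_functor: "is_functor C.CR D.CR F"
  unfolding is_functor_def
proof (intro conjI ballI)
  fix p assume "p \<in> Obj C.CR"
  then show "on_obj F p \<in> Obj D.CR"
    by (simp add: on_obj)
next
  fix p q U assume "p \<in> Obj C.CR" "q \<in> Obj C.CR" "U \<in> arrows C.CR p q"
  then show "on_arr F p q U \<in> arrows D.CR (on_obj F p) (on_obj F q)"
    by (auto elim!: C.arrow_quotientE simp: on_arr_cls rep_arrow D.cls_arrow)
next
  fix p assume "p \<in> Obj C.CR"
  then have p: "p \<in> Obj C"
    by simp
  show "on_arr F p p (Idn C.CR p) = Idn D.CR (on_obj F p)"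
    using D.cls_eqI[OF on_obj[OF p] on_obj[OF p] rep_Idn[OF p]] on_arr_cls[OF p p C.idn_arrow[OF p]]
    by (simp add: C.Idn_quotient D.Idn_quotient)
next
  fix p q r U V
  assume "p \<in> Obj C.CR" "q \<in> Obj C.CR" "r \<in> Obj C.CR" and U: "U \<in> arrows C.CR p q"
    and V: "V \<in> arrows C.CR q r"
  then have obj: "p \<in> Obj C" "q \<in> Obj C" "r \<in> Obj C"
    by simp_all
  obtain u where u: "u \<in> arrows C p q" "U = C.cls p q u"
    using U by (rule C.arrow_quotientE)
  obtain v where v: "v \<in> arrows C q r" "V = C.cls q r v"
    using V by (rule C.arrow_quotientE)
  show "on_arr F p r (Cmp C.CR p q r V U) =
      Cmp D.CR (on_obj F p) (on_obj F q) (on_obj F r) (on_arr F q r V) (on_arr F p q U)"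
    using obj u v D.cls_eqI[OF on_obj[OF obj(1)] on_obj[OF obj(3)] rep_Cmp[OF obj u(1) v(1)]]
    by (simp add: C.Cmp_quotient D.Cmp_quotient on_arr_cls rep_arrow C.cmp_arrow on_obj)
qed

lemma quantaloid_hom: "quantaloid_hom C.CR D.CR F"
  unfolding quantaloid_hom_def
proof (intro conjI ballI allI impI)
  fix p q \<A>
  assume "p \<in> Obj C.CR" "q \<in> Obj C.CR" and A': "\<A> \<subseteq> arrows C.CR p q"
  then have p: "p \<in> Obj C" and q: "q \<in> Obj C"
    by simp_all
  obtain A where A: "A \<subseteq> arrows C p q" "\<A> = C.cls p q ` A"
    using A' by (rule C.image_cls)
  have im: "f p q ` A \<subseteq> arrows D (on_obj F p) (on_obj F q)"
    using A(1) rep_arrow[OF p q] by auto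
  have eq: "on_arr F p q ` \<A> = D.cls (on_obj F p) (on_obj F q) ` f p q ` A"
    unfolding A(2) image_image using A(1) on_arr_cls[OF p q] by (intro image_cong) auto
  show "on_arr F p q (\<Squnion>\<^bsub>Hom C.CR p q\<^esub> \<A>) = \<Squnion>\<^bsub>Hom D.CR (on_obj F p) (on_obj F q)\<^esub> (on_arr F p q ` \<A>)"
    unfolding eq D.Sup_quotient[OF on_obj[OF p] on_obj[OF q] im]
    unfolding A(2) C.Sup_quotient[OF p q A(1)] on_arr_cls[OF p q C.Sup_arrow[OF p q A(1)]]
    by (rule D.cls_eqI[OF on_obj[OF p] on_obj[OF q] rep_Sup[OF p q A(1)]])
qed (simp_all add: C.quantaloid_quotient D.quantaloid_quotient is_functor)

end

text \<open>Naturality and invertibility of \<tau> are required only up to the congruence. Thus the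
  components may be represented by arrows that are not invertible in \<open>C\<close>, as happens
  for \<open>codomain_iso\<close>.\<close>

lemma (in quotient_quantaloid) naturally_isomorphic_quotientI:
  assumes obj: "\<And>p. p \<in> Obj B \<Longrightarrow> on_obj G p \<in> Obj C" "\<And>p. p \<in> Obj B \<Longrightarrow> on_obj H p \<in> Obj C"
    and rep: "\<And>p q U. \<lbrakk>p \<in> Obj B; q \<in> Obj B; U \<in> arrows B p q\<rbrakk> \<Longrightarrow>
      \<exists>g\<in>arrows C (on_obj G p) (on_obj G q). \<exists>h\<in>arrows C (on_obj H p) (on_obj H q).
        on_arr G p q U = cls (on_obj G p) (on_obj G q) g \<and>
        on_arr H p q U = cls (on_obj H p) (on_obj H q) h \<and>
        (Cmp C (on_obj G p) (on_obj G q) (on_obj H q) (\<tau> q) g,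
         Cmp C (on_obj G p) (on_obj H p) (on_obj H q) h (\<tau> p)) \<in> R (on_obj G p) (on_obj H q)"
    and \<tau>: "\<And>p. p \<in> Obj B \<Longrightarrow> \<tau> p \<in> arrows C (on_obj G p) (on_obj H p)"
    and \<sigma>: "\<And>p. p \<in> Obj B \<Longrightarrow> \<sigma> p \<in> arrows C (on_obj H p) (on_obj G p)"
    and inv: "\<And>p. p \<in> Obj B \<Longrightarrow>
        (Cmp C (on_obj G p) (on_obj H p) (on_obj G p) (\<sigma> p) (\<tau> p), Idn C (on_obj G p))
          \<in> R (on_obj G p) (on_obj G p)"
      "\<And>p. p \<in> Obj B \<Longrightarrow>
        (Cmp C (on_obj H p) (on_obj G p) (on_obj H p) (\<tau> p) (\<sigma> p), Idn C (on_obj H p))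
          \<in> R (on_obj H p) (on_obj H p)"
  shows "naturally_isomorphic B CR G H"
proof -
  let ?t = "\<lambda>p. cls (on_obj G p) (on_obj H p) (\<tau> p)"
  have "is_iso CR (on_obj G p) (on_obj H p) (?t p)" if p: "p \<in> Obj B" for p
    unfolding is_iso_def
  proof (intro conjI bexI[of _ "cls (on_obj H p) (on_obj G p) (\<sigma> p)"])
    note o = obj(1)[OF p] obj(2)[OF p]
    show "Cmp CR (on_obj G p) (on_obj H p) (on_obj G p) (cls (on_obj H p) (on_obj G p) (\<sigma> p)) (?t p) =
        Idn CR (on_obj G p)"
      unfolding Cmp_quotient[OF o(1,2,1) \<tau>[OF p] \<sigma>[OF p]] Idn_quotient
      by (rule cls_eqI[OF o(1,1) inv(1)[OF p]])
    show "Cmp CR (on_obj H p) (on_obj G p) (on_obj H p) (?t p) (cls (on_obj H p) (on_obj G p) (\<sigma> p)) =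
        Idn CR (on_obj H p)"
      unfolding Cmp_quotient[OF o(2,1,2) \<sigma>[OF p] \<tau>[OF p]] Idn_quotient
      by (rule cls_eqI[OF o(2,2) inv(2)[OF p]])
  qed (simp_all add: cls_arrow \<tau> \<sigma> p)
  moreover have "Cmp CR (on_obj G p) (on_obj G q) (on_obj H q) (?t q) (on_arr G p q U) =
      Cmp CR (on_obj G p) (on_obj H p) (on_obj H q) (on_arr H p q U) (?t p)"
    if p: "p \<in> Obj B" and q: "q \<in> Obj B" and U: "U \<in> arrows B p q" for p q U
  proof -
    obtain g h where gh: "g \<in> arrows C (on_obj G p) (on_obj G q)" "h \<in> arrows C (on_obj H p) (on_obj H q)"
        "on_arr G p q U = cls (on_obj G p) (on_obj G q) g"
        "on_arr H p q U = cls (on_obj H p) (on_obj H q) h"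
        "(Cmp C (on_obj G p) (on_obj G q) (on_obj H q) (\<tau> q) g,
         Cmp C (on_obj G p) (on_obj H p) (on_obj H q) h (\<tau> p)) \<in> R (on_obj G p) (on_obj H q)"
      using rep[OF p q U] by blast
    show ?thesis
      unfolding gh(3,4) Cmp_quotient[OF obj(1)[OF p] obj(1)[OF q] obj(2)[OF q] gh(1) \<tau>[OF q]]
        Cmp_quotient[OF obj(1)[OF p] obj(2)[OF p] obj(2)[OF q] \<tau>[OF p] gh(2)]
      by (rule cls_eqI[OF obj(1)[OF p] obj(2)[OF q] gh(5)])
  qed
  ultimately show ?thesis
    unfolding naturally_isomorphic_def by (intro exI[of _ ?t] conjI ballI) simp_all
qed

section \<open>Arrow and diagonal quantaloids\<close>

lemma arr_Obj_iff:
  "(X, \<phi>, Y) \<in> Obj (arr_qtld C) \<longleftrightarrow> X \<in> Obj C \<and> Y \<in> Obj C \<and> \<phi> \<in> arrows C X Y"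
  by (simp add: arr_qtld_def)

lemma arr_arrow_iff:
  "(\<zeta>, \<eta>) \<in> arrows (arr_qtld C) (X, \<phi>, Y) (X', \<psi>, Y') \<longleftrightarrow>
    \<zeta> \<in> arrows C X X' \<and> \<eta> \<in> arrows C Y Y' \<and> Cmp C X X' Y' \<psi> \<zeta> = Cmp C X Y Y' \<eta> \<phi>"
  by (simp add: arr_qtld_def)

lemma arr_le_iff:
  "(\<zeta>, \<eta>) \<sqsubseteq>\<^bsub>Hom (arr_qtld C) (X, \<phi>, Y) (X', \<psi>, Y')\<^esub> (\<zeta>', \<eta>') \<longleftrightarrow>
    \<zeta> \<sqsubseteq>\<^bsub>Hom C X X'\<^esub> \<zeta>' \<and> \<eta> \<sqsubseteq>\<^bsub>Hom C Y Y'\<^esub> \<eta>'"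
  by (simp add: arr_qtld_def)

lemma arr_Idn: "Idn (arr_qtld C) (X, \<phi>, Y) = (Idn C X, Idn C Y)"
  by (simp add: arr_qtld_def)

lemma arr_Cmp:
  "Cmp (arr_qtld C) (X, \<phi>, Y) (X', \<psi>, Y') (X'', \<chi>, Y'') (\<zeta>', \<eta>') (\<zeta>, \<eta>) =
    (Cmp C X X' X'' \<zeta>' \<zeta>, Cmp C Y Y' Y'' \<eta>' \<eta>)"
  by (simp add: arr_qtld_def)

lemma diag_rel_iff:
  "((\<zeta>, \<eta>), (\<zeta>', \<eta>')) \<in> diag_rel C (X, \<phi>, Y) (X', \<psi>, Y') \<longleftrightarrow>
    (\<zeta>, \<eta>) \<in> arrows (arr_qtld C) (X, \<phi>, Y) (X', \<psi>, Y') \<and>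
    (\<zeta>', \<eta>') \<in> arrows (arr_qtld C) (X, \<phi>, Y) (X', \<psi>, Y') \<and>
    Cmp C X X' Y' \<psi> \<zeta> = Cmp C X X' Y' \<psi> \<zeta>'"
  by (simp add: diag_rel_def)

context quantaloid
begin

text \<open>The componentwise join of commuting squares commutes because composition with \<psi> and
  composition with \<phi> both preserve joins; hence joins of squares are formed
  componentwise.\<close>

lemma arr_Sup_spec:
  assumes o: "(X, \<phi>, Y) \<in> Obj (arr_qtld Q)" "(X', \<psi>, Y') \<in> Obj (arr_qtld Q)"
    and A: "A \<subseteq> arrows (arr_qtld Q) (X, \<phi>, Y) (X', \<psi>, Y')"
  defines "s \<equiv> (\<Squnion>\<^bsub>Hom Q X X'\<^esub> (fst ` A), \<Squnion>\<^bsub>Hom Q Y Y'\<^esub> (snd ` A))"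
  shows "s \<in> arrows (arr_qtld Q) (X, \<phi>, Y) (X', \<psi>, Y')"
    and "b \<in> arrows (arr_qtld Q) (X, \<phi>, Y) (X', \<psi>, Y') \<Longrightarrow>
      s \<sqsubseteq>\<^bsub>Hom (arr_qtld Q) (X, \<phi>, Y) (X', \<psi>, Y')\<^esub> b \<longleftrightarrow>
      (\<forall>a\<in>A. a \<sqsubseteq>\<^bsub>Hom (arr_qtld Q) (X, \<phi>, Y) (X', \<psi>, Y')\<^esub> b)"
proof -
  note o' = o[unfolded arr_Obj_iff]
  have A1: "fst ` A \<subseteq> arrows Q X X'" and A2: "snd ` A \<subseteq> arrows Q Y Y'"
    using A by (auto simp: arr_arrow_iff)
  have "(\<lambda>u. Cmp Q X X' Y' \<psi> u) ` fst ` A = (\<lambda>v. Cmp Q X Y Y' v \<phi>) ` snd ` A"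
    unfolding image_image using A by (intro image_cong) (auto simp: arr_arrow_iff)
  then show "s \<in> arrows (arr_qtld Q) (X, \<phi>, Y) (X', \<psi>, Y')"
    using o' A1 A2 by (simp add: s_def arr_arrow_iff cmp_Sup_right cmp_Sup_left)
  assume b: "b \<in> arrows (arr_qtld Q) (X, \<phi>, Y) (X', \<psi>, Y')"
  obtain b1 b2 where b12: "b = (b1, b2)"
    by fastforce
  show "s \<sqsubseteq>\<^bsub>Hom (arr_qtld Q) (X, \<phi>, Y) (X', \<psi>, Y')\<^esub> b \<longleftrightarrow>
      (\<forall>a\<in>A. a \<sqsubseteq>\<^bsub>Hom (arr_qtld Q) (X, \<phi>, Y) (X', \<psi>, Y')\<^esub> b)"
  proof -
    have "a \<sqsubseteq>\<^bsub>Hom (arr_qtld Q) (X, \<phi>, Y) (X', \<psi>, Y')\<^esub> b \<longleftrightarrow>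
        fst a \<sqsubseteq>\<^bsub>Hom Q X X'\<^esub> b1 \<and> snd a \<sqsubseteq>\<^bsub>Hom Q Y Y'\<^esub> b2" for a
      by (cases a) (simp add: b12 arr_le_iff)
    then show ?thesis
      using o' b A1 A2 by (auto simp: b12 s_def arr_arrow_iff Sup_le_iff)
  qed
qed

lemma hom_arr_complete_lattice:
  assumes o: "(X, \<phi>, Y) \<in> Obj (arr_qtld Q)" "(X', \<psi>, Y') \<in> Obj (arr_qtld Q)"
  shows "complete_lattice (Hom (arr_qtld Q) (X, \<phi>, Y) (X', \<psi>, Y'))" (is "complete_lattice ?H")
proof (rule complete_lattice_if_lubs)
  note o' = o[unfolded arr_Obj_iff]
  show "eq ?H = (=)"
    by (simp add: arr_qtld_def)
  show "u \<sqsubseteq>\<^bsub>?H\<^esub> u" if "u \<in> carrier ?H" for u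
    using that o' hom_refl by (cases u) (auto simp: arr_arrow_iff arr_le_iff)
  show "u = v" if "u \<in> carrier ?H" "v \<in> carrier ?H" "u \<sqsubseteq>\<^bsub>?H\<^esub> v" "v \<sqsubseteq>\<^bsub>?H\<^esub> u" for u v
    using that o' by (cases u; cases v) (simp add: arr_arrow_iff arr_le_iff, blast intro: hom_antisym)
  show "u \<sqsubseteq>\<^bsub>?H\<^esub> w" if "u \<in> carrier ?H" "v \<in> carrier ?H" "w \<in> carrier ?H"
    "u \<sqsubseteq>\<^bsub>?H\<^esub> v" "v \<sqsubseteq>\<^bsub>?H\<^esub> w" for u v w
    using that o' hom_trans[of X X' "fst u" "fst v" "fst w"] hom_trans[of Y Y' "snd u" "snd v" "snd w"]
    by (cases u; cases v; cases w) (simp add: arr_arrow_iff arr_le_iff)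
  show "\<exists>s\<in>carrier ?H. \<forall>b\<in>carrier ?H. s \<sqsubseteq>\<^bsub>?H\<^esub> b \<longleftrightarrow> (\<forall>a\<in>A. a \<sqsubseteq>\<^bsub>?H\<^esub> b)"
    if "A \<subseteq> carrier ?H" for A
    using arr_Sup_spec[OF o that] by blast
qed

lemma arr_Sup:
  assumes o: "(X, \<phi>, Y) \<in> Obj (arr_qtld Q)" "(X', \<psi>, Y') \<in> Obj (arr_qtld Q)"
    and A: "A \<subseteq> arrows (arr_qtld Q) (X, \<phi>, Y) (X', \<psi>, Y')"
  shows "\<Squnion>\<^bsub>Hom (arr_qtld Q) (X, \<phi>, Y) (X', \<psi>, Y')\<^esub> A =
    (\<Squnion>\<^bsub>Hom Q X X'\<^esub> (fst ` A), \<Squnion>\<^bsub>Hom Q Y Y'\<^esub> (snd ` A))"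
  by (rule complete_lattice.sup_eqI[OF hom_arr_complete_lattice[OF o] A arr_Sup_spec[OF o A]])

text \<open>Two commuting squares are pasted along their common edge \<psi>.\<close>

lemma arr_cmp_arrow:
  assumes o: "(X, \<phi>, Y) \<in> Obj (arr_qtld Q)" "(X', \<psi>, Y') \<in> Obj (arr_qtld Q)"
    "(X'', \<chi>, Y'') \<in> Obj (arr_qtld Q)"
    and u: "(\<zeta>, \<eta>) \<in> arrows (arr_qtld Q) (X, \<phi>, Y) (X', \<psi>, Y')"
    and v: "(\<zeta>', \<eta>') \<in> arrows (arr_qtld Q) (X', \<psi>, Y') (X'', \<chi>, Y'')"
  shows "(Cmp Q X X' X'' \<zeta>' \<zeta>, Cmp Q Y Y' Y'' \<eta>' \<eta>) \<in> arrows (arr_qtld Q) (X, \<phi>, Y) (X'', \<chi>, Y'')"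
proof -
  note o' = o[unfolded arr_Obj_iff]
  note u' = u[unfolded arr_arrow_iff]
  note v' = v[unfolded arr_arrow_iff]
  have "Cmp Q X X'' Y'' \<chi> (Cmp Q X X' X'' \<zeta>' \<zeta>) = Cmp Q X X' Y'' (Cmp Q X' X'' Y'' \<chi> \<zeta>') \<zeta>"
    using o' u' v' by (intro cmp_assoc[symmetric]) simp_all
  also have "\<dots> = Cmp Q X X' Y'' (Cmp Q X' Y' Y'' \<eta>' \<psi>) \<zeta>"
    by (simp only: v')
  also have "\<dots> = Cmp Q X Y' Y'' \<eta>' (Cmp Q X X' Y' \<psi> \<zeta>)"
    using o' u' v' by (intro cmp_assoc) simp_all
  also have "\<dots> = Cmp Q X Y' Y'' \<eta>' (Cmp Q X Y Y' \<eta> \<phi>)"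
    by (simp only: u')
  also have "\<dots> = Cmp Q X Y Y'' (Cmp Q Y Y' Y'' \<eta>' \<eta>) \<phi>"
    using o' u' v' by (intro cmp_assoc[symmetric]) simp_all
  finally show ?thesis
    using o' u' v' by (simp add: arr_arrow_iff cmp_arrow)
qed

lemma arr_Cmp_arrow:
  assumes "p \<in> Obj (arr_qtld Q)" "q \<in> Obj (arr_qtld Q)" "r \<in> Obj (arr_qtld Q)"
    and "u \<in> arrows (arr_qtld Q) p q" "v \<in> arrows (arr_qtld Q) q r"
  shows "Cmp (arr_qtld Q) p q r v u \<in> arrows (arr_qtld Q) p r"
  using assms by (cases p; cases q; cases r; cases u; cases v) (simp add: arr_Cmp arr_cmp_arrow)

lemma quantaloid_arr: "quantaloid (arr_qtld Q)"
proof (rule quantaloid.intro, goal_cases)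
  case (1 p q)
  then show ?case
    by (cases p; cases q) (simp add: hom_arr_complete_lattice)
next
  case (2 p)
  then show ?case
    by (cases p) (simp add: arr_Obj_iff arr_arrow_iff arr_Idn idn_arrow cmp_idn_right cmp_idn_left)
next
  case (3 p q r u v)
  then show ?case
    by (rule arr_Cmp_arrow)
next
  case (4 p q u)
  then show ?case
    by (cases p; cases q; cases u) (simp add: arr_Cmp arr_Idn arr_Obj_iff arr_arrow_iff cmp_idn_right)
next
  case (5 p q u)
  then show ?case
    by (cases p; cases q; cases u) (simp add: arr_Cmp arr_Idn arr_Obj_iff arr_arrow_iff cmp_idn_left)
next
  case (6 p q r s u v w)
  then show ?case
    by (cases p; cases q; cases r; cases s; cases u; cases v; cases w)
      (simp add: arr_Cmp arr_Obj_iff arr_arrow_iff cmp_assoc)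
next
  case (7 p q r A v)
  obtain X \<phi> Y X' \<psi> Y' X'' \<chi> Y'' \<zeta> \<eta> where
    eqs: "p = (X, \<phi>, Y)" "q = (X', \<psi>, Y')" "r = (X'', \<chi>, Y'')" "v = (\<zeta>, \<eta>)"
    by (metis prod_cases3 surj_pair)
  note o = 7(1-3)[unfolded eqs arr_Obj_iff]
  have A: "fst ` A \<subseteq> arrows Q X X'" "snd ` A \<subseteq> arrows Q Y Y'"
    using 7(4) by (auto simp: eqs arr_arrow_iff)
  have v: "\<zeta> \<in> arrows Q X' X''" "\<eta> \<in> arrows Q Y' Y''"
    using 7(5) by (auto simp: eqs arr_arrow_iff)
  have im: "(\<lambda>u. Cmp (arr_qtld Q) p q r v u) ` A \<subseteq> arrows (arr_qtld Q) p r"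
    using arr_Cmp_arrow[OF 7(1-3) _ 7(5)] 7(4) by blast
  have "fst ` (\<lambda>u. Cmp (arr_qtld Q) p q r v u) ` A = (\<lambda>u. Cmp Q X X' X'' \<zeta> u) ` fst ` A"
    "snd ` (\<lambda>u. Cmp (arr_qtld Q) p q r v u) ` A = (\<lambda>u. Cmp Q Y Y' Y'' \<eta> u) ` snd ` A"
    unfolding image_image by (auto simp: eqs arr_Cmp intro!: image_cong)
  then show ?case
    using 7 im o A v by (simp add: eqs arr_Sup arr_Cmp cmp_Sup_right)
next
  case (8 p q r u B)
  obtain X \<phi> Y X' \<psi> Y' X'' \<chi> Y'' \<zeta> \<eta> where
    eqs: "p = (X, \<phi>, Y)" "q = (X', \<psi>, Y')" "r = (X'', \<chi>, Y'')" "u = (\<zeta>, \<eta>)"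
    by (metis prod_cases3 surj_pair)
  note o = 8(1-3)[unfolded eqs arr_Obj_iff]
  have B: "fst ` B \<subseteq> arrows Q X' X''" "snd ` B \<subseteq> arrows Q Y' Y''"
    using 8(5) by (auto simp: eqs arr_arrow_iff)
  have u: "\<zeta> \<in> arrows Q X X'" "\<eta> \<in> arrows Q Y Y'"
    using 8(4) by (auto simp: eqs arr_arrow_iff)
  have im: "(\<lambda>v. Cmp (arr_qtld Q) p q r v u) ` B \<subseteq> arrows (arr_qtld Q) p r"
    using arr_Cmp_arrow[OF 8(1-3) 8(4)] 8(5) by blast
  have "fst ` (\<lambda>v. Cmp (arr_qtld Q) p q r v u) ` B = (\<lambda>v. Cmp Q X X' X'' v \<zeta>) ` fst ` B"
    "snd ` (\<lambda>v. Cmp (arr_qtld Q) p q r v u) ` B = (\<lambda>v. Cmp Q Y Y' Y'' v \<eta>) ` snd ` B"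
    unfolding image_image by (auto simp: eqs arr_Cmp intro!: image_cong)
  then show ?case
    using 8 im o B u by (simp add: eqs arr_Sup arr_Cmp cmp_Sup_left)
qed

text \<open>The outer factor is exchanged directly, as \<chi> \<circ> \<zeta>' = \<chi> \<circ>
  \<zeta>1'. To exchange the inner one, the square turns \<chi> \<circ> \<zeta>1' into \<eta>1'
  \<circ> \<psi>, which puts \<psi> in front of \<zeta>; then \<psi> \<circ> \<zeta> = \<psi>
  \<circ> \<zeta>1 applies and the square is used backwards.\<close>

lemma diag_rel_Cmp:
  assumes o: "(X, \<phi>, Y) \<in> Obj (arr_qtld Q)" "(X', \<psi>, Y') \<in> Obj (arr_qtld Q)"
    "(X'', \<chi>, Y'') \<in> Obj (arr_qtld Q)"
    and u: "((\<zeta>, \<eta>), (\<zeta>1, \<eta>1)) \<in> diag_rel Q (X, \<phi>, Y) (X', \<psi>, Y')"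
    and v: "((\<zeta>', \<eta>'), (\<zeta>1', \<eta>1')) \<in> diag_rel Q (X', \<psi>, Y') (X'', \<chi>, Y'')"
  shows "Cmp Q X X'' Y'' \<chi> (Cmp Q X X' X'' \<zeta>' \<zeta>) = Cmp Q X X'' Y'' \<chi> (Cmp Q X X' X'' \<zeta>1' \<zeta>1)"
proof -
  note o' = o[unfolded arr_Obj_iff]
  note u' = u[unfolded diag_rel_iff arr_arrow_iff]
  note v' = v[unfolded diag_rel_iff arr_arrow_iff]
  have "Cmp Q X X'' Y'' \<chi> (Cmp Q X X' X'' \<zeta>' \<zeta>) = Cmp Q X X' Y'' (Cmp Q X' X'' Y'' \<chi> \<zeta>1') \<zeta>"
  proof -
    have "Cmp Q X X'' Y'' \<chi> (Cmp Q X X' X'' \<zeta>' \<zeta>) = Cmp Q X X' Y'' (Cmp Q X' X'' Y'' \<chi> \<zeta>') \<zeta>"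
      using o' u' v' by (intro cmp_assoc[symmetric]) simp_all
    moreover have "Cmp Q X' X'' Y'' \<chi> \<zeta>' = Cmp Q X' X'' Y'' \<chi> \<zeta>1'"
      using v' by blast
    ultimately show ?thesis
      by (simp only:)
  qed
  also have "\<dots> = Cmp Q X X' Y'' (Cmp Q X' Y' Y'' \<eta>1' \<psi>) \<zeta>"
    by (simp only: v')
  also have "\<dots> = Cmp Q X Y' Y'' \<eta>1' (Cmp Q X X' Y' \<psi> \<zeta>)"
    using o' u' v' by (intro cmp_assoc) simp_all
  also have "\<dots> = Cmp Q X Y' Y'' \<eta>1' (Cmp Q X X' Y' \<psi> \<zeta>1)"
    using u' by (intro arg_cong[where f = "Cmp Q X Y' Y'' \<eta>1'"]) blast
  also have "\<dots> = Cmp Q X X' Y'' (Cmp Q X' Y' Y'' \<eta>1' \<psi>) \<zeta>1"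
    using o' u' v' by (intro cmp_assoc[symmetric]) simp_all
  also have "\<dots> = Cmp Q X X' Y'' (Cmp Q X' X'' Y'' \<chi> \<zeta>1') \<zeta>1"
    by (simp only: v')
  also have "\<dots> = Cmp Q X X'' Y'' \<chi> (Cmp Q X X' X'' \<zeta>1' \<zeta>1)"
    using o' u' v' by (intro cmp_assoc) simp_all
  finally show ?thesis .
qed

lemma diag_rel_congruence: "congruence (arr_qtld Q) (diag_rel Q)"
  unfolding congruence_def
proof (intro conjI ballI allI impI)
  fix p q
  show "equiv (arrows (arr_qtld Q) p q) (diag_rel Q p q)"
    by (cases p; cases q; intro equivI refl_onI symI transI)
      (auto simp: diag_rel_iff diag_rel_def split: prod.splits)
next
  fix p q r u u' v v'
  assume o: "p \<in> Obj (arr_qtld Q)" "q \<in> Obj (arr_qtld Q)" "r \<in> Obj (arr_qtld Q)"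
    and u: "(u, u') \<in> diag_rel Q p q" and v: "(v, v') \<in> diag_rel Q q r"
  obtain X \<phi> Y X' \<psi> Y' X'' \<chi> Y'' where eqs: "p = (X, \<phi>, Y)" "q = (X', \<psi>, Y')" "r = (X'', \<chi>, Y'')"
    by (metis prod_cases3)
  obtain u1 u2 u1' u2' v1 v2 v1' v2' where
    uv: "u = (u1, u2)" "u' = (u1', u2')" "v = (v1, v2)" "v' = (v1', v2')"
    by (metis surj_pair)
  note o' = o[unfolded eqs] and u' = u[unfolded eqs uv] and v' = v[unfolded eqs uv]
  note ua = u'[unfolded diag_rel_iff] and va = v'[unfolded diag_rel_iff]
  show "(Cmp (arr_qtld Q) p q r v u, Cmp (arr_qtld Q) p q r v' u') \<in> diag_rel Q p r"
    unfolding eqs uv arr_Cmp diag_rel_iff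
    using arr_cmp_arrow[OF o'] ua va diag_rel_Cmp[OF o' u' v'] by blast
next
  fix p q A
  assume o: "p \<in> Obj (arr_qtld Q)" "q \<in> Obj (arr_qtld Q)" and A: "A \<subseteq> diag_rel Q p q"
  obtain X \<phi> Y X' \<psi> Y' where eqs: "p = (X, \<phi>, Y)" "q = (X', \<psi>, Y')"
    by (metis prod_cases3)
  interpret arr: quantaloid "arr_qtld Q"
    by (rule quantaloid_arr)
  have rel: "fst x \<in> arrows (arr_qtld Q) p q" "snd x \<in> arrows (arr_qtld Q) p q"
    "Cmp Q X X' Y' \<psi> (fst (fst x)) = Cmp Q X X' Y' \<psi> (fst (snd x))" if "x \<in> A" for x
    using A that unfolding eqs by (cases x; fastforce simp: diag_rel_iff)+
  have sub: "fst ` A \<subseteq> arrows (arr_qtld Q) p q" "snd ` A \<subseteq> arrows (arr_qtld Q) p q"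
    using rel by auto
  have sub': "fst ` fst ` A \<subseteq> arrows Q X X'" "fst ` snd ` A \<subseteq> arrows Q X X'"
  proof -
    have "fst (fst x) \<in> arrows Q X X'" "fst (snd x) \<in> arrows Q X X'" if "x \<in> A" for x
      using rel(1,2)[OF that] unfolding eqs
      by (cases "fst x"; cases "snd x"; simp add: arr_arrow_iff)+
    then show "fst ` fst ` A \<subseteq> arrows Q X X'" "fst ` snd ` A \<subseteq> arrows Q X X'"
      by auto
  qed
  \<comment> \<open>Composition with \<psi> preserves the two joins, and it sends both families of
    first components to the same set.\<close>
  have "(\<lambda>u. Cmp Q X X' Y' \<psi> u) ` fst ` fst ` A = (\<lambda>u. Cmp Q X X' Y' \<psi> u) ` fst ` snd ` A"
    unfolding image_image using rel by (intro image_cong) auto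
  then have "Cmp Q X X' Y' \<psi> (\<Squnion>\<^bsub>Hom Q X X'\<^esub> (fst ` fst ` A)) = Cmp Q X X' Y' \<psi> (\<Squnion>\<^bsub>Hom Q X X'\<^esub> (fst ` snd ` A))"
    using o sub' by (simp add: eqs arr_Obj_iff cmp_Sup_right)
  moreover have "\<Squnion>\<^bsub>Hom (arr_qtld Q) p q\<^esub> (fst ` A) \<in> arrows (arr_qtld Q) p q"
    "\<Squnion>\<^bsub>Hom (arr_qtld Q) p q\<^esub> (snd ` A) \<in> arrows (arr_qtld Q) p q"
    using o sub by simp_all
  ultimately show "(\<Squnion>\<^bsub>Hom (arr_qtld Q) p q\<^esub> (fst ` A), \<Squnion>\<^bsub>Hom (arr_qtld Q) p q\<^esub> (snd ` A)) \<in> diag_rel Q p q"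
    using arr_Sup o sub unfolding eqs by (simp add: diag_rel_iff)
qed

lemma quotient_quantaloid_diag: "quotient_quantaloid (arr_qtld Q) (diag_rel Q)"
  by (intro quotient_quantaloid.intro quantaloid_arr quotient_quantaloid_axioms.intro
      diag_rel_congruence)

end

section \<open>Distributors\<close>

context quantaloid
begin

lemma cmp_le_trans_left:
  assumes "p \<in> Obj Q" "q \<in> Obj Q" "r \<in> Obj Q"
    and "u \<in> arrows Q p q" "v \<in> arrows Q q r" "v' \<in> arrows Q q r" "w \<in> arrows Q p r"
    and "v \<sqsubseteq>\<^bsub>Hom Q q r\<^esub> v'" "Cmp Q p q r v' u \<sqsubseteq>\<^bsub>Hom Q p r\<^esub> w"
  shows "Cmp Q p q r v u \<sqsubseteq>\<^bsub>Hom Q p r\<^esub> w"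
  using assms(1-4) hom_refl[OF assms(1,2,4)] assms(5-9) by (intro cmp_le_trans[of p q r u u v v' w])

lemma cmp_le_trans_right:
  assumes "p \<in> Obj Q" "q \<in> Obj Q" "r \<in> Obj Q"
    and "u \<in> arrows Q p q" "u' \<in> arrows Q p q" "v \<in> arrows Q q r" "w \<in> arrows Q p r"
    and "u \<sqsubseteq>\<^bsub>Hom Q p q\<^esub> u'" "Cmp Q p q r v u' \<sqsubseteq>\<^bsub>Hom Q p r\<^esub> w"
  shows "Cmp Q p q r v u \<sqsubseteq>\<^bsub>Hom Q p r\<^esub> w"
  using assms(1-6) hom_refl[OF assms(2,3,6)] assms(7-9) by (intro cmp_le_trans[of p q r u u' v v w])

lemma qcat_tp [simp]: "qcategory Q X \<Longrightarrow> x \<in> pts X \<Longrightarrow> tp X x \<in> Obj Q"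
  by (auto simp: qcategory_def)

lemma qcat_hm [simp]:
  "qcategory Q X \<Longrightarrow> x \<in> pts X \<Longrightarrow> y \<in> pts X \<Longrightarrow> hm X (x, y) \<in> arrows Q (tp X x) (tp X y)"
  by (auto simp: qcategory_def dest!: PiE_mem[where x = "(x, y)"])

lemma qcat_hm_extensional: "qcategory Q X \<Longrightarrow> hm X \<in> extensional (pts X \<times> pts X)"
  by (simp add: qcategory_def PiE_def)

lemma qcat_Idn:
  "qcategory Q X \<Longrightarrow> x \<in> pts X \<Longrightarrow> Idn Q (tp X x) \<sqsubseteq>\<^bsub>Hom Q (tp X x) (tp X x)\<^esub> hm X (x, x)"
  by (simp add: qcategory_def)

lemma qcat_Cmp:
  "qcategory Q X \<Longrightarrow> x \<in> pts X \<Longrightarrow> y \<in> pts X \<Longrightarrow> z \<in> pts X \<Longrightarrow>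
    Cmp Q (tp X x) (tp X y) (tp X z) (hm X (y, z)) (hm X (x, y))
      \<sqsubseteq>\<^bsub>Hom Q (tp X x) (tp X z)\<^esub> hm X (x, z)"
  by (simp add: qcategory_def)

lemma dist_arrow [simp]:
  "\<phi> \<in> dist Q X Y \<Longrightarrow> x \<in> pts X \<Longrightarrow> y \<in> pts Y \<Longrightarrow> \<phi> (x, y) \<in> arrows Q (tp X x) (tp Y y)"
  by (auto simp: dist_def dest!: PiE_mem[where x = "(x, y)"])

lemma dist_extensional: "\<phi> \<in> dist Q X Y \<Longrightarrow> \<phi> \<in> extensional (pts X \<times> pts Y)"
  by (simp add: dist_def PiE_def)

lemma dist_eqI:
  assumes "\<phi> \<in> dist Q X Y" "\<psi> \<in> dist Q X Y"
    and "\<And>x y. x \<in> pts X \<Longrightarrow> y \<in> pts Y \<Longrightarrow> \<phi> (x, y) = \<psi> (x, y)"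
  shows "\<phi> = \<psi>"
  using assms by (intro extensionalityI[OF dist_extensional dist_extensional]) auto

text \<open>The two-sided action law is split into two one-sided laws. \<open>dist_left\<close> and
  \<open>dist_right\<close> undo this by putting an identity arrow below the hom-arrow at the other
  end.\<close>

lemma distI:
  assumes X: "qcategory Q X" and Y: "qcategory Q Y" and ext: "\<phi> \<in> extensional (pts X \<times> pts Y)"
    and arr: "\<And>x y. x \<in> pts X \<Longrightarrow> y \<in> pts Y \<Longrightarrow> \<phi> (x, y) \<in> arrows Q (tp X x) (tp Y y)"
    and left: "\<And>x y y'. x \<in> pts X \<Longrightarrow> y \<in> pts Y \<Longrightarrow> y' \<in> pts Y \<Longrightarrow>
      Cmp Q (tp X x) (tp Y y) (tp Y y') (hm Y (y, y')) (\<phi> (x, y))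
        \<sqsubseteq>\<^bsub>Hom Q (tp X x) (tp Y y')\<^esub> \<phi> (x, y')"
    and right: "\<And>x x' y. x \<in> pts X \<Longrightarrow> x' \<in> pts X \<Longrightarrow> y \<in> pts Y \<Longrightarrow>
      Cmp Q (tp X x') (tp X x) (tp Y y) (\<phi> (x, y)) (hm X (x', x))
        \<sqsubseteq>\<^bsub>Hom Q (tp X x') (tp Y y)\<^esub> \<phi> (x', y)"
  shows "\<phi> \<in> dist Q X Y"
  unfolding dist_def
proof (intro CollectI conjI ballI)
  show "\<phi> \<in> (\<Pi>\<^sub>E (x, y)\<in>pts X \<times> pts Y. arrows Q (tp X x) (tp Y y))"
    using ext arr by (auto simp: PiE_iff)
  fix x x' y y' assume xy: "x \<in> pts X" "x' \<in> pts X" "y \<in> pts Y" "y' \<in> pts Y"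
  show "Cmp Q (tp X x') (tp X x) (tp Y y')
           (Cmp Q (tp X x) (tp Y y) (tp Y y') (hm Y (y, y')) (\<phi> (x, y))) (hm X (x', x))
         \<sqsubseteq>\<^bsub>Hom Q (tp X x') (tp Y y')\<^esub> \<phi> (x', y')"
    by (rule cmp_le_trans_left[where v' = "\<phi> (x, y')"])
      (use xy X Y left right arr in \<open>simp_all add: cmp_arrow\<close>)
qed

lemma dist_left:
  assumes X: "qcategory Q X" and Y: "qcategory Q Y" and \<phi>: "\<phi> \<in> dist Q X Y"
    and xy: "x \<in> pts X" "y \<in> pts Y" "y' \<in> pts Y"
  shows "Cmp Q (tp X x) (tp Y y) (tp Y y') (hm Y (y, y')) (\<phi> (x, y))
    \<sqsubseteq>\<^bsub>Hom Q (tp X x) (tp Y y')\<^esub> \<phi> (x, y')"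
proof -
  let ?u = "Cmp Q (tp X x) (tp Y y) (tp Y y') (hm Y (y, y')) (\<phi> (x, y))"
  have u: "?u \<in> arrows Q (tp X x) (tp Y y')"
    using assms by (simp add: cmp_arrow)
  have le: "Cmp Q (tp X x) (tp X x) (tp Y y') ?u (hm X (x, x)) \<sqsubseteq>\<^bsub>Hom Q (tp X x) (tp Y y')\<^esub> \<phi> (x, y')"
    using \<phi> xy by (simp add: dist_def)
  have "Cmp Q (tp X x) (tp X x) (tp Y y') ?u (Idn Q (tp X x)) \<sqsubseteq>\<^bsub>Hom Q (tp X x) (tp Y y')\<^esub> \<phi> (x, y')"
    by (rule cmp_le_trans_right[where u' = "hm X (x, x)"])
      (use le assms u in \<open>simp_all add: idn_arrow qcat_Idn\<close>)
  then show ?thesis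
    using assms u by (simp add: cmp_idn_right)
qed

lemma dist_right:
  assumes X: "qcategory Q X" and Y: "qcategory Q Y" and \<phi>: "\<phi> \<in> dist Q X Y"
    and xy: "x \<in> pts X" "x' \<in> pts X" "y \<in> pts Y"
  shows "Cmp Q (tp X x') (tp X x) (tp Y y) (\<phi> (x, y)) (hm X (x', x))
    \<sqsubseteq>\<^bsub>Hom Q (tp X x') (tp Y y)\<^esub> \<phi> (x', y)"
proof -
  have "Cmp Q (tp X x') (tp X x) (tp Y y)
      (Cmp Q (tp X x) (tp Y y) (tp Y y) (Idn Q (tp Y y)) (\<phi> (x, y))) (hm X (x', x))
         \<sqsubseteq>\<^bsub>Hom Q (tp X x') (tp Y y)\<^esub> \<phi> (x', y)"
  proof (rule cmp_le_trans_left)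
    show "Cmp Q (tp X x') (tp X x) (tp Y y)
      (Cmp Q (tp X x) (tp Y y) (tp Y y) (hm Y (y, y)) (\<phi> (x, y))) (hm X (x', x))
         \<sqsubseteq>\<^bsub>Hom Q (tp X x') (tp Y y)\<^esub> \<phi> (x', y)"
      using \<phi> xy by (simp add: dist_def)
    show "Cmp Q (tp X x) (tp Y y) (tp Y y) (Idn Q (tp Y y)) (\<phi> (x, y)) \<sqsubseteq>\<^bsub>Hom Q (tp X x) (tp Y y)\<^esub>
      Cmp Q (tp X x) (tp Y y) (tp Y y) (hm Y (y, y)) (\<phi> (x, y))"
      using assms by (intro cmp_mono) (simp_all add: idn_arrow qcat_Idn hom_refl)
  qed (use assms in \<open>simp_all add: cmp_arrow idn_arrow\<close>)
  then show ?thesis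
    using assms by (simp add: cmp_idn_left)
qed

section \<open>Composition of distributors\<close>

lemma dist_comp_arrows:
  assumes "qcategory Q X" "qcategory Q Y" "qcategory Q Z" "\<phi> \<in> dist Q X Y" "\<psi> \<in> dist Q Y Z"
    and "x \<in> pts X" "z \<in> pts Z"
  shows "(\<lambda>y. Cmp Q (tp X x) (tp Y y) (tp Z z) (\<psi> (y, z)) (\<phi> (x, y))) ` pts Y \<subseteq> arrows Q (tp X x) (tp Z z)"
  using assms by (auto intro!: cmp_arrow)

lemma dist_comp_arrow [simp]:
  assumes "qcategory Q X" "qcategory Q Y" "qcategory Q Z" "\<phi> \<in> dist Q X Y" "\<psi> \<in> dist Q Y Z"
    and "x \<in> pts X" "z \<in> pts Z"
  shows "dist_comp Q X Y Z \<psi> \<phi> (x, z) \<in> arrows Q (tp X x) (tp Z z)"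
  using assms dist_comp_arrows[OF assms] by (simp add: dist_comp_def)

lemma dist_comp_le_iff:
  assumes "qcategory Q X" "qcategory Q Y" "qcategory Q Z" "\<phi> \<in> dist Q X Y" "\<psi> \<in> dist Q Y Z"
    and "x \<in> pts X" "z \<in> pts Z" "b \<in> arrows Q (tp X x) (tp Z z)"
  shows "dist_comp Q X Y Z \<psi> \<phi> (x, z) \<sqsubseteq>\<^bsub>Hom Q (tp X x) (tp Z z)\<^esub> b \<longleftrightarrow>
    (\<forall>y\<in>pts Y. Cmp Q (tp X x) (tp Y y) (tp Z z) (\<psi> (y, z)) (\<phi> (x, y)) \<sqsubseteq>\<^bsub>Hom Q (tp X x) (tp Z z)\<^esub> b)"
  using assms dist_comp_arrows[OF assms(1-7)] by (simp add: dist_comp_def Sup_le_iff)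

lemma dist_comp_upper:
  assumes "qcategory Q X" "qcategory Q Y" "qcategory Q Z" "\<phi> \<in> dist Q X Y" "\<psi> \<in> dist Q Y Z"
    and "x \<in> pts X" "z \<in> pts Z" "y \<in> pts Y"
  shows "Cmp Q (tp X x) (tp Y y) (tp Z z) (\<psi> (y, z)) (\<phi> (x, y))
    \<sqsubseteq>\<^bsub>Hom Q (tp X x) (tp Z z)\<^esub> dist_comp Q X Y Z \<psi> \<phi> (x, z)"
  using assms dist_comp_le_iff[OF assms(1-7) dist_comp_arrow[OF assms(1-7)]]
    hom_refl[OF _ _ dist_comp_arrow[OF assms(1-7)]] by simp

lemma cmp_dist_comp_right_le_iff:
  assumes "qcategory Q X" "qcategory Q Y" "qcategory Q Z" "\<phi> \<in> dist Q X Y" "\<psi> \<in> dist Q Y Z"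
    and "x \<in> pts X" "z \<in> pts Z" "r \<in> Obj Q" "v \<in> arrows Q (tp Z z) r" "b \<in> arrows Q (tp X x) r"
  shows "Cmp Q (tp X x) (tp Z z) r v (dist_comp Q X Y Z \<psi> \<phi> (x, z)) \<sqsubseteq>\<^bsub>Hom Q (tp X x) r\<^esub> b \<longleftrightarrow>
    (\<forall>y\<in>pts Y. Cmp Q (tp X x) (tp Z z) r v (Cmp Q (tp X x) (tp Y y) (tp Z z) (\<psi> (y, z)) (\<phi> (x, y)))
      \<sqsubseteq>\<^bsub>Hom Q (tp X x) r\<^esub> b)"
  using assms dist_comp_arrows[OF assms(1-7)] by (simp add: dist_comp_def cmp_Sup_right_le_iff)

lemma cmp_dist_comp_left_le_iff:
  assumes "qcategory Q X" "qcategory Q Y" "qcategory Q Z" "\<phi> \<in> dist Q X Y" "\<psi> \<in> dist Q Y Z"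
    and "x \<in> pts X" "z \<in> pts Z" "p \<in> Obj Q" "u \<in> arrows Q p (tp X x)" "b \<in> arrows Q p (tp Z z)"
  shows "Cmp Q p (tp X x) (tp Z z) (dist_comp Q X Y Z \<psi> \<phi> (x, z)) u \<sqsubseteq>\<^bsub>Hom Q p (tp Z z)\<^esub> b \<longleftrightarrow>
    (\<forall>y\<in>pts Y. Cmp Q p (tp X x) (tp Z z) (Cmp Q (tp X x) (tp Y y) (tp Z z) (\<psi> (y, z)) (\<phi> (x, y))) u
      \<sqsubseteq>\<^bsub>Hom Q p (tp Z z)\<^esub> b)"
  using assms dist_comp_arrows[OF assms(1-7)] by (simp add: dist_comp_def cmp_Sup_left_le_iff)

lemma dist_comp_extensional [simp]: "dist_comp Q X Y Z \<psi> \<phi> \<in> extensional (pts X \<times> pts Z)"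
  by (simp add: dist_comp_def)

text \<open>Each action law is checked on the joinands, where associativity moves the hom-arrow of Z
  next to \<psi> and that of X next to \<phi>.\<close>

lemma dist_comp_dist [simp]:
  assumes cats: "qcategory Q X" "qcategory Q Y" "qcategory Q Z"
    and \<phi>: "\<phi> \<in> dist Q X Y" and \<psi>: "\<psi> \<in> dist Q Y Z"
  shows "dist_comp Q X Y Z \<psi> \<phi> \<in> dist Q X Z"
proof (rule distI)
  fix x z z' assume p: "x \<in> pts X" "z \<in> pts Z" "z' \<in> pts Z"
  have "Cmp Q (tp X x) (tp Z z) (tp Z z') (hm Z (z, z'))
        (Cmp Q (tp X x) (tp Y y) (tp Z z) (\<psi> (y, z)) (\<phi> (x, y)))
      \<sqsubseteq>\<^bsub>Hom Q (tp X x) (tp Z z')\<^esub> dist_comp Q X Y Z \<psi> \<phi> (x, z')" if y: "y \<in> pts Y" for y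
  proof -
    have "Cmp Q (tp X x) (tp Y y) (tp Z z') (Cmp Q (tp Y y) (tp Z z) (tp Z z') (hm Z (z, z')) (\<psi> (y, z)))
        (\<phi> (x, y)) \<sqsubseteq>\<^bsub>Hom Q (tp X x) (tp Z z')\<^esub> dist_comp Q X Y Z \<psi> \<phi> (x, z')"
      by (rule cmp_le_trans_left[where v' = "\<psi> (y, z')"])
        (use dist_left[OF cats(2,3) \<psi> y p(2,3)] dist_comp_upper[OF assms p(1,3) y] assms p y in \<open>simp_all add: cmp_arrow\<close>)
    then show ?thesis
      using assms p y by (simp add: cmp_assoc)
  qed
  then show "Cmp Q (tp X x) (tp Z z) (tp Z z') (hm Z (z, z')) (dist_comp Q X Y Z \<psi> \<phi> (x, z))
      \<sqsubseteq>\<^bsub>Hom Q (tp X x) (tp Z z')\<^esub> dist_comp Q X Y Z \<psi> \<phi> (x, z')"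
    using assms p by (simp add: cmp_dist_comp_right_le_iff)
next
  fix x x' z assume p: "x \<in> pts X" "x' \<in> pts X" "z \<in> pts Z"
  have "Cmp Q (tp X x') (tp X x) (tp Z z)
        (Cmp Q (tp X x) (tp Y y) (tp Z z) (\<psi> (y, z)) (\<phi> (x, y))) (hm X (x', x))
      \<sqsubseteq>\<^bsub>Hom Q (tp X x') (tp Z z)\<^esub> dist_comp Q X Y Z \<psi> \<phi> (x', z)" if y: "y \<in> pts Y" for y
  proof -
    have "Cmp Q (tp X x') (tp Y y) (tp Z z) (\<psi> (y, z))
        (Cmp Q (tp X x') (tp X x) (tp Y y) (\<phi> (x, y)) (hm X (x', x)))
          \<sqsubseteq>\<^bsub>Hom Q (tp X x') (tp Z z)\<^esub> dist_comp Q X Y Z \<psi> \<phi> (x', z)"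
      by (rule cmp_le_trans_right[where u' = "\<phi> (x', y)"])
        (use dist_right[OF cats(1,2) \<phi> p(1,2) y] dist_comp_upper[OF assms p(2,3) y] assms p y in \<open>simp_all add: cmp_arrow\<close>)
    then show ?thesis
      using assms p y by (simp add: cmp_assoc)
  qed
  then show "Cmp Q (tp X x') (tp X x) (tp Z z) (dist_comp Q X Y Z \<psi> \<phi> (x, z)) (hm X (x', x))
      \<sqsubseteq>\<^bsub>Hom Q (tp X x') (tp Z z)\<^esub> dist_comp Q X Y Z \<psi> \<phi> (x', z)"
    using assms p by (simp add: cmp_dist_comp_left_le_iff)
qed (use assms in simp_all)

text \<open>Either side lies below \<open>b\<close> iff all threefold composites through points y
  and z do; what remains is associativity in Q and an exchange of quantifiers.\<close>

lemma dist_comp_assoc: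
  assumes cats: "qcategory Q X" "qcategory Q Y" "qcategory Q Z" "qcategory Q W"
    and dists: "\<phi> \<in> dist Q X Y" "\<psi> \<in> dist Q Y Z" "\<chi> \<in> dist Q Z W"
  shows "dist_comp Q X Y W (dist_comp Q Y Z W \<chi> \<psi>) \<phi> = dist_comp Q X Z W \<chi> (dist_comp Q X Y Z \<psi> \<phi>)"
    (is "?l = ?r")
proof (rule dist_eqI)
  fix x w assume p: "x \<in> pts X" "w \<in> pts W"
  show "?l (x, w) = ?r (x, w)"
  proof (rule hom_eqI)
    fix b assume b: "b \<in> arrows Q (tp X x) (tp W w)"
    have "?l (x, w) \<sqsubseteq>\<^bsub>Hom Q (tp X x) (tp W w)\<^esub> b \<longleftrightarrow>
      (\<forall>y\<in>pts Y. \<forall>z\<in>pts Z. Cmp Q (tp X x) (tp Y y) (tp W w)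
        (Cmp Q (tp Y y) (tp Z z) (tp W w) (\<chi> (z, w)) (\<psi> (y, z))) (\<phi> (x, y)) \<sqsubseteq>\<^bsub>Hom Q (tp X x) (tp W w)\<^esub> b)"
      using assms p b by (simp add: dist_comp_le_iff cmp_dist_comp_left_le_iff)
    also have "\<dots> \<longleftrightarrow> (\<forall>y\<in>pts Y. \<forall>z\<in>pts Z. Cmp Q (tp X x) (tp Z z) (tp W w) (\<chi> (z, w))
        (Cmp Q (tp X x) (tp Y y) (tp Z z) (\<psi> (y, z)) (\<phi> (x, y))) \<sqsubseteq>\<^bsub>Hom Q (tp X x) (tp W w)\<^esub> b)"
      using assms p by (simp add: cmp_assoc)
    also have "\<dots> \<longleftrightarrow> ?r (x, w) \<sqsubseteq>\<^bsub>Hom Q (tp X x) (tp W w)\<^esub> b"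
      using assms p b by (auto simp: dist_comp_le_iff cmp_dist_comp_right_le_iff)
    finally show "?l (x, w) \<sqsubseteq>\<^bsub>Hom Q (tp X x) (tp W w)\<^esub> b \<longleftrightarrow> ?r (x, w) \<sqsubseteq>\<^bsub>Hom Q (tp X x) (tp W w)\<^esub> b" .
  qed (use assms p in simp_all)
qed (use assms in simp_all)

lemma hm_dist [simp]: "qcategory Q X \<Longrightarrow> hm X \<in> dist Q X X"
  by (rule distI) (auto simp: qcat_Cmp qcat_hm_extensional)

text \<open>For composites whose join is attained at a single point: at x or y itself in the unit
  laws, and at an open presheaf in composites with \<open>kappa\<close>.\<close>

lemma dist_comp_eqI:
  assumes "qcategory Q X" "qcategory Q Y" "qcategory Q Z" "\<phi> \<in> dist Q X Y" "\<psi> \<in> dist Q Y Z" "\<chi> \<in> dist Q X Z"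
    and upper: "\<And>x y z. x \<in> pts X \<Longrightarrow> y \<in> pts Y \<Longrightarrow> z \<in> pts Z \<Longrightarrow>
      Cmp Q (tp X x) (tp Y y) (tp Z z) (\<psi> (y, z)) (\<phi> (x, y)) \<sqsubseteq>\<^bsub>Hom Q (tp X x) (tp Z z)\<^esub> \<chi> (x, z)"
    and attained: "\<And>x z. x \<in> pts X \<Longrightarrow> z \<in> pts Z \<Longrightarrow> \<exists>y\<in>pts Y.
      \<chi> (x, z) \<sqsubseteq>\<^bsub>Hom Q (tp X x) (tp Z z)\<^esub> Cmp Q (tp X x) (tp Y y) (tp Z z) (\<psi> (y, z)) (\<phi> (x, y))"
  shows "dist_comp Q X Y Z \<psi> \<phi> = \<chi>"
proof (rule dist_eqI)
  fix x z assume p: "x \<in> pts X" "z \<in> pts Z"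
  obtain y where y: "y \<in> pts Y"
    "\<chi> (x, z) \<sqsubseteq>\<^bsub>Hom Q (tp X x) (tp Z z)\<^esub> Cmp Q (tp X x) (tp Y y) (tp Z z) (\<psi> (y, z)) (\<phi> (x, y))"
    using attained[OF p] by blast
  have le: "dist_comp Q X Y Z \<psi> \<phi> (x, z) \<sqsubseteq>\<^bsub>Hom Q (tp X x) (tp Z z)\<^esub> \<chi> (x, z)"
    using assms(1-6) p upper by (simp add: dist_comp_le_iff)
  have ge: "\<chi> (x, z) \<sqsubseteq>\<^bsub>Hom Q (tp X x) (tp Z z)\<^esub> dist_comp Q X Y Z \<psi> \<phi> (x, z)"
    by (rule hom_trans[OF _ _ _ _ _ y(2) dist_comp_upper[OF assms(1-5) p y(1)]])
      (use assms(1-6) p y in \<open>simp_all add: cmp_arrow\<close>)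
  show "dist_comp Q X Y Z \<psi> \<phi> (x, z) = \<chi> (x, z)"
    by (rule hom_antisym[OF _ _ _ _ le ge]) (use assms(1-6) p in simp_all)
qed (use assms in simp_all)

lemma dist_comp_hm_right [simp]:
  assumes "qcategory Q X" "qcategory Q Y" "\<phi> \<in> dist Q X Y"
  shows "dist_comp Q X X Y \<phi> (hm X) = \<phi>"
proof (rule dist_comp_eqI)
  fix x y assume p: "x \<in> pts X" "y \<in> pts Y"
  have "Cmp Q (tp X x) (tp X x) (tp Y y) (\<phi> (x, y)) (Idn Q (tp X x)) \<sqsubseteq>\<^bsub>Hom Q (tp X x) (tp Y y)\<^esub>
      Cmp Q (tp X x) (tp X x) (tp Y y) (\<phi> (x, y)) (hm X (x, x))"
    using assms p by (intro cmp_mono) (simp_all add: hom_refl idn_arrow qcat_Idn)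
  then show "\<exists>x'\<in>pts X. \<phi> (x, y) \<sqsubseteq>\<^bsub>Hom Q (tp X x) (tp Y y)\<^esub>
      Cmp Q (tp X x) (tp X x') (tp Y y) (\<phi> (x', y)) (hm X (x, x'))"
    using assms p by (intro bexI[of _ x]) (simp_all add: cmp_idn_right)
qed (use assms dist_right[OF assms] in simp_all)

lemma dist_comp_hm_left [simp]:
  assumes "qcategory Q X" "qcategory Q Y" "\<phi> \<in> dist Q X Y"
  shows "dist_comp Q X Y Y (hm Y) \<phi> = \<phi>"
proof (rule dist_comp_eqI)
  fix x y assume p: "x \<in> pts X" "y \<in> pts Y"
  have "Cmp Q (tp X x) (tp Y y) (tp Y y) (Idn Q (tp Y y)) (\<phi> (x, y)) \<sqsubseteq>\<^bsub>Hom Q (tp X x) (tp Y y)\<^esub>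
      Cmp Q (tp X x) (tp Y y) (tp Y y) (hm Y (y, y)) (\<phi> (x, y))"
    using assms p by (intro cmp_mono) (simp_all add: hom_refl idn_arrow qcat_Idn)
  then show "\<exists>y'\<in>pts Y. \<phi> (x, y) \<sqsubseteq>\<^bsub>Hom Q (tp X x) (tp Y y)\<^esub>
      Cmp Q (tp X x) (tp Y y') (tp Y y) (hm Y (y', y)) (\<phi> (x, y'))"
    using assms p by (intro bexI[of _ y]) (simp_all add: cmp_idn_left)
qed (use assms dist_left[OF assms] in simp_all)

text \<open>Given explicitly instead of as a join in \<open>qdist_qtld\<close>, because it is also
  needed for distributors into \<open>one_cat\<close>, which is not an object of that quantaloid.
  The two are identified in \<open>qdist_Sup\<close>.\<close>

definition dist_Sup ::
  "('v, 'o, 'a) qcat \<Rightarrow> ('w, 'o, 'a) qcat \<Rightarrow> ('v \<times> 'w \<Rightarrow> 'a) set \<Rightarrow> 'v \<times> 'w \<Rightarrow> 'a" where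
  "dist_Sup X Y A = (\<lambda>(x, y)\<in>pts X \<times> pts Y. \<Squnion>\<^bsub>Hom Q (tp X x) (tp Y y)\<^esub> ((\<lambda>\<phi>. \<phi> (x, y)) ` A))"

lemma dist_Sup_apply:
  "x \<in> pts X \<Longrightarrow> y \<in> pts Y \<Longrightarrow>
    dist_Sup X Y A (x, y) = \<Squnion>\<^bsub>Hom Q (tp X x) (tp Y y)\<^esub> ((\<lambda>\<phi>. \<phi> (x, y)) ` A)"
  by (simp add: dist_Sup_def)

lemma dist_vals: "A \<subseteq> dist Q X Y \<Longrightarrow> x \<in> pts X \<Longrightarrow> y \<in> pts Y \<Longrightarrow>
    (\<lambda>\<phi>. \<phi> (x, y)) ` A \<subseteq> arrows Q (tp X x) (tp Y y)"
  by (auto simp: subset_iff)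

lemma dist_Sup_le_iff:
  assumes "qcategory Q X" "qcategory Q Y" "A \<subseteq> dist Q X Y" "x \<in> pts X" "y \<in> pts Y"
    and "b \<in> arrows Q (tp X x) (tp Y y)"
  shows "dist_Sup X Y A (x, y) \<sqsubseteq>\<^bsub>Hom Q (tp X x) (tp Y y)\<^esub> b \<longleftrightarrow>
    (\<forall>\<phi>\<in>A. \<phi> (x, y) \<sqsubseteq>\<^bsub>Hom Q (tp X x) (tp Y y)\<^esub> b)"
  using assms dist_vals[OF assms(3-5)] by (simp add: dist_Sup_apply Sup_le_iff)

lemma dist_Sup_arrow [simp]:
  assumes "qcategory Q X" "qcategory Q Y" "A \<subseteq> dist Q X Y" "x \<in> pts X" "y \<in> pts Y"
  shows "dist_Sup X Y A (x, y) \<in> arrows Q (tp X x) (tp Y y)"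
  using assms dist_vals[OF assms(3-5)] by (simp add: dist_Sup_apply)

lemma dist_Sup_upper:
  assumes "qcategory Q X" "qcategory Q Y" "A \<subseteq> dist Q X Y" "x \<in> pts X" "y \<in> pts Y" "\<phi> \<in> A"
  shows "\<phi> (x, y) \<sqsubseteq>\<^bsub>Hom Q (tp X x) (tp Y y)\<^esub> dist_Sup X Y A (x, y)"
  using assms(6) dist_Sup_le_iff[OF assms(1-5) dist_Sup_arrow[OF assms(1-5)]]
    hom_refl[OF _ _ dist_Sup_arrow[OF assms(1-5)]] assms by simp

lemma dist_Sup_dist [simp]:
  assumes X: "qcategory Q X" and Y: "qcategory Q Y" and A: "A \<subseteq> dist Q X Y"
  shows "dist_Sup X Y A \<in> dist Q X Y"
proof (rule distI[OF X Y])
  show "dist_Sup X Y A \<in> extensional (pts X \<times> pts Y)"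
    by (simp add: dist_Sup_def)
next
  fix x y y' assume p: "x \<in> pts X" "y \<in> pts Y" "y' \<in> pts Y"
  have "Cmp Q (tp X x) (tp Y y) (tp Y y') (hm Y (y, y')) (\<phi> (x, y))
        \<sqsubseteq>\<^bsub>Hom Q (tp X x) (tp Y y')\<^esub> dist_Sup X Y A (x, y')" if \<phi>: "\<phi> \<in> A" for \<phi>
  proof -
    have d: "\<phi> \<in> dist Q X Y"
      using \<phi> A by blast
    show ?thesis
      by (rule hom_trans[OF _ _ _ _ _ dist_left[OF X Y d p] dist_Sup_upper[OF assms p(1,3) \<phi>]])
        (use assms p d in \<open>simp_all add: cmp_arrow\<close>)
  qed
  then show "Cmp Q (tp X x) (tp Y y) (tp Y y') (hm Y (y, y')) (dist_Sup X Y A (x, y))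
        \<sqsubseteq>\<^bsub>Hom Q (tp X x) (tp Y y')\<^esub> dist_Sup X Y A (x, y')"
    using assms p dist_vals[OF A p(1,2)]
    by (simp add: dist_Sup_apply[OF p(1,2)] cmp_Sup_right_le_iff)
next
  fix x x' y assume p: "x \<in> pts X" "x' \<in> pts X" "y \<in> pts Y"
  have "Cmp Q (tp X x') (tp X x) (tp Y y) (\<phi> (x, y)) (hm X (x', x))
        \<sqsubseteq>\<^bsub>Hom Q (tp X x') (tp Y y)\<^esub> dist_Sup X Y A (x', y)" if \<phi>: "\<phi> \<in> A" for \<phi>
  proof -
    have d: "\<phi> \<in> dist Q X Y"
      using \<phi> A by blast
    show ?thesis
      by (rule hom_trans[OF _ _ _ _ _ dist_right[OF X Y d p] dist_Sup_upper[OF assms p(2,3) \<phi>]])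
        (use assms p d in \<open>simp_all add: cmp_arrow\<close>)
  qed
  then show "Cmp Q (tp X x') (tp X x) (tp Y y) (dist_Sup X Y A (x, y)) (hm X (x', x))
        \<sqsubseteq>\<^bsub>Hom Q (tp X x') (tp Y y)\<^esub> dist_Sup X Y A (x', y)"
    using assms p dist_vals[OF A p(1,3)]
    by (simp add: dist_Sup_apply[OF p(1,3)] cmp_Sup_left_le_iff)
qed (use assms in simp_all)

lemma dist_comp_Sup_right:
  assumes cats: "qcategory Q X" "qcategory Q Y" "qcategory Q Z"
    and A: "A \<subseteq> dist Q X Y" and \<psi>: "\<psi> \<in> dist Q Y Z"
  shows "dist_comp Q X Y Z \<psi> (dist_Sup X Y A) = dist_Sup X Z ((\<lambda>\<phi>. dist_comp Q X Y Z \<psi> \<phi>) ` A)"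
    (is "?l = ?r")
proof (rule dist_eqI)
  have im: "(\<lambda>\<phi>. dist_comp Q X Y Z \<psi> \<phi>) ` A \<subseteq> dist Q X Z"
    using assms by auto
  show "?r \<in> dist Q X Z"
    using im cats by simp
  fix x z assume p: "x \<in> pts X" "z \<in> pts Z"
  show "?l (x, z) = ?r (x, z)"
  proof (rule hom_eqI)
    fix b assume b: "b \<in> arrows Q (tp X x) (tp Z z)"
    have "?l (x, z) \<sqsubseteq>\<^bsub>Hom Q (tp X x) (tp Z z)\<^esub> b \<longleftrightarrow> (\<forall>y\<in>pts Y. \<forall>\<phi>\<in>A.
        Cmp Q (tp X x) (tp Y y) (tp Z z) (\<psi> (y, z)) (\<phi> (x, y)) \<sqsubseteq>\<^bsub>Hom Q (tp X x) (tp Z z)\<^esub> b)"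
      using assms p b dist_vals[OF A p(1)]
      by (simp add: dist_comp_le_iff dist_Sup_apply cmp_Sup_right_le_iff)
    also have "\<dots> \<longleftrightarrow> ?r (x, z) \<sqsubseteq>\<^bsub>Hom Q (tp X x) (tp Z z)\<^esub> b"
      using assms p b im A by (auto simp: dist_comp_le_iff dist_Sup_le_iff subset_iff)
    finally show "?l (x, z) \<sqsubseteq>\<^bsub>Hom Q (tp X x) (tp Z z)\<^esub> b \<longleftrightarrow> ?r (x, z) \<sqsubseteq>\<^bsub>Hom Q (tp X x) (tp Z z)\<^esub> b" .
  qed (use assms p im in simp_all)
qed (use assms in simp_all)

lemma dist_comp_Sup_left:
  assumes cats: "qcategory Q X" "qcategory Q Y" "qcategory Q Z"
    and B: "B \<subseteq> dist Q Y Z" and \<phi>: "\<phi> \<in> dist Q X Y"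
  shows "dist_comp Q X Y Z (dist_Sup Y Z B) \<phi> = dist_Sup X Z ((\<lambda>\<psi>. dist_comp Q X Y Z \<psi> \<phi>) ` B)"
    (is "?l = ?r")
proof (rule dist_eqI)
  have im: "(\<lambda>\<psi>. dist_comp Q X Y Z \<psi> \<phi>) ` B \<subseteq> dist Q X Z"
    using assms by auto
  show "?r \<in> dist Q X Z"
    using im cats by simp
  fix x z assume p: "x \<in> pts X" "z \<in> pts Z"
  show "?l (x, z) = ?r (x, z)"
  proof (rule hom_eqI)
    fix b assume b: "b \<in> arrows Q (tp X x) (tp Z z)"
    have "?l (x, z) \<sqsubseteq>\<^bsub>Hom Q (tp X x) (tp Z z)\<^esub> b \<longleftrightarrow> (\<forall>y\<in>pts Y. \<forall>\<psi>\<in>B.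
        Cmp Q (tp X x) (tp Y y) (tp Z z) (\<psi> (y, z)) (\<phi> (x, y)) \<sqsubseteq>\<^bsub>Hom Q (tp X x) (tp Z z)\<^esub> b)"
      using assms p b dist_vals[OF B _ p(2)]
      by (simp add: dist_comp_le_iff dist_Sup_apply cmp_Sup_left_le_iff)
    also have "\<dots> \<longleftrightarrow> ?r (x, z) \<sqsubseteq>\<^bsub>Hom Q (tp X x) (tp Z z)\<^esub> b"
      using assms p b im B by (auto simp: dist_comp_le_iff dist_Sup_le_iff subset_iff)
    finally show "?l (x, z) \<sqsubseteq>\<^bsub>Hom Q (tp X x) (tp Z z)\<^esub> b \<longleftrightarrow> ?r (x, z) \<sqsubseteq>\<^bsub>Hom Q (tp X x) (tp Z z)\<^esub> b" .
  qed (use assms p im in simp_all)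
qed (use assms in simp_all)

section \<open>Residuals of distributors\<close>

lemma dist_lres_arrows:
  assumes "qcategory Q X" "qcategory Q Y" "qcategory Q Z" "\<phi> \<in> dist Q X Y" "\<xi> \<in> dist Q X Z"
    and "y \<in> pts Y" "z \<in> pts Z"
  shows "(\<lambda>x. lres Q (tp X x) (tp Y y) (tp Z z) (\<xi> (x, z)) (\<phi> (x, y))) ` pts X \<subseteq> arrows Q (tp Y y) (tp Z z)"
  using assms by (auto intro!: lres_arrow)

lemma dist_lres_arrow [simp]:
  assumes "qcategory Q X" "qcategory Q Y" "qcategory Q Z" "\<phi> \<in> dist Q X Y" "\<xi> \<in> dist Q X Z"
    and "y \<in> pts Y" "z \<in> pts Z"
  shows "dist_lres Q X Y Z \<xi> \<phi> (y, z) \<in> arrows Q (tp Y y) (tp Z z)"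
  using assms dist_lres_arrows[OF assms] by (simp add: dist_lres_def)

lemma le_dist_lres_iff:
  assumes "qcategory Q X" "qcategory Q Y" "qcategory Q Z" "\<phi> \<in> dist Q X Y" "\<xi> \<in> dist Q X Z"
    and "y \<in> pts Y" "z \<in> pts Z" "v \<in> arrows Q (tp Y y) (tp Z z)"
  shows "v \<sqsubseteq>\<^bsub>Hom Q (tp Y y) (tp Z z)\<^esub> dist_lres Q X Y Z \<xi> \<phi> (y, z) \<longleftrightarrow>
    (\<forall>x\<in>pts X. Cmp Q (tp X x) (tp Y y) (tp Z z) v (\<phi> (x, y)) \<sqsubseteq>\<^bsub>Hom Q (tp X x) (tp Z z)\<^esub> \<xi> (x, z))"
  using assms dist_lres_arrows[OF assms(1-7)] by (simp add: dist_lres_def le_Inf_iff le_lres_iff)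

lemma dist_lres_cmp_le:
  assumes "qcategory Q X" "qcategory Q Y" "qcategory Q Z" "\<phi> \<in> dist Q X Y" "\<xi> \<in> dist Q X Z"
    and "y \<in> pts Y" "z \<in> pts Z" "x \<in> pts X"
  shows "Cmp Q (tp X x) (tp Y y) (tp Z z) (dist_lres Q X Y Z \<xi> \<phi> (y, z)) (\<phi> (x, y))
    \<sqsubseteq>\<^bsub>Hom Q (tp X x) (tp Z z)\<^esub> \<xi> (x, z)"
  using le_dist_lres_iff[OF assms(1-7) dist_lres_arrow[OF assms(1-7)]]
    hom_refl[OF _ _ dist_lres_arrow[OF assms(1-7)]] assms by simp

text \<open>By \<open>le_dist_lres_iff\<close> both action laws are tested after composing with
  \<phi>. An action of Z passes on to \<xi>, while an action of Y is absorbed by the left action of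
  Y on \<phi>.\<close>

lemma dist_lres_dist [simp]:
  assumes cats: "qcategory Q X" "qcategory Q Y" "qcategory Q Z"
    and \<phi>: "\<phi> \<in> dist Q X Y" and \<xi>: "\<xi> \<in> dist Q X Z"
  shows "dist_lres Q X Y Z \<xi> \<phi> \<in> dist Q Y Z"
proof (rule distI)
  show "dist_lres Q X Y Z \<xi> \<phi> \<in> extensional (pts Y \<times> pts Z)"
    by (simp add: dist_lres_def)
next
  fix y z z' assume p: "y \<in> pts Y" "z \<in> pts Z" "z' \<in> pts Z"
  have "Cmp Q (tp X x) (tp Y y) (tp Z z')
        (Cmp Q (tp Y y) (tp Z z) (tp Z z') (hm Z (z, z')) (dist_lres Q X Y Z \<xi> \<phi> (y, z))) (\<phi> (x, y))
      \<sqsubseteq>\<^bsub>Hom Q (tp X x) (tp Z z')\<^esub> \<xi> (x, z')" if x: "x \<in> pts X" for x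
  proof -
    have "Cmp Q (tp X x) (tp Z z) (tp Z z') (hm Z (z, z'))
        (Cmp Q (tp X x) (tp Y y) (tp Z z) (dist_lres Q X Y Z \<xi> \<phi> (y, z)) (\<phi> (x, y)))
      \<sqsubseteq>\<^bsub>Hom Q (tp X x) (tp Z z')\<^esub> \<xi> (x, z')"
      by (rule cmp_le_trans_right[where u' = "\<xi> (x, z)"])
        (use dist_lres_cmp_le[OF assms p(1,2) x] dist_left[OF cats(1,3) \<xi> x p(2,3)] assms p x
          in \<open>simp_all add: cmp_arrow\<close>)
    then show ?thesis
      using assms p x by (simp add: cmp_assoc)
  qed
  then show "Cmp Q (tp Y y) (tp Z z) (tp Z z') (hm Z (z, z')) (dist_lres Q X Y Z \<xi> \<phi> (y, z))
      \<sqsubseteq>\<^bsub>Hom Q (tp Y y) (tp Z z')\<^esub> dist_lres Q X Y Z \<xi> \<phi> (y, z')"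
    using assms p by (simp add: le_dist_lres_iff cmp_arrow)
next
  fix y y' z assume p: "y \<in> pts Y" "y' \<in> pts Y" "z \<in> pts Z"
  have "Cmp Q (tp X x) (tp Y y') (tp Z z)
        (Cmp Q (tp Y y') (tp Y y) (tp Z z) (dist_lres Q X Y Z \<xi> \<phi> (y, z)) (hm Y (y', y))) (\<phi> (x, y'))
      \<sqsubseteq>\<^bsub>Hom Q (tp X x) (tp Z z)\<^esub> \<xi> (x, z)" if x: "x \<in> pts X" for x
  proof -
    have "Cmp Q (tp X x) (tp Y y) (tp Z z) (dist_lres Q X Y Z \<xi> \<phi> (y, z))
        (Cmp Q (tp X x) (tp Y y') (tp Y y) (hm Y (y', y)) (\<phi> (x, y')))
      \<sqsubseteq>\<^bsub>Hom Q (tp X x) (tp Z z)\<^esub> \<xi> (x, z)"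
      by (rule cmp_le_trans_right[where u' = "\<phi> (x, y)"])
        (use dist_lres_cmp_le[OF assms p(1,3) x] dist_left[OF cats(1,2) \<phi> x p(2,1)] assms p x
          in \<open>simp_all add: cmp_arrow\<close>)
    then show ?thesis
      using assms p x by (simp add: cmp_assoc)
  qed
  then show "Cmp Q (tp Y y') (tp Y y) (tp Z z) (dist_lres Q X Y Z \<xi> \<phi> (y, z)) (hm Y (y', y))
      \<sqsubseteq>\<^bsub>Hom Q (tp Y y') (tp Z z)\<^esub> dist_lres Q X Y Z \<xi> \<phi> (y', z)"
    using assms p by (simp add: le_dist_lres_iff cmp_arrow)
qed (use assms in simp_all)

section \<open>Presheaves\<close>

lemma one_cat_simps [simp]:
  "pts (one_cat Q q) = {()}" "tp (one_cat Q q) x = q" "hm (one_cat Q q) xy = Idn Q q"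
  by (simp_all add: one_cat_def)

lemma qcategory_one_cat [simp]: "q \<in> Obj Q \<Longrightarrow> qcategory Q (one_cat Q q)"
  by (auto simp: qcategory_def idn_arrow cmp_idn_left hom_refl PiE_iff extensional_def)

text \<open>The \<mu>(x) of the usual notation: the type is dropped and the point of
  \<open>one_cat\<close> is filled in.\<close>

definition pval :: "('v, 'o, 'a) presheaf \<Rightarrow> 'v \<Rightarrow> 'a" where
  "pval \<mu> x = snd \<mu> (x, ())"

lemma psh_ptsD [simp]:
  assumes "\<mu> \<in> psh_pts Q X"
  shows "fst \<mu> \<in> Obj Q" "snd \<mu> \<in> dist Q X (one_cat Q (fst \<mu>))"
  using assms by (auto simp: psh_pts_def)

lemma psh_pts_pair_iff: "(q, m) \<in> psh_pts Q X \<longleftrightarrow> q \<in> Obj Q \<and> m \<in> dist Q X (one_cat Q q)"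
  by (simp add: psh_pts_def)

lemma pval_arrow [simp]:
  "\<mu> \<in> psh_pts Q X \<Longrightarrow> x \<in> pts X \<Longrightarrow> pval \<mu> x \<in> arrows Q (tp X x) (fst \<mu>)"
  using dist_arrow[of "snd \<mu>" X "one_cat Q (fst \<mu>)" x "()"] by (simp add: pval_def)

lemma psh_eqI:
  assumes "\<mu> \<in> psh_pts Q X" "\<nu> \<in> psh_pts Q X" "fst \<mu> = fst \<nu>"
    and "\<And>x. x \<in> pts X \<Longrightarrow> pval \<mu> x = pval \<nu> x"
  shows "\<mu> = \<nu>"
proof (rule prod_eqI[OF assms(3)])
  show "snd \<mu> = snd \<nu>"
    by (rule dist_eqI[where X = X and Y = "one_cat Q (fst \<mu>)"])
      (use psh_ptsD(2)[OF assms(1)] psh_ptsD(2)[OF assms(2)] assms(3,4) in \<open>auto simp: pval_def\<close>)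
qed

lemma pval_right:
  assumes "qcategory Q X" "\<mu> \<in> psh_pts Q X" "x \<in> pts X" "x' \<in> pts X"
  shows "Cmp Q (tp X x') (tp X x) (fst \<mu>) (pval \<mu> x) (hm X (x', x))
    \<sqsubseteq>\<^bsub>Hom Q (tp X x') (fst \<mu>)\<^esub> pval \<mu> x'"
  using dist_right[of X "one_cat Q (fst \<mu>)" "snd \<mu>" x x' "()"] assms by (simp add: pval_def)

lemma psh_simps [simp]:
  "pts (psh Q X) = psh_pts Q X"
  "\<mu> \<in> psh_pts Q X \<Longrightarrow> tp (psh Q X) \<mu> = fst \<mu>"
  by (simp_all add: psh_def)

lemma psh_hm:
  assumes "\<mu> \<in> psh_pts Q X" "\<nu> \<in> psh_pts Q X"
  shows "hm (psh Q X) (\<mu>, \<nu>) =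
    dist_lres Q X (one_cat Q (fst \<mu>)) (one_cat Q (fst \<nu>)) (snd \<nu>) (snd \<mu>) ((), ())"
  using assms by (cases \<mu>; cases \<nu>) (simp add: psh_def)

lemma psh_hm_arrow [simp]:
  assumes "qcategory Q X" "\<mu> \<in> psh_pts Q X" "\<nu> \<in> psh_pts Q X"
  shows "hm (psh Q X) (\<mu>, \<nu>) \<in> arrows Q (fst \<mu>) (fst \<nu>)"
  using dist_lres_arrow[of X "one_cat Q (fst \<mu>)" "one_cat Q (fst \<nu>)" "snd \<mu>" "snd \<nu>" "()" "()"] assms
  by (simp add: psh_hm)

text \<open>Serves from here on in place of the definition of the hom-arrows of presheaves: the
  residual is the largest arrow v with v \<circ> \<mu> \<le> \<nu>.\<close>

lemma le_psh_hm_iff: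
  assumes "qcategory Q X" "\<mu> \<in> psh_pts Q X" "\<nu> \<in> psh_pts Q X" "v \<in> arrows Q (fst \<mu>) (fst \<nu>)"
  shows "v \<sqsubseteq>\<^bsub>Hom Q (fst \<mu>) (fst \<nu>)\<^esub> hm (psh Q X) (\<mu>, \<nu>) \<longleftrightarrow>
    (\<forall>x\<in>pts X. Cmp Q (tp X x) (fst \<mu>) (fst \<nu>) v (pval \<mu> x) \<sqsubseteq>\<^bsub>Hom Q (tp X x) (fst \<nu>)\<^esub> pval \<nu> x)"
  using le_dist_lres_iff[of X "one_cat Q (fst \<mu>)" "one_cat Q (fst \<nu>)" "snd \<mu>" "snd \<nu>" "()" "()" v] assms
  by (simp add: psh_hm pval_def)

lemma psh_hm_cmp_le:
  assumes "qcategory Q X" "\<mu> \<in> psh_pts Q X" "\<nu> \<in> psh_pts Q X" "x \<in> pts X"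
  shows "Cmp Q (tp X x) (fst \<mu>) (fst \<nu>) (hm (psh Q X) (\<mu>, \<nu>)) (pval \<mu> x)
    \<sqsubseteq>\<^bsub>Hom Q (tp X x) (fst \<nu>)\<^esub> pval \<nu> x"
  using le_psh_hm_iff[OF assms(1-3) psh_hm_arrow[OF assms(1-3)]]
    hom_refl[OF _ _ psh_hm_arrow[OF assms(1-3)]] assms by simp

lemma qle_psh_iff:
  assumes "qcategory Q X" "\<mu> \<in> psh_pts Q X" "\<nu> \<in> psh_pts Q X"
  shows "qle Q (psh Q X) \<mu> \<nu> \<longleftrightarrow> fst \<mu> = fst \<nu> \<and>
    (\<forall>x\<in>pts X. pval \<mu> x \<sqsubseteq>\<^bsub>Hom Q (tp X x) (fst \<nu>)\<^esub> pval \<nu> x)"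
proof (cases "fst \<mu> = fst \<nu>")
  case True
  have "pval \<mu> x \<in> arrows Q (tp X x) (fst \<nu>)" if "x \<in> pts X" for x
    using pval_arrow[OF assms(2) that] True by simp
  then show ?thesis
    using le_psh_hm_iff[OF assms, of "Idn Q (fst \<mu>)"] assms True
    by (simp add: qle_def idn_arrow cmp_idn_left)
qed (use assms in \<open>simp add: qle_def\<close>)

lemma qcategory_psh [simp]:
  assumes X: "qcategory Q X"
  shows "qcategory Q (psh Q X)"
  unfolding qcategory_def
proof (intro conjI ballI)
  show "tp (psh Q X) \<in> pts (psh Q X) \<rightarrow>\<^sub>E Obj Q"
    by (auto simp: psh_def PiE_iff)
  have "hm (psh Q X) \<in> extensional (psh_pts Q X \<times> psh_pts Q X)"
    by (simp add: psh_def)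
  then show "hm (psh Q X) \<in> (\<Pi>\<^sub>E (x, y)\<in>pts (psh Q X) \<times> pts (psh Q X).
      arrows Q (tp (psh Q X) x) (tp (psh Q X) y))"
    using psh_hm_arrow[OF X] unfolding PiE_iff by fastforce
next
  fix \<mu> assume "\<mu> \<in> pts (psh Q X)"
  then show "Idn Q (tp (psh Q X) \<mu>) \<sqsubseteq>\<^bsub>Hom Q (tp (psh Q X) \<mu>) (tp (psh Q X) \<mu>)\<^esub> hm (psh Q X) (\<mu>, \<mu>)"
    using X by (simp add: le_psh_hm_iff idn_arrow cmp_idn_left hom_refl)
next
  fix \<mu> \<nu> \<rho> assume "\<mu> \<in> pts (psh Q X)" "\<nu> \<in> pts (psh Q X)" "\<rho> \<in> pts (psh Q X)"
  then have p: "\<mu> \<in> psh_pts Q X" "\<nu> \<in> psh_pts Q X" "\<rho> \<in> psh_pts Q X"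
    by simp_all
  let ?H = "hm (psh Q X)"
  have "Cmp Q (tp X x) (fst \<mu>) (fst \<rho>) (Cmp Q (fst \<mu>) (fst \<nu>) (fst \<rho>) (?H (\<nu>, \<rho>)) (?H (\<mu>, \<nu>))) (pval \<mu> x)
      \<sqsubseteq>\<^bsub>Hom Q (tp X x) (fst \<rho>)\<^esub> pval \<rho> x" if x: "x \<in> pts X" for x
  proof -
    have "Cmp Q (tp X x) (fst \<nu>) (fst \<rho>) (?H (\<nu>, \<rho>)) (Cmp Q (tp X x) (fst \<mu>) (fst \<nu>) (?H (\<mu>, \<nu>)) (pval \<mu> x))
      \<sqsubseteq>\<^bsub>Hom Q (tp X x) (fst \<rho>)\<^esub> pval \<rho> x"
      by (rule cmp_le_trans_right[where u' = "pval \<nu> x"])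
        (use X p x in \<open>simp_all add: cmp_arrow psh_hm_cmp_le\<close>)
    then show ?thesis
      using X p x by (simp add: cmp_assoc)
  qed
  then show "Cmp Q (tp (psh Q X) \<mu>) (tp (psh Q X) \<nu>) (tp (psh Q X) \<rho>) (?H (\<nu>, \<rho>)) (?H (\<mu>, \<nu>))
      \<sqsubseteq>\<^bsub>Hom Q (tp (psh Q X) \<mu>) (tp (psh Q X) \<rho>)\<^esub> ?H (\<mu>, \<rho>)"
    using X p by (simp add: le_psh_hm_iff cmp_arrow)
qed

text \<open>The underlying preorder of a Q-category need not be antisymmetric. That of presheaves
  is, being the pointwise order of the hom-lattices of Q on presheaves of one type.\<close>

lemma qle_psh_antisym:
  assumes "qcategory Q X" "\<mu> \<in> psh_pts Q X" "\<nu> \<in> psh_pts Q X"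
    and "qle Q (psh Q X) \<mu> \<nu>" "qle Q (psh Q X) \<nu> \<mu>"
  shows "\<mu> = \<nu>"
proof (rule psh_eqI[OF assms(2,3)])
  show eq: "fst \<mu> = fst \<nu>"
    using assms(4) qle_psh_iff[OF assms(1,2,3)] by simp
  fix x assume x: "x \<in> pts X"
  have m: "pval \<mu> x \<in> arrows Q (tp X x) (fst \<nu>)"
    using pval_arrow[OF assms(2) x] eq by simp
  have "pval \<mu> x \<sqsubseteq>\<^bsub>Hom Q (tp X x) (fst \<nu>)\<^esub> pval \<nu> x" "pval \<nu> x \<sqsubseteq>\<^bsub>Hom Q (tp X x) (fst \<nu>)\<^esub> pval \<mu> x"
    using assms(4,5) x eq qle_psh_iff[OF assms(1,2,3)] qle_psh_iff[OF assms(1,3,2)] by simp_all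
  then show "pval \<mu> x = pval \<nu> x"
    by (rule hom_antisym[OF _ _ m, rotated -2]) (use assms x in simp_all)
qed

lemma qfunctor_hm:
  "qfunctor Q X Y f \<Longrightarrow> x \<in> pts X \<Longrightarrow> x' \<in> pts X \<Longrightarrow>
    hm X (x, x') \<sqsubseteq>\<^bsub>Hom Q (tp X x) (tp X x')\<^esub> hm Y (f x, f x')"
  by (simp add: qfunctor_def)

lemma qfunctor_qle:
  assumes X: "qcategory Q X" and Y: "qcategory Q Y" and f: "qfunctor Q X Y f"
    and p: "x \<in> pts X" "x' \<in> pts X" and le: "qle Q X x x'"
  shows "qle Q Y (f x) (f x')"
proof -
  have q: "f x \<in> pts Y" "f x' \<in> pts Y" "tp Y (f x) = tp X x" "tp Y (f x') = tp X x'"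
    "hm X (x, x') \<sqsubseteq>\<^bsub>Hom Q (tp X x) (tp X x')\<^esub> hm Y (f x, f x')"
    using f p by (auto simp: qfunctor_def)
  have eq: "tp X x' = tp X x" and Idn: "Idn Q (tp X x) \<sqsubseteq>\<^bsub>Hom Q (tp X x) (tp X x)\<^esub> hm X (x, x')"
    using le unfolding qle_def by (metis, blast)
  note q' = q[unfolded eq]
  have h: "hm X (x, x') \<in> arrows Q (tp X x) (tp X x)" "hm Y (f x, f x') \<in> arrows Q (tp X x) (tp X x)"
    using qcat_hm[OF X p] qcat_hm[OF Y q(1,2)] q' eq by simp_all
  have "Idn Q (tp X x) \<sqsubseteq>\<^bsub>Hom Q (tp X x) (tp X x)\<^esub> hm Y (f x, f x')"
    by (rule hom_trans[OF _ _ _ h Idn q'(5)]) (use X p in \<open>simp_all add: idn_arrow\<close>)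
  then show ?thesis
    using q' by (simp add: qle_def)
qed

text \<open>The presheaf \<phi>(-, y). For \<phi> = \<open>hm Y\<close> it is the representable
  presheaf at y.\<close>

definition column :: "('v, 'o, 'a) qcat \<Rightarrow> ('w, 'o, 'a) qcat \<Rightarrow> ('v \<times> 'w \<Rightarrow> 'a) \<Rightarrow> 'w \<Rightarrow> ('v, 'o, 'a) presheaf" where
  "column X Y \<phi> y = (tp Y y, \<lambda>(x, _)\<in>pts X \<times> {()}. \<phi> (x, y))"

lemma fst_column [simp]: "fst (column X Y \<phi> y) = tp Y y"
  by (simp add: column_def)

lemma pval_column [simp]: "x \<in> pts X \<Longrightarrow> pval (column X Y \<phi> y) x = \<phi> (x, y)"
  by (simp add: column_def pval_def)

lemma column_psh [simp]:
  assumes "qcategory Q X" "qcategory Q Y" "\<phi> \<in> dist Q X Y" "y \<in> pts Y"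
  shows "column X Y \<phi> y \<in> psh_pts Q X"
  unfolding column_def psh_pts_pair_iff
proof
  show "(\<lambda>(x, _)\<in>pts X \<times> {()}. \<phi> (x, y)) \<in> dist Q X (one_cat Q (tp Y y))"
    by (rule distI) (use assms in \<open>simp_all add: cmp_idn_left hom_refl dist_right\<close>)
qed (use assms in simp)

section \<open>Kan adjunctions\<close>

lemma kan_pull_simps [simp]:
  assumes "\<nu> \<in> psh_pts Q Y"
  shows "fst (kan_pull Q X Y \<phi> \<nu>) = fst \<nu>"
    and "snd (kan_pull Q X Y \<phi> \<nu>) = dist_comp Q X Y (one_cat Q (fst \<nu>)) (snd \<nu>) \<phi>"
  using assms by (cases \<nu>; simp add: kan_pull_def)+

lemma kan_push_simps [simp]:
  assumes "\<mu> \<in> psh_pts Q X"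
  shows "fst (kan_push Q X Y \<phi> \<mu>) = fst \<mu>"
    and "snd (kan_push Q X Y \<phi> \<mu>) = dist_lres Q X Y (one_cat Q (fst \<mu>)) (snd \<mu>) \<phi>"
  using assms by (cases \<mu>; simp add: kan_push_def)+

lemma psh_pts_iff: "\<mu> \<in> psh_pts Q X \<longleftrightarrow> fst \<mu> \<in> Obj Q \<and> snd \<mu> \<in> dist Q X (one_cat Q (fst \<mu>))"
  by (cases \<mu>) (simp add: psh_pts_pair_iff)

lemma kan_pull_psh [simp]:
  assumes "qcategory Q X" "qcategory Q Y" "\<phi> \<in> dist Q X Y" "\<nu> \<in> psh_pts Q Y"
  shows "kan_pull Q X Y \<phi> \<nu> \<in> psh_pts Q X"
  unfolding psh_pts_iff[of "kan_pull Q X Y \<phi> \<nu>"] using assms by simp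

lemma kan_push_psh [simp]:
  assumes "qcategory Q X" "qcategory Q Y" "\<phi> \<in> dist Q X Y" "\<mu> \<in> psh_pts Q X"
  shows "kan_push Q X Y \<phi> \<mu> \<in> psh_pts Q Y"
  unfolding psh_pts_iff[of "kan_push Q X Y \<phi> \<mu>"] using assms by simp

lemma kan_pull_le_iff:
  assumes "qcategory Q X" "qcategory Q Y" "\<phi> \<in> dist Q X Y" "\<nu> \<in> psh_pts Q Y"
    and "x \<in> pts X" "b \<in> arrows Q (tp X x) (fst \<nu>)"
  shows "pval (kan_pull Q X Y \<phi> \<nu>) x \<sqsubseteq>\<^bsub>Hom Q (tp X x) (fst \<nu>)\<^esub> b \<longleftrightarrow>
    (\<forall>y\<in>pts Y. Cmp Q (tp X x) (tp Y y) (fst \<nu>) (pval \<nu> y) (\<phi> (x, y)) \<sqsubseteq>\<^bsub>Hom Q (tp X x) (fst \<nu>)\<^esub> b)"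
  using dist_comp_le_iff[of X Y "one_cat Q (fst \<nu>)" \<phi> "snd \<nu>" x "()" b] assms
  by (simp add: pval_def)

lemma kan_pull_upper:
  assumes "qcategory Q X" "qcategory Q Y" "\<phi> \<in> dist Q X Y" "\<nu> \<in> psh_pts Q Y"
    and "x \<in> pts X" "y \<in> pts Y"
  shows "Cmp Q (tp X x) (tp Y y) (fst \<nu>) (pval \<nu> y) (\<phi> (x, y))
    \<sqsubseteq>\<^bsub>Hom Q (tp X x) (fst \<nu>)\<^esub> pval (kan_pull Q X Y \<phi> \<nu>) x"
  using dist_comp_upper[of X Y "one_cat Q (fst \<nu>)" \<phi> "snd \<nu>" x "()" y] assms
  by (simp add: pval_def)

lemma le_kan_push_iff:
  assumes "qcategory Q X" "qcategory Q Y" "\<phi> \<in> dist Q X Y" "\<mu> \<in> psh_pts Q X"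
    and "y \<in> pts Y" "v \<in> arrows Q (tp Y y) (fst \<mu>)"
  shows "v \<sqsubseteq>\<^bsub>Hom Q (tp Y y) (fst \<mu>)\<^esub> pval (kan_push Q X Y \<phi> \<mu>) y \<longleftrightarrow>
    (\<forall>x\<in>pts X. Cmp Q (tp X x) (tp Y y) (fst \<mu>) v (\<phi> (x, y)) \<sqsubseteq>\<^bsub>Hom Q (tp X x) (fst \<mu>)\<^esub> pval \<mu> x)"
  using le_dist_lres_iff[of X Y "one_cat Q (fst \<mu>)" \<phi> "snd \<mu>" y "()" v] assms
  by (simp add: pval_def)

lemma kan_push_cmp_le:
  assumes "qcategory Q X" "qcategory Q Y" "\<phi> \<in> dist Q X Y" "\<mu> \<in> psh_pts Q X"
    and "x \<in> pts X" "y \<in> pts Y"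
  shows "Cmp Q (tp X x) (tp Y y) (fst \<mu>) (pval (kan_push Q X Y \<phi> \<mu>) y) (\<phi> (x, y))
    \<sqsubseteq>\<^bsub>Hom Q (tp X x) (fst \<mu>)\<^esub> pval \<mu> x"
  using dist_lres_cmp_le[of X Y "one_cat Q (fst \<mu>)" \<phi> "snd \<mu>" y "()" x] assms
  by (simp add: pval_def)

lemma kan_pull_comp:
  assumes "qcategory Q X" "qcategory Q Y" "qcategory Q Z" "\<phi> \<in> dist Q X Y" "\<psi> \<in> dist Q Y Z"
    and "\<nu> \<in> psh_pts Q Z"
  shows "kan_pull Q X Z (dist_comp Q X Y Z \<psi> \<phi>) \<nu> = kan_pull Q X Y \<phi> (kan_pull Q Y Z \<psi> \<nu>)"
  using assms by (intro prod_eqI) (simp_all add: dist_comp_assoc)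

lemma kan_pull_hm:
  assumes "qcategory Q X" "\<mu> \<in> psh_pts Q X"
  shows "kan_pull Q X X (hm X) \<mu> = \<mu>"
  using assms by (intro prod_eqI) simp_all

lemma snd_kan_pull_Sup:
  assumes "qcategory Q X" "qcategory Q Y" "A \<subseteq> dist Q X Y" "\<nu> \<in> psh_pts Q Y"
  shows "snd (kan_pull Q X Y (dist_Sup X Y A) \<nu>) =
    dist_Sup X (one_cat Q (fst \<nu>)) ((\<lambda>\<phi>. snd (kan_pull Q X Y \<phi> \<nu>)) ` A)"
  using assms by (simp add: dist_comp_Sup_right)

text \<open>The unit law for composition with \<open>hm Y\<close>, read at the point y. It exhibits
  \<phi>(-, y) as the pullback of a representable presheaf, which makes it open for
  \<open>\<phi>\<^sup>* \<phi>\<^sub>*\<close>.\<close>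

lemma kan_pull_column_hm:
  assumes "qcategory Q X" "qcategory Q Y" "\<phi> \<in> dist Q X Y" "y \<in> pts Y"
  shows "kan_pull Q X Y \<phi> (column Y Y (hm Y) y) = column X Y \<phi> y"
proof (rule psh_eqI)
  fix x assume x: "x \<in> pts X"
  let ?c = "column Y Y (hm Y) y"
  have "dist_comp Q X Y (one_cat Q (tp Y y)) (snd ?c) \<phi> (x, ()) = dist_comp Q X Y Y (hm Y) \<phi> (x, y)"
    using x assms(4) by (simp add: dist_comp_def column_def cong: image_cong_simp)
  then show "pval (kan_pull Q X Y \<phi> ?c) x = pval (column X Y \<phi> y) x"
    using assms x by (simp add: pval_def[of "kan_pull Q X Y \<phi> ?c"])
qed (use assms in simp_all)

text \<open>Write h for the hom-arrow from \<nu> to \<nu>'. On each joinand, associativity brings h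
  next to \<nu>(y), and h \<circ> \<nu>(y) \<le> \<nu>'(y).\<close>

lemma qfunctor_kan_pull:
  assumes X: "qcategory Q X" and Y: "qcategory Q Y" and \<phi>: "\<phi> \<in> dist Q X Y"
  shows "qfunctor Q (psh Q Y) (psh Q X) (kan_pull Q X Y \<phi>)"
  unfolding qfunctor_def
proof (intro conjI ballI)
  show "kan_pull Q X Y \<phi> \<in> pts (psh Q Y) \<rightarrow>\<^sub>E pts (psh Q X)"
    using assms by (auto simp: PiE_iff) (simp add: kan_pull_def)
next
  fix \<nu> assume "\<nu> \<in> pts (psh Q Y)"
  then show "tp (psh Q X) (kan_pull Q X Y \<phi> \<nu>) = tp (psh Q Y) \<nu>"
    using assms by simp
next
  fix \<nu> \<nu>' assume "\<nu> \<in> pts (psh Q Y)" "\<nu>' \<in> pts (psh Q Y)"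
  then have p: "\<nu> \<in> psh_pts Q Y" "\<nu>' \<in> psh_pts Q Y"
    by simp_all
  let ?h = "hm (psh Q Y) (\<nu>, \<nu>')"
  let ?k = "kan_pull Q X Y \<phi>"
  have h: "?h \<in> arrows Q (fst \<nu>) (fst \<nu>')"
    using Y p by simp
  have "Cmp Q (tp X x) (fst \<nu>) (fst \<nu>') ?h (pval (?k \<nu>) x) \<sqsubseteq>\<^bsub>Hom Q (tp X x) (fst \<nu>')\<^esub> pval (?k \<nu>') x"
    if x: "x \<in> pts X" for x
  proof -
    have k: "pval (?k \<nu>') x \<in> arrows Q (tp X x) (fst \<nu>')"
      using pval_arrow[OF kan_pull_psh[OF assms p(2)] x] p by simp
    have "Cmp Q (tp X x) (fst \<nu>) (fst \<nu>') ?h (Cmp Q (tp X x) (tp Y y) (fst \<nu>) (pval \<nu> y) (\<phi> (x, y)))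
        \<sqsubseteq>\<^bsub>Hom Q (tp X x) (fst \<nu>')\<^esub> pval (?k \<nu>') x" if y: "y \<in> pts Y" for y
    proof -
      have "Cmp Q (tp X x) (tp Y y) (fst \<nu>') (Cmp Q (tp Y y) (fst \<nu>) (fst \<nu>') ?h (pval \<nu> y)) (\<phi> (x, y))
        \<sqsubseteq>\<^bsub>Hom Q (tp X x) (fst \<nu>')\<^esub> pval (?k \<nu>') x"
        by (rule cmp_le_trans_left[where v' = "pval \<nu>' y"])
          (use assms p x y h k in \<open>simp_all add: cmp_arrow psh_hm_cmp_le kan_pull_upper\<close>)
      then show ?thesis
        using assms p x y h by (simp add: cmp_assoc)
    qed
    moreover have "pval (?k \<nu>) x = dist_comp Q X Y (one_cat Q (fst \<nu>)) (snd \<nu>) \<phi> (x, ())"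
      using p by (simp add: pval_def)
    ultimately show ?thesis
      using cmp_dist_comp_right_le_iff[of X Y "one_cat Q (fst \<nu>)" \<phi> "snd \<nu>" x "()" "fst \<nu>'" ?h "pval (?k \<nu>') x"]
        assms p x h k by (simp add: pval_def)
  qed
  then show "?h \<sqsubseteq>\<^bsub>Hom Q (tp (psh Q Y) \<nu>) (tp (psh Q Y) \<nu>')\<^esub> hm (psh Q X) (?k \<nu>, ?k \<nu>')"
    using assms p h le_psh_hm_iff[OF X kan_pull_psh[OF assms p(1)] kan_pull_psh[OF assms p(2)], of ?h]
    by simp
qed

text \<open>Write h for the hom-arrow from \<mu> to \<mu>' and s for
  \<open>\<phi>\<^sub>* \<mu>\<close>. After composing with \<phi>(x, y), the claim follows from h
  \<circ> s(y) \<circ> \<phi>(x, y) \<le> h \<circ> \<mu>(x) \<le> \<mu>'(x).\<close>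

lemma qfunctor_kan_push:
  assumes X: "qcategory Q X" and Y: "qcategory Q Y" and \<phi>: "\<phi> \<in> dist Q X Y"
  shows "qfunctor Q (psh Q X) (psh Q Y) (kan_push Q X Y \<phi>)"
  unfolding qfunctor_def
proof (intro conjI ballI)
  show "kan_push Q X Y \<phi> \<in> pts (psh Q X) \<rightarrow>\<^sub>E pts (psh Q Y)"
    using assms by (auto simp: PiE_iff) (simp add: kan_push_def)
next
  fix \<mu> assume "\<mu> \<in> pts (psh Q X)"
  then show "tp (psh Q Y) (kan_push Q X Y \<phi> \<mu>) = tp (psh Q X) \<mu>"
    using assms by simp
next
  fix \<mu> \<mu>' assume "\<mu> \<in> pts (psh Q X)" "\<mu>' \<in> pts (psh Q X)"
  then have p: "\<mu> \<in> psh_pts Q X" "\<mu>' \<in> psh_pts Q X"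
    by simp_all
  let ?h = "hm (psh Q X) (\<mu>, \<mu>')"
  let ?k = "kan_push Q X Y \<phi>"
  have h: "?h \<in> arrows Q (fst \<mu>) (fst \<mu>')"
    using X p by simp
  have "Cmp Q (tp Y y) (fst \<mu>) (fst \<mu>') ?h (pval (?k \<mu>) y) \<sqsubseteq>\<^bsub>Hom Q (tp Y y) (fst \<mu>')\<^esub> pval (?k \<mu>') y"
    if y: "y \<in> pts Y" for y
  proof -
    have k: "pval (?k \<mu>) y \<in> arrows Q (tp Y y) (fst \<mu>)"
      using pval_arrow[OF kan_push_psh[OF assms p(1)] y] p by simp
    have "Cmp Q (tp X x) (tp Y y) (fst \<mu>') (Cmp Q (tp Y y) (fst \<mu>) (fst \<mu>') ?h (pval (?k \<mu>) y)) (\<phi> (x, y))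
        \<sqsubseteq>\<^bsub>Hom Q (tp X x) (fst \<mu>')\<^esub> pval \<mu>' x" if x: "x \<in> pts X" for x
    proof -
      have "Cmp Q (tp X x) (fst \<mu>) (fst \<mu>') ?h (Cmp Q (tp X x) (tp Y y) (fst \<mu>) (pval (?k \<mu>) y) (\<phi> (x, y)))
        \<sqsubseteq>\<^bsub>Hom Q (tp X x) (fst \<mu>')\<^esub> pval \<mu>' x"
        by (rule cmp_le_trans_right[where u' = "pval \<mu> x"])
          (use assms p x y h k in \<open>simp_all add: cmp_arrow psh_hm_cmp_le kan_push_cmp_le\<close>)
      then show ?thesis
        using assms p x y h k by (simp add: cmp_assoc)
    qed
    then show ?thesis
      using assms p y h k by (simp add: le_kan_push_iff cmp_arrow)
  qed
  then show "?h \<sqsubseteq>\<^bsub>Hom Q (tp (psh Q X) \<mu>) (tp (psh Q X) \<mu>')\<^esub> hm (psh Q Y) (?k \<mu>, ?k \<mu>')"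
    using assms p h le_psh_hm_iff[OF Y kan_push_psh[OF assms p(1)] kan_push_psh[OF assms p(2)], of ?h]
    by simp
qed

lemma kan_unit:
  assumes "qcategory Q X" "qcategory Q Y" "\<phi> \<in> dist Q X Y" "\<nu> \<in> psh_pts Q Y"
  shows "qle Q (psh Q Y) \<nu> (kan_push Q X Y \<phi> (kan_pull Q X Y \<phi> \<nu>))"
proof -
  let ?k = "kan_pull Q X Y \<phi> \<nu>"
  have k: "?k \<in> psh_pts Q X"
    using assms by simp
  have "pval \<nu> y \<sqsubseteq>\<^bsub>Hom Q (tp Y y) (fst ?k)\<^esub> pval (kan_push Q X Y \<phi> ?k) y" if y: "y \<in> pts Y" for y
    using le_kan_push_iff[OF assms(1-3) k y, of "pval \<nu> y"] assms y by (simp add: kan_pull_upper)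
  then show ?thesis
    using assms k by (simp add: qle_psh_iff)
qed

lemma kan_counit:
  assumes "qcategory Q X" "qcategory Q Y" "\<phi> \<in> dist Q X Y" "\<mu> \<in> psh_pts Q X"
  shows "qle Q (psh Q X) (kan_pull Q X Y \<phi> (kan_push Q X Y \<phi> \<mu>)) \<mu>"
proof -
  let ?k = "kan_push Q X Y \<phi> \<mu>"
  have k: "?k \<in> psh_pts Q Y"
    using assms by simp
  have "pval (kan_pull Q X Y \<phi> ?k) x \<sqsubseteq>\<^bsub>Hom Q (tp X x) (fst ?k)\<^esub> pval \<mu> x" if x: "x \<in> pts X" for x
    using kan_pull_le_iff[OF assms(1-3) k x, of "pval \<mu> x"] assms x by (simp add: kan_push_cmp_le)
  then show ?thesis
    using assms k by (simp add: qle_psh_iff)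
qed

text \<open>A triangle identity of the adjunction: \<open>\<phi>\<^sup>*\<close> applied to the unit
  gives one inequality, the counit at \<open>\<phi>\<^sup>* \<nu>\<close> the other. Antisymmetry of
  presheaves makes it an equation.\<close>

lemma kan_pull_push_pull:
  assumes "qcategory Q X" "qcategory Q Y" "\<phi> \<in> dist Q X Y" "\<nu> \<in> psh_pts Q Y"
  shows "kan_pull Q X Y \<phi> (kan_push Q X Y \<phi> (kan_pull Q X Y \<phi> \<nu>)) = kan_pull Q X Y \<phi> \<nu>"
proof (rule qle_psh_antisym)
  show "qle Q (psh Q X) (kan_pull Q X Y \<phi> \<nu>) (kan_pull Q X Y \<phi> (kan_push Q X Y \<phi> (kan_pull Q X Y \<phi> \<nu>)))"
    by (rule qfunctor_qle[OF _ _ qfunctor_kan_pull[OF assms(1-3)] _ _ kan_unit[OF assms]])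
      (use assms in simp_all)
qed (use assms kan_counit[OF assms(1-3) kan_pull_psh[OF assms]] in simp_all)

section \<open>Interior spaces\<close>

lemma interior_space_qcategory [simp]: "interior_space Q X a \<Longrightarrow> qcategory Q X"
  by (simp add: interior_space_def)

lemma interior_psh [simp]:
  "interior_space Q X a \<Longrightarrow> \<mu> \<in> psh_pts Q X \<Longrightarrow> a \<mu> \<in> psh_pts Q X"
  by (auto simp: interior_space_def qfunctor_def)

lemma interior_le: "interior_space Q X a \<Longrightarrow> \<mu> \<in> psh_pts Q X \<Longrightarrow> qle Q (psh Q X) (a \<mu>) \<mu>"
  by (simp add: interior_space_def qfunctor_le_def)

lemma fst_interior [simp]: "interior_space Q X a \<Longrightarrow> \<mu> \<in> psh_pts Q X \<Longrightarrow> fst (a \<mu>) = fst \<mu>"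
  using interior_le[of X a \<mu>] by (simp add: qle_psh_iff)

lemma interior_idem: "interior_space Q X a \<Longrightarrow> \<mu> \<in> psh_pts Q X \<Longrightarrow> a (a \<mu>) = a \<mu>"
  by (simp add: interior_space_def)

lemma interior_mono:
  assumes "interior_space Q X a" "\<mu> \<in> psh_pts Q X" "\<nu> \<in> psh_pts Q X" "qle Q (psh Q X) \<mu> \<nu>"
  shows "qle Q (psh Q X) (a \<mu>) (a \<nu>)"
  by (rule qfunctor_qle[where X = "psh Q X"]) (use assms in \<open>simp_all add: interior_space_def\<close>)

lemma open_pts_iff: "\<mu> \<in> open_pts Q X a \<longleftrightarrow> \<mu> \<in> psh_pts Q X \<and> a \<mu> = \<mu>"
  by (simp add: open_pts_def)

text \<open>The opposite inequality holds for every presheaf, as an interior operator lies below the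
  identity.\<close>

lemma open_ptsI:
  assumes "interior_space Q X a" "\<mu> \<in> psh_pts Q X" "qle Q (psh Q X) \<mu> (a \<mu>)"
  shows "\<mu> \<in> open_pts Q X a"
  using assms interior_le[OF assms(1,2)] qle_psh_antisym[of X "a \<mu>" \<mu>] by (simp add: open_pts_iff)

lemma interior_open [simp]: "interior_space Q X a \<Longrightarrow> \<mu> \<in> psh_pts Q X \<Longrightarrow> a \<mu> \<in> open_pts Q X a"
  by (simp add: open_pts_iff interior_idem)

text \<open>At an open \<nu> the continuity inequality says that
  \<open>\<zeta>\<^sup>* \<nu>\<close> is below its own interior. Conversely \<open>b \<nu>\<close>
  is open, so \<open>\<zeta>\<^sup>* (b \<nu>)\<close> is open; lying below
  \<open>\<zeta>\<^sup>* \<nu>\<close>, it also lies below the interior of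
  \<open>\<zeta>\<^sup>* \<nu>\<close>.\<close>

lemma cont_dist_iff:
  assumes a: "interior_space Q X a" and b: "interior_space Q Y b"
  shows "\<zeta> \<in> cont_dist Q X a Y b \<longleftrightarrow>
    \<zeta> \<in> dist Q X Y \<and> (\<forall>\<nu>\<in>open_pts Q Y b. kan_pull Q X Y \<zeta> \<nu> \<in> open_pts Q X a)"
proof -
  note X = interior_space_qcategory[OF a] and Y = interior_space_qcategory[OF b]
  have cont: "\<zeta> \<in> cont_dist Q X a Y b \<longleftrightarrow> \<zeta> \<in> dist Q X Y \<and>
      (\<forall>\<nu>\<in>psh_pts Q Y. qle Q (psh Q X) (kan_pull Q X Y \<zeta> (b \<nu>)) (a (kan_pull Q X Y \<zeta> \<nu>)))"
    by (simp add: cont_dist_def qfunctor_le_def compose_def)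
  have "(\<forall>\<nu>\<in>psh_pts Q Y. qle Q (psh Q X) (kan_pull Q X Y \<zeta> (b \<nu>)) (a (kan_pull Q X Y \<zeta> \<nu>))) \<longleftrightarrow>
      (\<forall>\<nu>\<in>open_pts Q Y b. kan_pull Q X Y \<zeta> \<nu> \<in> open_pts Q X a)" if \<zeta>: "\<zeta> \<in> dist Q X Y"
  proof (intro iffI ballI)
    fix \<nu>
    assume le: "\<forall>\<nu>\<in>psh_pts Q Y. qle Q (psh Q X) (kan_pull Q X Y \<zeta> (b \<nu>)) (a (kan_pull Q X Y \<zeta> \<nu>))"
      and \<nu>: "\<nu> \<in> open_pts Q Y b"
    then have "\<nu> \<in> psh_pts Q Y" "b \<nu> = \<nu>"
      by (simp_all add: open_pts_iff)
    moreover from le this have "qle Q (psh Q X) (kan_pull Q X Y \<zeta> \<nu>) (a (kan_pull Q X Y \<zeta> \<nu>))"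
      by force
    ultimately show "kan_pull Q X Y \<zeta> \<nu> \<in> open_pts Q X a"
      using a X Y \<zeta> by (simp add: open_ptsI)
  next
    fix \<nu> assume op: "\<forall>\<nu>\<in>open_pts Q Y b. kan_pull Q X Y \<zeta> \<nu> \<in> open_pts Q X a"
      and \<nu>: "\<nu> \<in> psh_pts Q Y"
    have "kan_pull Q X Y \<zeta> (b \<nu>) = a (kan_pull Q X Y \<zeta> (b \<nu>))"
      using op b \<nu> by (simp add: open_pts_iff interior_idem)
    moreover have "qle Q (psh Q X) (kan_pull Q X Y \<zeta> (b \<nu>)) (kan_pull Q X Y \<zeta> \<nu>)"
      by (rule qfunctor_qle[OF _ _ qfunctor_kan_pull[OF X Y \<zeta>] _ _ interior_le[OF b \<nu>]])
        (use X Y b \<nu> in simp_all)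
    ultimately show "qle Q (psh Q X) (kan_pull Q X Y \<zeta> (b \<nu>)) (a (kan_pull Q X Y \<zeta> \<nu>))"
      using interior_mono[OF a, of "kan_pull Q X Y \<zeta> (b \<nu>)" "kan_pull Q X Y \<zeta> \<nu>"] X Y b \<nu> \<zeta> by simp
  qed
  with cont show ?thesis
    by blast
qed

lemma cont_distD:
  assumes "interior_space Q X a" "interior_space Q Y b" "\<zeta> \<in> cont_dist Q X a Y b"
  shows "\<zeta> \<in> dist Q X Y"
    and "\<nu> \<in> open_pts Q Y b \<Longrightarrow> kan_pull Q X Y \<zeta> \<nu> \<in> open_pts Q X a"
  using assms by (simp_all add: cont_dist_iff)

lemma open_rel_iff:
  assumes b: "interior_space Q Y b"
  shows "(\<zeta>, \<zeta>') \<in> open_rel Q (X, a) (Y, b) \<longleftrightarrow>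
    \<zeta> \<in> cont_dist Q X a Y b \<and> \<zeta>' \<in> cont_dist Q X a Y b \<and>
    (\<forall>\<nu>\<in>open_pts Q Y b. kan_pull Q X Y \<zeta> \<nu> = kan_pull Q X Y \<zeta>' \<nu>)"
proof -
  have "compose (psh_pts Q Y) (kan_pull Q X Y \<zeta>) b = compose (psh_pts Q Y) (kan_pull Q X Y \<zeta>') b \<longleftrightarrow>
      (\<forall>\<nu>\<in>psh_pts Q Y. kan_pull Q X Y \<zeta> (b \<nu>) = kan_pull Q X Y \<zeta>' (b \<nu>))"
    by (auto simp: compose_def fun_eq_iff restrict_def)
  \<comment> \<open>The image of \<open>b\<close> is the set of its open presheaves: each
    \<open>b \<nu>\<close> is open, and an open \<nu> equals \<open>b \<nu>\<close>.\<close>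
  also have "\<dots> \<longleftrightarrow> (\<forall>\<nu>\<in>open_pts Q Y b. kan_pull Q X Y \<zeta> \<nu> = kan_pull Q X Y \<zeta>' \<nu>)"
    using interior_open[OF b] by (metis open_pts_iff)
  finally show ?thesis
    by (simp add: open_rel_def)
qed

lemma hm_cont_dist: "interior_space Q X a \<Longrightarrow> hm X \<in> cont_dist Q X a X a"
  by (simp add: cont_dist_iff kan_pull_hm open_pts_iff)

lemma dist_comp_cont_dist:
  assumes "interior_space Q X a" "interior_space Q Y b" "interior_space Q Z c"
    and "\<zeta> \<in> cont_dist Q X a Y b" "\<xi> \<in> cont_dist Q Y b Z c"
  shows "dist_comp Q X Y Z \<xi> \<zeta> \<in> cont_dist Q X a Z c"
  using assms cont_distD(1)[OF assms(1,2,4)] cont_distD(1)[OF assms(2,3,5)]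
  by (auto simp: cont_dist_iff kan_pull_comp open_pts_iff[where a = c])

text \<open>The pullback of \<nu> along the join is the join of the presheaves
  \<open>\<phi>\<^sup>* \<nu>\<close>. Each of these is open and below that join, hence below its
  interior, and so the join is open as well.\<close>

lemma dist_Sup_cont_dist:
  assumes a: "interior_space Q X a" and b: "interior_space Q Y b" and A: "A \<subseteq> cont_dist Q X a Y b"
  shows "dist_Sup X Y A \<in> cont_dist Q X a Y b"
  unfolding cont_dist_iff[OF a b]
proof (intro conjI ballI)
  note X = interior_space_qcategory[OF a] and Y = interior_space_qcategory[OF b]
  have A': "A \<subseteq> dist Q X Y"
    using A cont_distD(1)[OF a b] by auto
  show d: "dist_Sup X Y A \<in> dist Q X Y"
    using X Y A' by simp
  fix \<nu> assume \<nu>: "\<nu> \<in> open_pts Q Y b"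
  then have \<nu>': "\<nu> \<in> psh_pts Q Y"
    by (simp add: open_pts_iff)
  let ?s = "kan_pull Q X Y (dist_Sup X Y A) \<nu>"
  let ?one = "one_cat Q (fst \<nu>)"
  let ?A = "(\<lambda>\<phi>. snd (kan_pull Q X Y \<phi> \<nu>)) ` A"
  have s: "?s \<in> psh_pts Q X"
    using X Y \<nu>' d by simp
  have im: "?A \<subseteq> dist Q X ?one"
    using A' X Y \<nu>' by auto
  have s_val: "pval ?s x = dist_Sup X ?one ?A (x, ())" for x
    using snd_kan_pull_Sup[OF X Y A' \<nu>'] by (simp add: pval_def)
  have "pval ?s x \<sqsubseteq>\<^bsub>Hom Q (tp X x) (fst \<nu>)\<^esub> pval (a ?s) x" if x: "x \<in> pts X" for x
  proof -
    have as: "pval (a ?s) x \<in> arrows Q (tp X x) (fst \<nu>)"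
      using pval_arrow[OF interior_psh[OF a s] x] a s \<nu>' by simp
    have "snd (kan_pull Q X Y \<phi> \<nu>) (x, ()) \<sqsubseteq>\<^bsub>Hom Q (tp X x) (fst \<nu>)\<^esub> pval (a ?s) x" if \<phi>: "\<phi> \<in> A" for \<phi>
    proof -
      let ?k = "kan_pull Q X Y \<phi> \<nu>"
      have k: "?k \<in> psh_pts Q X" "a ?k = ?k"
        using \<phi> A cont_distD(2)[OF a b _ \<nu>] open_pts_iff by blast+
      have "pval ?k x \<sqsubseteq>\<^bsub>Hom Q (tp X x) (fst \<nu>)\<^esub> pval ?s x" if x: "x \<in> pts X" for x
        using dist_Sup_upper[OF X _ im x, of "()" "snd ?k"] \<phi> \<nu>' s_val by (simp add: pval_def)
      then have "qle Q (psh Q X) ?k ?s"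
        using X k s \<nu>' by (simp add: qle_psh_iff)
      then have "qle Q (psh Q X) ?k (a ?s)"
        using interior_mono[OF a k(1) s] k(2) by simp
      then show ?thesis
        using X k s a x \<nu>' by (simp add: qle_psh_iff) (simp add: pval_def)
    qed
    then show ?thesis
      using dist_Sup_le_iff[OF X _ im x, of "()" "pval (a ?s) x"] as s_val \<nu>' by simp
  qed
  then have "qle Q (psh Q X) ?s (a ?s)"
    using a X s \<nu>' by (simp add: qle_psh_iff)
  then show "?s \<in> open_pts Q X a"
    by (rule open_ptsI[OF a s])
qed

text \<open>The comonad of the adjunction: the counit puts it below the identity, and the triangle
  identity makes it idempotent.\<close>

lemma interior_space_kan:
  assumes X: "qcategory Q X" and Y: "qcategory Q Y" and \<phi>: "\<phi> \<in> dist Q X Y"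
  shows "interior_space Q X (compose (psh_pts Q X) (kan_pull Q X Y \<phi>) (kan_push Q X Y \<phi>))" (is "interior_space Q X ?a")
  unfolding interior_space_def
proof (intro conjI ballI)
  show "qfunctor Q (psh Q X) (psh Q X) ?a"
    unfolding qfunctor_def
  proof (intro conjI ballI)
    show "?a \<in> pts (psh Q X) \<rightarrow>\<^sub>E pts (psh Q X)"
      using assms by (auto simp: compose_def)
  next
    fix \<mu> assume "\<mu> \<in> pts (psh Q X)"
    then show "tp (psh Q X) (?a \<mu>) = tp (psh Q X) \<mu>"
      using assms by (simp add: compose_def)
  next
    fix \<mu> \<nu> assume "\<mu> \<in> pts (psh Q X)" "\<nu> \<in> pts (psh Q X)"
    then have p: "\<mu> \<in> psh_pts Q X" "\<nu> \<in> psh_pts Q X"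
      by simp_all
    note k = kan_push_psh[OF assms p(1)] kan_push_psh[OF assms p(2)]
    have 1: "hm (psh Q X) (\<mu>, \<nu>) \<sqsubseteq>\<^bsub>Hom Q (fst \<mu>) (fst \<nu>)\<^esub>
        hm (psh Q Y) (kan_push Q X Y \<phi> \<mu>, kan_push Q X Y \<phi> \<nu>)"
      using qfunctor_hm[OF qfunctor_kan_push[OF assms], of \<mu> \<nu>] p by simp
    have 2: "hm (psh Q Y) (kan_push Q X Y \<phi> \<mu>, kan_push Q X Y \<phi> \<nu>) \<sqsubseteq>\<^bsub>Hom Q (fst \<mu>) (fst \<nu>)\<^esub>
        hm (psh Q X) (kan_pull Q X Y \<phi> (kan_push Q X Y \<phi> \<mu>), kan_pull Q X Y \<phi> (kan_push Q X Y \<phi> \<nu>))"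
      using qfunctor_hm[OF qfunctor_kan_pull[OF assms], of "kan_push Q X Y \<phi> \<mu>" "kan_push Q X Y \<phi> \<nu>"] p k
      by simp
    have h: "hm (psh Q Y) (kan_push Q X Y \<phi> \<mu>, kan_push Q X Y \<phi> \<nu>) \<in> arrows Q (fst \<mu>) (fst \<nu>)"
      "hm (psh Q X) (kan_pull Q X Y \<phi> (kan_push Q X Y \<phi> \<mu>), kan_pull Q X Y \<phi> (kan_push Q X Y \<phi> \<nu>))
        \<in> arrows Q (fst \<mu>) (fst \<nu>)"
      using psh_hm_arrow[OF Y k] psh_hm_arrow[OF X kan_pull_psh[OF assms k(1)] kan_pull_psh[OF assms k(2)]] p k
      by simp_all
    have "hm (psh Q X) (\<mu>, \<nu>) \<sqsubseteq>\<^bsub>Hom Q (fst \<mu>) (fst \<nu>)\<^esub>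
        hm (psh Q X) (kan_pull Q X Y \<phi> (kan_push Q X Y \<phi> \<mu>), kan_pull Q X Y \<phi> (kan_push Q X Y \<phi> \<nu>))"
      by (rule hom_trans[OF _ _ _ h 1 2]) (use X p in simp_all)
    then show "hm (psh Q X) (\<mu>, \<nu>) \<sqsubseteq>\<^bsub>Hom Q (tp (psh Q X) \<mu>) (tp (psh Q X) \<nu>)\<^esub> hm (psh Q X) (?a \<mu>, ?a \<nu>)"
      using p by (simp add: compose_def)
  qed
  show "qfunctor_le Q (psh Q X) (psh Q X) ?a (\<lambda>\<mu>. \<mu>)"
    using kan_counit[OF assms] by (simp add: qfunctor_le_def compose_def)
  show "?a (?a \<mu>) = ?a \<mu>" if "\<mu> \<in> psh_pts Q X" for \<mu>
    using that assms by (simp add: compose_def kan_pull_push_pull)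
qed (rule X)

lemma open_pts_kan:
  assumes "qcategory Q X" "qcategory Q Y" "\<phi> \<in> dist Q X Y"
  shows "open_pts Q X (compose (psh_pts Q X) (kan_pull Q X Y \<phi>) (kan_push Q X Y \<phi>)) =
    kan_pull Q X Y \<phi> ` psh_pts Q Y"
proof (intro equalityI subsetI)
  fix \<mu> assume \<mu>: "\<mu> \<in> open_pts Q X (compose (psh_pts Q X) (kan_pull Q X Y \<phi>) (kan_push Q X Y \<phi>))"
  then have "\<mu> \<in> psh_pts Q X"
    by (simp add: open_pts_iff)
  moreover from this \<mu> have "kan_pull Q X Y \<phi> (kan_push Q X Y \<phi> \<mu>) = \<mu>"
    by (simp add: open_pts_iff compose_def)
  ultimately show "\<mu> \<in> kan_pull Q X Y \<phi> ` psh_pts Q Y"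
    using kan_push_psh[OF assms] by (metis image_eqI)
next
  fix \<mu> assume "\<mu> \<in> kan_pull Q X Y \<phi> ` psh_pts Q Y"
  then show "\<mu> \<in> open_pts Q X (compose (psh_pts Q X) (kan_pull Q X Y \<phi>) (kan_push Q X Y \<phi>))"
    using assms by (auto simp: open_pts_iff compose_def kan_pull_push_pull)
qed

lemma interior_extensional: "interior_space Q X a \<Longrightarrow> a \<in> extensional (psh_pts Q X)"
  unfolding interior_space_def qfunctor_def psh_simps(1) PiE_def by blast

text \<open>\<open>c \<mu>\<close> is open for \<open>d\<close> and lies below \<mu>, so c \<mu> = d
  (c \<mu>) \<le> d \<mu>; the roles of c and d are then exchanged. Equal values suffice because
  interior operators are extensional.\<close>

lemma interior_eqI:
  assumes a: "interior_space Q X a" and b: "interior_space Q X b"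
    and opens: "open_pts Q X a = open_pts Q X b"
  shows "a = b"
proof (rule extensionalityI)
  show "a \<in> extensional (psh_pts Q X)" "b \<in> extensional (psh_pts Q X)"
    by (rule interior_extensional[OF a], rule interior_extensional[OF b])
  have le: "qle Q (psh Q X) (c \<mu>) (d \<mu>)"
    if c: "interior_space Q X c" and d: "interior_space Q X d"
      and op: "open_pts Q X c = open_pts Q X d" and \<mu>: "\<mu> \<in> psh_pts Q X" for c d \<mu>
  proof -
    have "d (c \<mu>) = c \<mu>"
      using interior_open[OF c \<mu>] op by (simp add: open_pts_iff)
    then show ?thesis
      using interior_mono[OF d interior_psh[OF c \<mu>] \<mu> interior_le[OF c \<mu>]] by simp
  qed
  fix \<mu> assume \<mu>: "\<mu> \<in> psh_pts Q X"
  show "a \<mu> = b \<mu>"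
    by (rule qle_psh_antisym[OF interior_space_qcategory[OF a]])
      (use a b opens \<mu> le in simp_all)
qed

subsection \<open>Distributors into and between categories of open presheaves\<close>

lemma open_cat_simps [simp]:
  "pts (open_cat Q X a) = open_pts Q X a"
  "\<mu> \<in> open_pts Q X a \<Longrightarrow> tp (open_cat Q X a) \<mu> = fst \<mu>"
  "\<mu> \<in> open_pts Q X a \<Longrightarrow> \<nu> \<in> open_pts Q X a \<Longrightarrow>
    hm (open_cat Q X a) (\<mu>, \<nu>) = hm (psh Q X) (\<mu>, \<nu>)"
  by (simp_all add: open_cat_def full_subcat_def open_pts_iff)

lemma open_psh: "\<mu> \<in> open_pts Q X a \<Longrightarrow> \<mu> \<in> psh_pts Q X"
  by (simp add: open_pts_iff)

lemma fst_open [simp]: "\<mu> \<in> open_pts Q X a \<Longrightarrow> fst \<mu> \<in> Obj Q"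
  by (rule psh_ptsD(1)[OF open_psh])

lemma qcategory_open_cat [simp]:
  assumes X: "qcategory Q X"
  shows "qcategory Q (open_cat Q X a)"
  unfolding qcategory_def
proof (intro conjI ballI)
  note P = qcategory_psh[OF X]
  show "tp (open_cat Q X a) \<in> pts (open_cat Q X a) \<rightarrow>\<^sub>E Obj Q"
    by (auto simp: open_cat_def full_subcat_def open_pts_iff psh_pts_pair_iff)
  have "hm (open_cat Q X a) \<in> extensional (open_pts Q X a \<times> open_pts Q X a)"
    by (simp add: open_cat_def full_subcat_def)
  then show "hm (open_cat Q X a) \<in> (\<Pi>\<^sub>E (x, y)\<in>pts (open_cat Q X a) \<times> pts (open_cat Q X a).
      arrows Q (tp (open_cat Q X a) x) (tp (open_cat Q X a) y))"
    using X by (auto simp: PiE_iff open_psh)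
  show "Idn Q (tp (open_cat Q X a) \<mu>) \<sqsubseteq>\<^bsub>Hom Q (tp (open_cat Q X a) \<mu>) (tp (open_cat Q X a) \<mu>)\<^esub>
      hm (open_cat Q X a) (\<mu>, \<mu>)" if "\<mu> \<in> pts (open_cat Q X a)" for \<mu>
    using qcat_Idn[OF P, of \<mu>] that by (simp add: open_psh)
  show "Cmp Q (tp (open_cat Q X a) \<mu>) (tp (open_cat Q X a) \<nu>) (tp (open_cat Q X a) \<rho>)
      (hm (open_cat Q X a) (\<nu>, \<rho>)) (hm (open_cat Q X a) (\<mu>, \<nu>))
      \<sqsubseteq>\<^bsub>Hom Q (tp (open_cat Q X a) \<mu>) (tp (open_cat Q X a) \<rho>)\<^esub> hm (open_cat Q X a) (\<mu>, \<rho>)"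
    if "\<mu> \<in> pts (open_cat Q X a)" "\<nu> \<in> pts (open_cat Q X a)" "\<rho> \<in> pts (open_cat Q X a)" for \<mu> \<nu> \<rho>
    using qcat_Cmp[OF P, of \<mu> \<nu> \<rho>] that by (simp add: open_psh)
qed

text \<open>The distributor corresponding to a Q-functor f from A to the presheaves on X. It covers
  \<open>kappa\<close>, with f the inclusion, and \<open>from_codomain\<close>.\<close>

definition eval_dist ::
  "('v, 'o, 'a) qcat \<Rightarrow> ('w, 'o, 'a) qcat \<Rightarrow> ('w \<Rightarrow> ('v, 'o, 'a) presheaf) \<Rightarrow> 'v \<times> 'w \<Rightarrow> 'a" where
  "eval_dist X A f = (\<lambda>(x, w)\<in>pts X \<times> pts A. pval (f w) x)"

lemma eval_dist_apply [simp]: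
  "x \<in> pts X \<Longrightarrow> w \<in> pts A \<Longrightarrow> eval_dist X A f (x, w) = pval (f w) x"
  by (simp add: eval_dist_def)

lemma eval_dist_dist:
  assumes X: "qcategory Q X" and A: "qcategory Q A"
    and f: "\<And>w. w \<in> pts A \<Longrightarrow> f w \<in> psh_pts Q X" "\<And>w. w \<in> pts A \<Longrightarrow> fst (f w) = tp A w"
      "\<And>w w'. w \<in> pts A \<Longrightarrow> w' \<in> pts A \<Longrightarrow>
        hm A (w, w') \<sqsubseteq>\<^bsub>Hom Q (tp A w) (tp A w')\<^esub> hm (psh Q X) (f w, f w')"
  shows "eval_dist X A f \<in> dist Q X A"
proof (rule distI[OF X A])
  show "eval_dist X A f \<in> extensional (pts X \<times> pts A)"
    by (simp add: eval_dist_def)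
  show arr: "eval_dist X A f (x, w) \<in> arrows Q (tp X x) (tp A w)" if "x \<in> pts X" "w \<in> pts A" for x w
    using pval_arrow[OF f(1)[OF that(2)] that(1)] f(2) that by simp
  fix x w w' assume p: "x \<in> pts X" "w \<in> pts A" "w' \<in> pts A"
  have h: "hm (psh Q X) (f w, f w') \<in> arrows Q (tp A w) (tp A w')"
    using psh_hm_arrow[OF X f(1)[OF p(2)] f(1)[OF p(3)]] p f(2) by simp
  show "Cmp Q (tp X x) (tp A w) (tp A w') (hm A (w, w')) (eval_dist X A f (x, w))
      \<sqsubseteq>\<^bsub>Hom Q (tp X x) (tp A w')\<^esub> eval_dist X A f (x, w')"
    by (rule cmp_le_trans_left[OF _ _ _ _ _ h _ f(3)[OF p(2,3)]])
      (use X A p arr h psh_hm_cmp_le[OF X f(1)[OF p(2)] f(1)[OF p(3)] p(1)] f(2) in simp_all)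
next
  fix x x' w assume p: "x \<in> pts X" "x' \<in> pts X" "w \<in> pts A"
  show "Cmp Q (tp X x') (tp X x) (tp A w) (eval_dist X A f (x, w)) (hm X (x', x))
      \<sqsubseteq>\<^bsub>Hom Q (tp X x') (tp A w)\<^esub> eval_dist X A f (x', w)"
    using pval_right[OF X f(1)[OF p(3)] p(1,2)] p f(2) by simp
qed

text \<open>Covers \<open>restricted_cograph\<close> and \<open>to_codomain\<close>. In both, f is
  the inclusion of the open presheaves into all presheaves.\<close>

definition hom_dist ::
  "('v, 'o, 'a) qcat \<Rightarrow> ('w, 'o, 'a) qcat \<Rightarrow> ('z, 'o, 'a) qcat \<Rightarrow> ('v \<Rightarrow> 'z) \<Rightarrow> ('w \<Rightarrow> 'z) \<Rightarrow> 'v \<times> 'w \<Rightarrow> 'a" where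
  "hom_dist A B P f g = (\<lambda>(v, w)\<in>pts A \<times> pts B. hm P (f v, g w))"

lemma hom_dist_apply [simp]:
  "v \<in> pts A \<Longrightarrow> w \<in> pts B \<Longrightarrow> hom_dist A B P f g (v, w) = hm P (f v, g w)"
  by (simp add: hom_dist_def)

lemma hom_dist_dist:
  assumes A: "qcategory Q A" and B: "qcategory Q B" and P: "qcategory Q P"
    and f: "\<And>v. v \<in> pts A \<Longrightarrow> f v \<in> pts P" "\<And>v. v \<in> pts A \<Longrightarrow> tp P (f v) = tp A v"
      "\<And>v v'. v \<in> pts A \<Longrightarrow> v' \<in> pts A \<Longrightarrow>
        hm A (v, v') \<sqsubseteq>\<^bsub>Hom Q (tp A v) (tp A v')\<^esub> hm P (f v, f v')"
    and g: "\<And>w. w \<in> pts B \<Longrightarrow> g w \<in> pts P" "\<And>w. w \<in> pts B \<Longrightarrow> tp P (g w) = tp B w"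
      "\<And>w w'. w \<in> pts B \<Longrightarrow> w' \<in> pts B \<Longrightarrow>
        hm B (w, w') \<sqsubseteq>\<^bsub>Hom Q (tp B w) (tp B w')\<^esub> hm P (g w, g w')"
  shows "hom_dist A B P f g \<in> dist Q A B"
proof (rule distI[OF A B])
  show "hom_dist A B P f g \<in> extensional (pts A \<times> pts B)"
    by (simp add: hom_dist_def)
  show arr: "hom_dist A B P f g (v, w) \<in> arrows Q (tp A v) (tp B w)" if "v \<in> pts A" "w \<in> pts B" for v w
    using qcat_hm[OF P f(1)[OF that(1)] g(1)[OF that(2)]] f(2) g(2) that by simp
  show "Cmp Q (tp A v) (tp B w) (tp B w') (hm B (w, w')) (hom_dist A B P f g (v, w))
      \<sqsubseteq>\<^bsub>Hom Q (tp A v) (tp B w')\<^esub> hom_dist A B P f g (v, w')"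
    if p: "v \<in> pts A" "w \<in> pts B" "w' \<in> pts B" for v w w'
  proof -
    have h: "hm P (g w, g w') \<in> arrows Q (tp B w) (tp B w')"
      using qcat_hm[OF P g(1)[OF p(2)] g(1)[OF p(3)]] p g(2) by simp
    show ?thesis
      by (rule cmp_le_trans_left[OF _ _ _ _ _ h _ g(3)[OF p(2,3)]])
        (use A B p arr h qcat_Cmp[OF P f(1)[OF p(1)] g(1)[OF p(2)] g(1)[OF p(3)]] f(2) g(2)
          qcat_hm[OF P f(1)[OF p(1)] g(1)[OF p(2)]] qcat_hm[OF P f(1)[OF p(1)] g(1)[OF p(3)]] in simp_all)
  qed
  show "Cmp Q (tp A v') (tp A v) (tp B w) (hom_dist A B P f g (v, w)) (hm A (v', v))
      \<sqsubseteq>\<^bsub>Hom Q (tp A v') (tp B w)\<^esub> hom_dist A B P f g (v', w)"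
    if p: "v \<in> pts A" "v' \<in> pts A" "w \<in> pts B" for v v' w
  proof -
    have h: "hm P (f v', f v) \<in> arrows Q (tp A v') (tp A v)"
      using qcat_hm[OF P f(1)[OF p(2)] f(1)[OF p(1)]] p f(2) by simp
    show ?thesis
      by (rule cmp_le_trans_right[OF _ _ _ _ h _ _ f(3)[OF p(2,1)]])
        (use A B p arr h qcat_Cmp[OF P f(1)[OF p(2)] f(1)[OF p(1)] g(1)[OF p(3)]] f(2) g(2)
          qcat_hm[OF P f(1)[OF p(1)] g(1)[OF p(3)]] qcat_hm[OF P f(1)[OF p(2)] g(1)[OF p(3)]] in simp_all)
  qed
qed

lemma kappa_eq: "kappa Q X a = eval_dist X (open_cat Q X a) (\<lambda>\<mu>. \<mu>)"
  by (auto simp: kappa_def eval_dist_def pval_def restrict_def fun_eq_iff)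

lemma kappa_dist [simp]:
  assumes "qcategory Q X"
  shows "kappa Q X a \<in> dist Q X (open_cat Q X a)"
  unfolding kappa_eq by (rule eval_dist_dist) (use assms in \<open>simp_all add: open_psh hom_refl\<close>)

lemma kappa_apply [simp]: "x \<in> pts X \<Longrightarrow> \<mu> \<in> open_pts Q X a \<Longrightarrow> kappa Q X a (x, \<mu>) = pval \<mu> x"
  by (simp add: kappa_eq)

text \<open>Both sides are the same join over the points of Y. Through this reading, two composites
  with \<open>kappa\<close> agree as soon as the pullbacks agree on open presheaves.\<close>

lemma dist_comp_kappa_apply:
  assumes "qcategory Q X" "qcategory Q Y" "\<zeta> \<in> dist Q X Y" "x \<in> pts X" "\<nu> \<in> open_pts Q Y b"
  shows "dist_comp Q X Y (open_cat Q Y b) (kappa Q Y b) \<zeta> (x, \<nu>) = pval (kan_pull Q X Y \<zeta> \<nu>) x"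
  using assms by (simp add: pval_def[of "kan_pull Q X Y \<zeta> \<nu>"] open_psh)
    (simp add: dist_comp_def pval_def cong: image_cong_simp)

lemma restricted_cograph_eq:
  "restricted_cograph Q X a Y b \<zeta> =
    hom_dist (open_cat Q X a) (open_cat Q Y b) (psh Q X) (\<lambda>\<mu>. \<mu>) (kan_pull Q X Y \<zeta>)"
  by (auto simp: restricted_cograph_def cograph_def hom_dist_def restrict_def fun_eq_iff open_psh)

lemma restricted_cograph_dist:
  assumes "qcategory Q X" "qcategory Q Y" "\<zeta> \<in> dist Q X Y"
  shows "restricted_cograph Q X a Y b \<zeta> \<in> dist Q (open_cat Q X a) (open_cat Q Y b)"
  unfolding restricted_cograph_eq
proof (rule hom_dist_dist)
  fix \<nu> \<nu>' assume "\<nu> \<in> pts (open_cat Q Y b)" "\<nu>' \<in> pts (open_cat Q Y b)"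
  then show "hm (open_cat Q Y b) (\<nu>, \<nu>')
      \<sqsubseteq>\<^bsub>Hom Q (tp (open_cat Q Y b) \<nu>) (tp (open_cat Q Y b) \<nu>')\<^esub>
      hm (psh Q X) (kan_pull Q X Y \<zeta> \<nu>, kan_pull Q X Y \<zeta> \<nu>')"
    using qfunctor_hm[OF qfunctor_kan_pull[OF assms], of \<nu> \<nu>'] by (simp add: open_psh)
qed (use assms in \<open>simp_all add: open_psh hom_refl\<close>)

text \<open>The join is attained at \<open>g w\<close>, as \<open>1 \<le> 1(g w, g w)\<close>.\<close>

lemma dist_comp_hom_kappa:
  assumes X: "qcategory Q X" and B: "qcategory Q B" and g: "\<And>w. w \<in> pts B \<Longrightarrow> g w \<in> open_pts Q X a"
      "\<And>w. w \<in> pts B \<Longrightarrow> fst (g w) = tp B w"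
    and d: "hom_dist (open_cat Q X a) B (psh Q X) (\<lambda>\<mu>. \<mu>) g \<in> dist Q (open_cat Q X a) B"
    and e: "\<theta> \<in> dist Q X B" "\<And>x w. x \<in> pts X \<Longrightarrow> w \<in> pts B \<Longrightarrow> \<theta> (x, w) = pval (g w) x"
  shows "dist_comp Q X (open_cat Q X a) B (hom_dist (open_cat Q X a) B (psh Q X) (\<lambda>\<mu>. \<mu>) g) (kappa Q X a) = \<theta>"
proof (rule dist_comp_eqI)
  fix x \<mu> w assume p: "x \<in> pts X" "\<mu> \<in> pts (open_cat Q X a)" "w \<in> pts B"
  then show "Cmp Q (tp X x) (tp (open_cat Q X a) \<mu>) (tp B w)
      (hom_dist (open_cat Q X a) B (psh Q X) (\<lambda>\<mu>. \<mu>) g (\<mu>, w)) (kappa Q X a (x, \<mu>))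
      \<sqsubseteq>\<^bsub>Hom Q (tp X x) (tp B w)\<^esub> \<theta> (x, w)"
    using psh_hm_cmp_le[OF X, of \<mu> "g w" x] g(1)[OF p(3)] g(2)[OF p(3)] e(2) by (simp add: open_psh)
next
  fix x w assume p: "x \<in> pts X" "w \<in> pts B"
  let ?\<mu> = "g w"
  have \<mu>: "?\<mu> \<in> psh_pts Q X" "fst ?\<mu> = tp B w"
    using open_psh[OF g(1)] g(2) p by simp_all
  have v: "pval ?\<mu> x \<in> arrows Q (tp X x) (tp B w)"
    using pval_arrow[OF \<mu>(1) p(1)] \<mu> by simp
  have h: "hm (psh Q X) (?\<mu>, ?\<mu>) \<in> arrows Q (tp B w) (tp B w)"
    using psh_hm_arrow[OF X \<mu>(1) \<mu>(1)] \<mu> by simp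
  have i: "Idn Q (tp B w) \<sqsubseteq>\<^bsub>Hom Q (tp B w) (tp B w)\<^esub> hm (psh Q X) (?\<mu>, ?\<mu>)"
    using qcat_Idn[OF qcategory_psh[OF X], of ?\<mu>] \<mu> by simp
  have "Cmp Q (tp X x) (tp B w) (tp B w) (Idn Q (tp B w)) (pval ?\<mu> x) \<sqsubseteq>\<^bsub>Hom Q (tp X x) (tp B w)\<^esub>
      Cmp Q (tp X x) (tp B w) (tp B w) (hm (psh Q X) (?\<mu>, ?\<mu>)) (pval ?\<mu> x)"
    by (rule cmp_mono) (use X B p v h i in \<open>simp_all add: idn_arrow hom_refl\<close>)
  then show "\<exists>\<mu>\<in>pts (open_cat Q X a). \<theta> (x, w) \<sqsubseteq>\<^bsub>Hom Q (tp X x) (tp B w)\<^esub>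
      Cmp Q (tp X x) (tp (open_cat Q X a) \<mu>) (tp B w)
        (hom_dist (open_cat Q X a) B (psh Q X) (\<lambda>\<mu>. \<mu>) g (\<mu>, w)) (kappa Q X a (x, \<mu>))"
    using X B p v g \<mu> e(2) by (intro bexI[of _ ?\<mu>]) (simp_all add: cmp_idn_left)
qed (use assms in simp_all)

text \<open>The square that makes \<open>Ihat_rep\<close> an arrow. It is
  \<open>dist_comp_hom_kappa\<close> for g = \<open>\<zeta>\<^sup>*\<close>, whose values on open
  presheaves are open by continuity.\<close>

lemma restricted_cograph_kappa:
  assumes a: "interior_space Q X a" and b: "interior_space Q Y b" and \<zeta>: "\<zeta> \<in> cont_dist Q X a Y b"
  shows "dist_comp Q X (open_cat Q X a) (open_cat Q Y b) (restricted_cograph Q X a Y b \<zeta>) (kappa Q X a) =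
    dist_comp Q X Y (open_cat Q Y b) (kappa Q Y b) \<zeta>"
proof -
  note X = interior_space_qcategory[OF a] and Y = interior_space_qcategory[OF b]
  note d = cont_distD[OF a b \<zeta>]
  show ?thesis
    unfolding restricted_cograph_eq
    by (rule dist_comp_hom_kappa)
      (use X Y d restricted_cograph_dist[OF X Y d(1), of a b]
        in \<open>simp_all add: dist_comp_kappa_apply open_psh restricted_cograph_eq\<close>)
qed

abbreviation kan_op :: "('v, 'o, 'a) qcat \<Rightarrow> ('w, 'o, 'a) qcat \<Rightarrow> ('v \<times> 'w \<Rightarrow> 'a) \<Rightarrow> ('v, 'o, 'a) psh_op" where
  "kan_op X Y \<phi> \<equiv> compose (psh_pts Q X) (kan_pull Q X Y \<phi>) (kan_push Q X Y \<phi>)"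

lemma column_open:
  assumes "qcategory Q X" "qcategory Q Y" "\<phi> \<in> dist Q X Y" "y \<in> pts Y"
  shows "column X Y \<phi> y \<in> open_pts Q X (kan_op X Y \<phi>)"
  unfolding open_pts_kan[OF assms(1-3)]
  using kan_pull_column_hm[OF assms] column_psh[OF assms(2,2) hm_dist[OF assms(2)] assms(4)] by (metis image_eqI)

text \<open>The left action of Y on \<phi>, read through \<open>le_psh_hm_iff\<close>; it makes the
  column map a Q-functor from Y to the presheaves on X.\<close>

lemma hm_le_column:
  assumes X: "qcategory Q X" and Y: "qcategory Q Y" and \<phi>: "\<phi> \<in> dist Q X Y"
    and p: "y \<in> pts Y" "y' \<in> pts Y"
  shows "hm Y (y, y') \<sqsubseteq>\<^bsub>Hom Q (tp Y y) (tp Y y')\<^esub> hm (psh Q X) (column X Y \<phi> y, column X Y \<phi> y')"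
  using le_psh_hm_iff[OF X column_psh[OF X Y \<phi> p(1)] column_psh[OF X Y \<phi> p(2)], of "hm Y (y, y')"]
    dist_left[OF X Y \<phi> _ p] Y p by simp

text \<open>Composed with \<open>\<kappa>\<close> resp. \<open>\<phi>\<close> these two give \<open>\<phi>\<close> resp. \<open>\<kappa>\<close>.  In general they are not inverse to each other,
  but together with the identity of \<open>X\<close> they represent mutually inverse diagonals.\<close>

definition to_codomain ::
  "('v, 'o, 'a) qcat \<Rightarrow> ('w, 'o, 'a) qcat \<Rightarrow> ('v \<times> 'w \<Rightarrow> 'a) \<Rightarrow> ('v, 'o, 'a) presheaf \<times> 'w \<Rightarrow> 'a" where
  "to_codomain X Y \<phi> = hom_dist (open_cat Q X (kan_op X Y \<phi>)) Y (psh Q X) (\<lambda>\<mu>. \<mu>) (column X Y \<phi>)"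

definition from_codomain ::
  "('v, 'o, 'a) qcat \<Rightarrow> ('w, 'o, 'a) qcat \<Rightarrow> ('v \<times> 'w \<Rightarrow> 'a) \<Rightarrow> 'w \<times> ('v, 'o, 'a) presheaf \<Rightarrow> 'a" where
  "from_codomain X Y \<phi> = eval_dist Y (open_cat Q X (kan_op X Y \<phi>)) (kan_push Q X Y \<phi>)"

lemma to_codomain_dist:
  assumes "qcategory Q X" "qcategory Q Y" "\<phi> \<in> dist Q X Y"
  shows "to_codomain X Y \<phi> \<in> dist Q (open_cat Q X (kan_op X Y \<phi>)) Y"
  unfolding to_codomain_def
  by (rule hom_dist_dist) (use assms in \<open>simp_all add: open_psh hom_refl hm_le_column\<close>)

lemma from_codomain_dist:
  assumes "qcategory Q X" "qcategory Q Y" "\<phi> \<in> dist Q X Y"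
  shows "from_codomain X Y \<phi> \<in> dist Q Y (open_cat Q X (kan_op X Y \<phi>))"
  unfolding from_codomain_def
proof (rule eval_dist_dist)
  fix \<mu> \<mu>' assume "\<mu> \<in> pts (open_cat Q X (kan_op X Y \<phi>))" "\<mu>' \<in> pts (open_cat Q X (kan_op X Y \<phi>))"
  then show "hm (open_cat Q X (kan_op X Y \<phi>)) (\<mu>, \<mu>')
      \<sqsubseteq>\<^bsub>Hom Q (tp (open_cat Q X (kan_op X Y \<phi>)) \<mu>) (tp (open_cat Q X (kan_op X Y \<phi>)) \<mu>')\<^esub>
      hm (psh Q Y) (kan_push Q X Y \<phi> \<mu>, kan_push Q X Y \<phi> \<mu>')"
    using qfunctor_hm[OF qfunctor_kan_push[OF assms], of \<mu> \<mu>'] by (simp add: open_psh)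
qed (use assms in \<open>simp_all add: open_psh\<close>)

text \<open>\<open>dist_comp_hom_kappa\<close> for the column map: the join is attained at the open
  presheaf \<phi>(-, y), whose value at x is \<phi>(x, y).\<close>

lemma to_codomain_kappa:
  assumes "qcategory Q X" "qcategory Q Y" "\<phi> \<in> dist Q X Y"
  shows "dist_comp Q X (open_cat Q X (kan_op X Y \<phi>)) Y (to_codomain X Y \<phi>) (kappa Q X (kan_op X Y \<phi>)) = \<phi>"
  unfolding to_codomain_def
  by (rule dist_comp_hom_kappa)
    (use assms to_codomain_dist[OF assms] in \<open>simp_all add: column_open to_codomain_def\<close>)

text \<open>At (x, \<mu>) the composite is the value of
  \<open>\<phi>\<^sup>* \<phi>\<^sub>* \<mu>\<close> at x, and this presheaf is \<mu> because \<mu>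
  is open.\<close>

lemma from_codomain_comp:
  assumes "qcategory Q X" "qcategory Q Y" "\<phi> \<in> dist Q X Y"
  shows "dist_comp Q X Y (open_cat Q X (kan_op X Y \<phi>)) (from_codomain X Y \<phi>) \<phi> = kappa Q X (kan_op X Y \<phi>)"
proof (rule dist_eqI)
  fix x \<mu> assume x: "x \<in> pts X" and "\<mu> \<in> pts (open_cat Q X (kan_op X Y \<phi>))"
  then have \<mu>: "\<mu> \<in> open_pts Q X (kan_op X Y \<phi>)" "\<mu> \<in> psh_pts Q X"
    by (simp_all add: open_psh)
  have "dist_comp Q X Y (open_cat Q X (kan_op X Y \<phi>)) (from_codomain X Y \<phi>) \<phi> (x, \<mu>) =
      dist_comp Q X Y (one_cat Q (fst \<mu>)) (snd (kan_push Q X Y \<phi> \<mu>)) \<phi> (x, ())"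
    using x \<mu> by (simp add: from_codomain_def dist_comp_def pval_def cong: image_cong_simp)
  also have "\<dots> = pval (kan_pull Q X Y \<phi> (kan_push Q X Y \<phi> \<mu>)) x"
    using assms \<mu> by (simp add: pval_def[of "kan_pull Q X Y \<phi> (kan_push Q X Y \<phi> \<mu>)"])
  also have "kan_pull Q X Y \<phi> (kan_push Q X Y \<phi> \<mu>) = \<mu>"
    using \<mu> by (simp add: open_pts_iff compose_def)
  finally show "dist_comp Q X Y (open_cat Q X (kan_op X Y \<phi>)) (from_codomain X Y \<phi>) \<phi> (x, \<mu>) =
      kappa Q X (kan_op X Y \<phi>) (x, \<mu>)"
    using x \<mu> by simp
qed (use assms from_codomain_dist[OF assms] in simp_all)

section \<open>Relabelling\<close>

lemma relabel_cat_simps: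
  assumes "inj_on e (pts Z)"
  shows "pts (relabel_cat e Z) = e ` pts Z"
    and "z \<in> pts Z \<Longrightarrow> tp (relabel_cat e Z) (e z) = tp Z z"
    and "z \<in> pts Z \<Longrightarrow> z' \<in> pts Z \<Longrightarrow> hm (relabel_cat e Z) (e z, e z') = hm Z (z, z')"
  using assms by (simp_all add: relabel_cat_def Let_def)

lemma qcategory_relabel_cat:
  assumes Z: "qcategory Q Z" and e: "inj_on e (pts Z)"
  shows "qcategory Q (relabel_cat e Z)"
  unfolding qcategory_def relabel_cat_simps(1)[OF e]
proof (intro conjI)
  note s = relabel_cat_simps[OF e]
  have "tp (relabel_cat e Z) \<in> extensional (e ` pts Z)"
    "hm (relabel_cat e Z) \<in> extensional (e ` pts Z \<times> e ` pts Z)"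
    by (simp_all add: relabel_cat_def Let_def)
  then show "tp (relabel_cat e Z) \<in> e ` pts Z \<rightarrow>\<^sub>E Obj Q"
    "hm (relabel_cat e Z) \<in> (\<Pi>\<^sub>E (x, y)\<in>e ` pts Z \<times> e ` pts Z.
      arrows Q (tp (relabel_cat e Z) x) (tp (relabel_cat e Z) y))"
    using Z s by (auto simp: PiE_iff)
  show "\<forall>x\<in>e ` pts Z. Idn Q (tp (relabel_cat e Z) x)
      \<sqsubseteq>\<^bsub>Hom Q (tp (relabel_cat e Z) x) (tp (relabel_cat e Z) x)\<^esub> hm (relabel_cat e Z) (x, x)"
    using s qcat_Idn[OF Z] by simp
  show "\<forall>x\<in>e ` pts Z. \<forall>y\<in>e ` pts Z. \<forall>z\<in>e ` pts Z.
      Cmp Q (tp (relabel_cat e Z) x) (tp (relabel_cat e Z) y) (tp (relabel_cat e Z) z)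
        (hm (relabel_cat e Z) (y, z)) (hm (relabel_cat e Z) (x, y))
      \<sqsubseteq>\<^bsub>Hom Q (tp (relabel_cat e Z) x) (tp (relabel_cat e Z) z)\<^esub> hm (relabel_cat e Z) (x, z)"
    using s qcat_Cmp[OF Z] by simp
qed

lemma relabel_dist_apply:
  assumes "inj_on e S" "inj_on e' T" "x \<in> S" "y \<in> T"
  shows "relabel_dist S e T e' \<phi> (e x, e' y) = \<phi> (x, y)"
  using assms by (simp add: relabel_dist_def)

lemma relabel_dist_dist:
  assumes Z: "qcategory Q Z" and e: "inj_on e (pts Z)" and W: "qcategory Q W" and e': "inj_on e' (pts W)"
    and \<phi>: "\<phi> \<in> dist Q Z W"
  shows "relabel_dist (pts Z) e (pts W) e' \<phi> \<in> dist Q (relabel_cat e Z) (relabel_cat e' W)"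
proof (rule distI)
  note s = relabel_cat_simps[OF e] relabel_cat_simps[OF e'] relabel_dist_apply[OF e e', where \<phi> = \<phi>]
  show "relabel_dist (pts Z) e (pts W) e' \<phi> \<in> extensional (pts (relabel_cat e Z) \<times> pts (relabel_cat e' W))"
    unfolding s by (simp add: relabel_dist_def)
  show "relabel_dist (pts Z) e (pts W) e' \<phi> (x, y) \<in> arrows Q (tp (relabel_cat e Z) x) (tp (relabel_cat e' W) y)"
    if "x \<in> pts (relabel_cat e Z)" "y \<in> pts (relabel_cat e' W)" for x y
    using that \<phi> s by auto
  show "Cmp Q (tp (relabel_cat e Z) x) (tp (relabel_cat e' W) y) (tp (relabel_cat e' W) y')
      (hm (relabel_cat e' W) (y, y')) (relabel_dist (pts Z) e (pts W) e' \<phi> (x, y))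
      \<sqsubseteq>\<^bsub>Hom Q (tp (relabel_cat e Z) x) (tp (relabel_cat e' W) y')\<^esub> relabel_dist (pts Z) e (pts W) e' \<phi> (x, y')"
    if "x \<in> pts (relabel_cat e Z)" "y \<in> pts (relabel_cat e' W)" "y' \<in> pts (relabel_cat e' W)" for x y y'
    using that dist_left[OF Z W \<phi>] s by auto
  show "Cmp Q (tp (relabel_cat e Z) x') (tp (relabel_cat e Z) x) (tp (relabel_cat e' W) y)
      (relabel_dist (pts Z) e (pts W) e' \<phi> (x, y)) (hm (relabel_cat e Z) (x', x))
      \<sqsubseteq>\<^bsub>Hom Q (tp (relabel_cat e Z) x') (tp (relabel_cat e' W) y)\<^esub> relabel_dist (pts Z) e (pts W) e' \<phi> (x', y)"
    if "x \<in> pts (relabel_cat e Z)" "x' \<in> pts (relabel_cat e Z)" "y \<in> pts (relabel_cat e' W)" for x x' y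
    using that dist_right[OF Z W \<phi>] s by auto
qed (use qcategory_relabel_cat[OF Z e] qcategory_relabel_cat[OF W e'] in simp_all)

text \<open>The join over the labels of the points of Y is the join over the points themselves,
  re-indexed along the injection \<open>e'\<close>.\<close>

lemma dist_comp_relabel:
  assumes e: "inj_on e (pts X)" and e': "inj_on e' (pts Y)" and e'': "inj_on e'' (pts Z)"
  shows "dist_comp Q (relabel_cat e X) (relabel_cat e' Y) (relabel_cat e'' Z)
      (relabel_dist (pts Y) e' (pts Z) e'' \<psi>) (relabel_dist (pts X) e (pts Y) e' \<phi>) =
    relabel_dist (pts X) e (pts Z) e'' (dist_comp Q X Y Z \<psi> \<phi>)"
proof (rule extensionalityI)
  note s = relabel_cat_simps[OF e] relabel_cat_simps[OF e'] relabel_cat_simps[OF e'']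
    relabel_dist_apply[OF e e'] relabel_dist_apply[OF e' e''] relabel_dist_apply[OF e e'']
  show "dist_comp Q (relabel_cat e X) (relabel_cat e' Y) (relabel_cat e'' Z)
      (relabel_dist (pts Y) e' (pts Z) e'' \<psi>) (relabel_dist (pts X) e (pts Y) e' \<phi>)
        \<in> extensional (e ` pts X \<times> e'' ` pts Z)"
    unfolding dist_comp_def s(1,7) by simp
  show "relabel_dist (pts X) e (pts Z) e'' (dist_comp Q X Y Z \<psi> \<phi>) \<in> extensional (e ` pts X \<times> e'' ` pts Z)"
    by (simp add: relabel_dist_def)
  fix xz assume "xz \<in> e ` pts X \<times> e'' ` pts Z"
  then obtain x z where p: "xz = (e x, e'' z)" "x \<in> pts X" "z \<in> pts Z"
    by auto
  show "dist_comp Q (relabel_cat e X) (relabel_cat e' Y) (relabel_cat e'' Z)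
      (relabel_dist (pts Y) e' (pts Z) e'' \<psi>) (relabel_dist (pts X) e (pts Y) e' \<phi>) xz =
    relabel_dist (pts X) e (pts Z) e'' (dist_comp Q X Y Z \<psi> \<phi>) xz"
    unfolding p(1) s(12)[OF p(2,3)] using p
    by (simp add: dist_comp_def s image_image cong: image_cong_simp)
qed

text \<open>In \<open>kappa\<close> only the codomain has to be relabelled. The lemmas above relabel
  at both ends, so the identity is used at the other; it changes nothing since \<open>tp\<close> and
  \<open>hm\<close> are extensional.\<close>

lemma relabel_cat_id:
  assumes "qcategory Q X"
  shows "relabel_cat (\<lambda>x. x) X = (X :: ('v, 'o, 'a) qcat)"
proof -
  have "tp X \<in> extensional (pts X)" "hm X \<in> extensional (pts X \<times> pts X)"
    using assms by (simp_all add: qcategory_def PiE_def)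
  then have "restrict (tp X) (pts X) = tp X" "restrict (hm X) (pts X \<times> pts X) = hm X"
    by (simp_all add: extensional_restrict)
  moreover have "(\<lambda>(u, v)\<in>pts X \<times> pts X. hm X (inv_into (pts X) (\<lambda>x. x) u, inv_into (pts X) (\<lambda>x. x) v)) =
      restrict (hm X) (pts X \<times> pts X)"
    using inv_into_f_f[of "\<lambda>x. x" "pts X"] by (auto simp: fun_eq_iff restrict_def inj_on_def)
  moreover have "(\<lambda>u\<in>pts X. tp X (inv_into (pts X) (\<lambda>x. x) u)) = restrict (tp X) (pts X)"
    using inv_into_f_f[of "\<lambda>x. x" "pts X"] by (auto simp: fun_eq_iff restrict_def inj_on_def)
  ultimately show ?thesis
    by (simp add: relabel_cat_def)
qed

lemma relabel_dist_id:
  assumes "\<phi> \<in> dist Q X Y"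
  shows "relabel_dist (pts X) (\<lambda>x. x) (pts Y) (\<lambda>y. y) \<phi> = \<phi>"
proof (rule extensionalityI)
  show "relabel_dist (pts X) (\<lambda>x. x) (pts Y) (\<lambda>y. y) \<phi> \<in> extensional (pts X \<times> pts Y)"
    by (simp add: relabel_dist_def)
  show "\<phi> \<in> extensional (pts X \<times> pts Y)"
    using assms by (rule dist_extensional)
  show "relabel_dist (pts X) (\<lambda>x. x) (pts Y) (\<lambda>y. y) \<phi> xy = \<phi> xy" if "xy \<in> pts X \<times> pts Y" for xy
    using that relabel_dist_apply[of "\<lambda>x. x" "pts X" "\<lambda>y. y" "pts Y" "fst xy" "snd xy" \<phi>] by auto
qed

end

section \<open>The quantaloids of distributors and of interior spaces\<close>

locale small_base = set_universe small code + quantaloid Q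
  for small :: "'u set \<Rightarrow> bool" and code :: "'u set \<Rightarrow> 'u" and Q :: "('u, 'u) qtld" +
  assumes small_Obj: "small (Obj Q)"
    and small_arrows: "p \<in> Obj Q \<Longrightarrow> q \<in> Obj Q \<Longrightarrow> small (arrows Q p q)"
begin

abbreviation "QDist \<equiv> qdist_qtld small Q"
abbreviation "QArr \<equiv> arr_qtld QDist"
abbreviation "QInt \<equiv> intdist_qtld small Q"

lemma qdist_simps [simp]:
  "X \<in> Obj QDist \<longleftrightarrow> qcategory Q X \<and> small (pts X)"
  "arrows QDist X Y = dist Q X Y"
  "Idn QDist X = hm X"
  "Cmp QDist X Y Z \<psi> \<phi> = dist_comp Q X Y Z \<psi> \<phi>"
  by (simp_all add: qdist_qtld_def)

lemma qdist_le_iff: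
  "\<phi> \<sqsubseteq>\<^bsub>Hom QDist X Y\<^esub> \<psi> \<longleftrightarrow>
    (\<forall>x\<in>pts X. \<forall>y\<in>pts Y. \<phi> (x, y) \<sqsubseteq>\<^bsub>Hom Q (tp X x) (tp Y y)\<^esub> \<psi> (x, y))"
  by (simp add: qdist_qtld_def)

lemma int_simps [simp]:
  "(X, a) \<in> Obj QInt \<longleftrightarrow> interior_space Q X a \<and> small (pts X)"
  "arrows QInt (X, a) (Y, b) = cont_dist Q X a Y b"
  "Idn QInt (X, a) = hm X"
  "Cmp QInt (X, a) (Y, b) (Z, c) \<psi> \<phi> = dist_comp Q X Y Z \<psi> \<phi>"
  by (simp_all add: intdist_qtld_def qdist_qtld_def)

lemma int_le_iff: "\<phi> \<sqsubseteq>\<^bsub>Hom QInt (X, a) (Y, b)\<^esub> \<psi> \<longleftrightarrow> \<phi> \<sqsubseteq>\<^bsub>Hom QDist X Y\<^esub> \<psi>"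
  by (simp add: intdist_qtld_def)

lemma qdist_le_antisym:
  assumes "qcategory Q X" "qcategory Q Y" "\<phi> \<in> dist Q X Y" "\<psi> \<in> dist Q X Y"
    and "\<phi> \<sqsubseteq>\<^bsub>Hom QDist X Y\<^esub> \<psi>" "\<psi> \<sqsubseteq>\<^bsub>Hom QDist X Y\<^esub> \<phi>"
  shows "\<phi> = \<psi>"
proof (rule dist_eqI[OF assms(3,4)])
  fix x y assume p: "x \<in> pts X" "y \<in> pts Y"
  show "\<phi> (x, y) = \<psi> (x, y)"
    by (rule hom_antisym[of "tp X x" "tp Y y"]) (use assms p in \<open>simp_all add: qdist_le_iff\<close>)
qed

lemma qdist_le_trans:
  assumes "qcategory Q X" "qcategory Q Y" "\<phi> \<in> dist Q X Y" "\<psi> \<in> dist Q X Y" "\<chi> \<in> dist Q X Y"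
    and "\<phi> \<sqsubseteq>\<^bsub>Hom QDist X Y\<^esub> \<psi>" "\<psi> \<sqsubseteq>\<^bsub>Hom QDist X Y\<^esub> \<chi>"
  shows "\<phi> \<sqsubseteq>\<^bsub>Hom QDist X Y\<^esub> \<chi>"
  unfolding qdist_le_iff
proof (intro ballI)
  fix x y assume p: "x \<in> pts X" "y \<in> pts Y"
  show "\<phi> (x, y) \<sqsubseteq>\<^bsub>Hom Q (tp X x) (tp Y y)\<^esub> \<chi> (x, y)"
    by (rule hom_trans[where v = "\<psi> (x, y)"]) (use assms p in \<open>simp_all add: qdist_le_iff\<close>)
qed

lemma qdist_le_refl: "qcategory Q X \<Longrightarrow> qcategory Q Y \<Longrightarrow> \<phi> \<in> dist Q X Y \<Longrightarrow> \<phi> \<sqsubseteq>\<^bsub>Hom QDist X Y\<^esub> \<phi>"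
  by (simp add: qdist_le_iff hom_refl)

lemma dist_Sup_qdist_le_iff:
  assumes "qcategory Q X" "qcategory Q Y" "A \<subseteq> dist Q X Y" "\<psi> \<in> dist Q X Y"
  shows "dist_Sup X Y A \<sqsubseteq>\<^bsub>Hom QDist X Y\<^esub> \<psi> \<longleftrightarrow> (\<forall>\<phi>\<in>A. \<phi> \<sqsubseteq>\<^bsub>Hom QDist X Y\<^esub> \<psi>)"
  using assms by (auto simp: qdist_le_iff dist_Sup_le_iff)

lemma hom_qdist_complete_lattice:
  assumes "qcategory Q X" "qcategory Q Y"
  shows "complete_lattice (Hom QDist X Y)"
proof (rule complete_lattice_if_lubs)
  show "eq (Hom QDist X Y) = (=)"
    by (simp add: qdist_qtld_def)
  show "\<exists>s\<in>carrier (Hom QDist X Y). \<forall>b\<in>carrier (Hom QDist X Y).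
      s \<sqsubseteq>\<^bsub>Hom QDist X Y\<^esub> b \<longleftrightarrow> (\<forall>a\<in>A. a \<sqsubseteq>\<^bsub>Hom QDist X Y\<^esub> b)" if "A \<subseteq> carrier (Hom QDist X Y)" for A
    using that assms by (intro bexI[of _ "dist_Sup X Y A"]) (simp_all add: dist_Sup_qdist_le_iff)
  show "\<phi> \<sqsubseteq>\<^bsub>Hom QDist X Y\<^esub> \<phi>" if "\<phi> \<in> carrier (Hom QDist X Y)" for \<phi>
    using that assms qdist_le_refl by simp
  show "\<phi> = \<psi>" if "\<phi> \<in> carrier (Hom QDist X Y)" "\<psi> \<in> carrier (Hom QDist X Y)"
    "\<phi> \<sqsubseteq>\<^bsub>Hom QDist X Y\<^esub> \<psi>" "\<psi> \<sqsubseteq>\<^bsub>Hom QDist X Y\<^esub> \<phi>" for \<phi> \<psi>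
    using that qdist_le_antisym[OF assms, of \<phi> \<psi>] by simp
  show "\<phi> \<sqsubseteq>\<^bsub>Hom QDist X Y\<^esub> \<chi>" if "\<phi> \<in> carrier (Hom QDist X Y)" "\<psi> \<in> carrier (Hom QDist X Y)"
    "\<chi> \<in> carrier (Hom QDist X Y)" "\<phi> \<sqsubseteq>\<^bsub>Hom QDist X Y\<^esub> \<psi>" "\<psi> \<sqsubseteq>\<^bsub>Hom QDist X Y\<^esub> \<chi>" for \<phi> \<psi> \<chi>
    using that qdist_le_trans[OF assms, of \<phi> \<psi> \<chi>] by simp
qed

lemma qdist_Sup:
  assumes "qcategory Q X" "qcategory Q Y" "A \<subseteq> dist Q X Y"
  shows "\<Squnion>\<^bsub>Hom QDist X Y\<^esub> A = dist_Sup X Y A"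
  by (rule complete_lattice.sup_eqI[OF hom_qdist_complete_lattice])
    (use assms in \<open>simp_all add: dist_Sup_qdist_le_iff\<close>)

lemma quantaloid_qdist: "quantaloid QDist"
proof (rule quantaloid.intro, goal_cases)
  case (7 p q r A v)
  moreover have "(\<lambda>u. dist_comp Q p q r v u) ` A \<subseteq> dist Q p r"
    using 7 by auto
  ultimately show ?case
    by (simp add: qdist_Sup dist_comp_Sup_right)
next
  case (8 p q r u B)
  moreover have "(\<lambda>v. dist_comp Q p q r v u) ` B \<subseteq> dist Q p r"
    using 8 by auto
  ultimately show ?case
    by (simp add: qdist_Sup dist_comp_Sup_left)
qed (simp_all add: hom_qdist_complete_lattice dist_comp_assoc)

lemma cont_dist_subset:
  "interior_space Q X a \<Longrightarrow> interior_space Q Y b \<Longrightarrow> A \<subseteq> cont_dist Q X a Y b \<Longrightarrow> A \<subseteq> dist Q X Y"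
  using cont_distD(1) by blast

lemma hom_int_complete_lattice:
  assumes a: "interior_space Q X a" and b: "interior_space Q Y b"
  shows "complete_lattice (Hom QInt (X, a) (Y, b))"
proof (rule complete_lattice_if_lubs)
  let ?H = "Hom QInt (X, a) (Y, b)"
  note X = interior_space_qcategory[OF a] and Y = interior_space_qcategory[OF b]
  note d = cont_distD(1)[OF a b]
  show "eq ?H = (=)"
    by (simp add: intdist_qtld_def qdist_qtld_def)
  show "\<exists>s\<in>carrier ?H. \<forall>b\<in>carrier ?H. s \<sqsubseteq>\<^bsub>?H\<^esub> b \<longleftrightarrow> (\<forall>a\<in>A. a \<sqsubseteq>\<^bsub>?H\<^esub> b)"
    if "A \<subseteq> carrier ?H" for A
  proof -
    have A: "A \<subseteq> cont_dist Q X a Y b"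
      using that by simp
    show ?thesis
      using dist_Sup_cont_dist[OF a b A] dist_Sup_qdist_le_iff[OF X Y cont_dist_subset[OF a b A]] d
      by (intro bexI[of _ "dist_Sup X Y A"]) (simp_all add: int_le_iff)
  qed
  show "\<phi> \<sqsubseteq>\<^bsub>?H\<^esub> \<phi>" if "\<phi> \<in> carrier ?H" for \<phi>
    using that d qdist_le_refl[OF X Y] by (simp add: int_le_iff)
  show "\<phi> = \<psi>" if "\<phi> \<in> carrier ?H" "\<psi> \<in> carrier ?H" "\<phi> \<sqsubseteq>\<^bsub>?H\<^esub> \<psi>" "\<psi> \<sqsubseteq>\<^bsub>?H\<^esub> \<phi>" for \<phi> \<psi>
    using that d qdist_le_antisym[OF X Y, of \<phi> \<psi>] by (simp add: int_le_iff)
  show "\<phi> \<sqsubseteq>\<^bsub>?H\<^esub> \<chi>" if "\<phi> \<in> carrier ?H" "\<psi> \<in> carrier ?H" "\<chi> \<in> carrier ?H"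
    "\<phi> \<sqsubseteq>\<^bsub>?H\<^esub> \<psi>" "\<psi> \<sqsubseteq>\<^bsub>?H\<^esub> \<chi>" for \<phi> \<psi> \<chi>
    using that d qdist_le_trans[OF X Y, of \<phi> \<psi> \<chi>] by (simp add: int_le_iff)
qed

text \<open>Continuous distributors are closed under pointwise joins, so joins are the same as for
  all distributors.\<close>

lemma int_Sup:
  assumes a: "interior_space Q X a" and b: "interior_space Q Y b" and A: "A \<subseteq> cont_dist Q X a Y b"
  shows "\<Squnion>\<^bsub>Hom QInt (X, a) (Y, b)\<^esub> A = dist_Sup X Y A"
proof (rule complete_lattice.sup_eqI[OF hom_int_complete_lattice[OF a b]])
  note X = interior_space_qcategory[OF a] and Y = interior_space_qcategory[OF b]
  show "dist_Sup X Y A \<sqsubseteq>\<^bsub>Hom QInt (X, a) (Y, b)\<^esub> \<phi> \<longleftrightarrow> (\<forall>\<psi>\<in>A. \<psi> \<sqsubseteq>\<^bsub>Hom QInt (X, a) (Y, b)\<^esub> \<phi>)"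
    if "\<phi> \<in> carrier (Hom QInt (X, a) (Y, b))" for \<phi>
    using that dist_Sup_qdist_le_iff[OF X Y cont_dist_subset[OF a b A], of \<phi>] cont_distD(1)[OF a b, of \<phi>]
    by (simp add: int_le_iff)
qed (use A dist_Sup_cont_dist[OF a b A] in simp_all)

lemma quantaloid_int: "quantaloid QInt"
proof (rule quantaloid.intro, goal_cases)
  case (1 p q)
  then show ?case
    by (cases p; cases q) (simp add: hom_int_complete_lattice)
next
  case (2 p)
  then show ?case
    by (cases p) (simp add: hm_cont_dist)
next
  case (3 p q r u v)
  obtain X a Y b Z c where eqs: "p = (X, a)" "q = (Y, b)" "r = (Z, c)"
    by (metis surj_pair)
  show ?case
    using 3 dist_comp_cont_dist[of X a Y b Z c u v] by (simp add: eqs)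
next
  case (4 p q u)
  then show ?case
    using cont_distD(1)[of "fst p" "snd p" "fst q" "snd q" u] by (cases p; cases q) auto
next
  case (5 p q u)
  then show ?case
    using cont_distD(1)[of "fst p" "snd p" "fst q" "snd q" u] by (cases p; cases q) auto
next
  case (6 p q r s u v w)
  obtain X a Y b Z c W d where eqs: "p = (X, a)" "q = (Y, b)" "r = (Z, c)" "s = (W, d)"
    by (metis surj_pair)
  show ?case
    using 6 cont_distD(1)[of X a Y b u] cont_distD(1)[of Y b Z c v] cont_distD(1)[of Z c W d w]
    by (auto simp: eqs intro!: dist_comp_assoc)
next
  case (7 p q r A v)
  obtain X a Y b Z c where eqs: "p = (X, a)" "q = (Y, b)" "r = (Z, c)"
    by (metis surj_pair)
  have sp: "interior_space Q X a" "interior_space Q Y b" "interior_space Q Z c"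
    using 7 by (simp_all add: eqs)
  have A: "A \<subseteq> cont_dist Q X a Y b" and v: "v \<in> cont_dist Q Y b Z c"
    using 7 by (simp_all add: eqs)
  have "(\<lambda>u. dist_comp Q X Y Z v u) ` A \<subseteq> cont_dist Q X a Z c"
    using dist_comp_cont_dist[OF sp _ v] A by blast
  then show ?case
    using sp A dist_comp_Sup_right[of X Y Z A v] cont_dist_subset[OF sp(1,2) A] cont_distD(1)[OF sp(2,3) v]
    by (simp add: eqs int_Sup)
next
  case (8 p q r u B)
  obtain X a Y b Z c where eqs: "p = (X, a)" "q = (Y, b)" "r = (Z, c)"
    by (metis surj_pair)
  have sp: "interior_space Q X a" "interior_space Q Y b" "interior_space Q Z c"
    using 8 by (simp_all add: eqs)
  have B: "B \<subseteq> cont_dist Q Y b Z c" and u: "u \<in> cont_dist Q X a Y b"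
    using 8 by (simp_all add: eqs)
  have "(\<lambda>v. dist_comp Q X Y Z v u) ` B \<subseteq> cont_dist Q X a Z c"
    using dist_comp_cont_dist[OF sp u] B by blast
  then show ?case
    using sp B dist_comp_Sup_left[of X Y Z B u] cont_dist_subset[OF sp(2,3) B] cont_distD(1)[OF sp(1,2) u]
    by (simp add: eqs int_Sup)
qed

lemma open_rel_congruence: "congruence QInt (open_rel Q)"
  unfolding congruence_def
proof (intro conjI ballI allI impI)
  fix p q assume o: "p \<in> Obj QInt" "q \<in> Obj QInt"
  obtain X a Y b where eqs: "p = (X, a)" "q = (Y, b)"
    by (metis surj_pair)
  have b: "interior_space Q Y b"
    using o by (simp add: eqs)
  show "equiv (arrows QInt p q) (open_rel Q p q)"
    unfolding eqs int_simps
    by (intro equivI refl_onI symI transI) (auto simp: open_rel_iff[OF b] open_rel_def)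
next
  fix p q r u u' v v'
  assume o: "p \<in> Obj QInt" "q \<in> Obj QInt" "r \<in> Obj QInt"
    and u: "(u, u') \<in> open_rel Q p q" and v: "(v, v') \<in> open_rel Q q r"
  obtain X a Y b Z c where eqs: "p = (X, a)" "q = (Y, b)" "r = (Z, c)"
    by (metis surj_pair)
  have sp: "interior_space Q X a" "interior_space Q Y b" "interior_space Q Z c"
    using o by (simp_all add: eqs)
  note cats = sp[THEN interior_space_qcategory]
  have u': "u \<in> cont_dist Q X a Y b" "u' \<in> cont_dist Q X a Y b"
    "\<And>\<nu>. \<nu> \<in> open_pts Q Y b \<Longrightarrow> kan_pull Q X Y u \<nu> = kan_pull Q X Y u' \<nu>"
    using u unfolding eqs open_rel_iff[OF sp(2)] by blast+
  have v': "v \<in> cont_dist Q Y b Z c" "v' \<in> cont_dist Q Y b Z c"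
    "\<And>\<nu>. \<nu> \<in> open_pts Q Z c \<Longrightarrow> kan_pull Q Y Z v \<nu> = kan_pull Q Y Z v' \<nu>"
    using v unfolding eqs open_rel_iff[OF sp(3)] by blast+
  \<comment> \<open>The chain is \<open>u\<^sup>* v\<^sup>* \<nu> = u\<^sup>* v'\<^sup>* \<nu> =
    u'\<^sup>* v'\<^sup>* \<nu>\<close>. Its second equation applies the relation of u and u' to
    \<open>v'\<^sup>* \<nu>\<close>, which is open because v' is continuous.\<close>
  have "kan_pull Q X Z (dist_comp Q X Y Z v u) \<nu> = kan_pull Q X Z (dist_comp Q X Y Z v' u') \<nu>"
    if \<nu>: "\<nu> \<in> open_pts Q Z c" for \<nu>
    using kan_pull_comp[OF cats cont_distD(1)[OF sp(1,2) u'(1)] cont_distD(1)[OF sp(2,3) v'(1)] open_psh[OF \<nu>]]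
      kan_pull_comp[OF cats cont_distD(1)[OF sp(1,2) u'(2)] cont_distD(1)[OF sp(2,3) v'(2)] open_psh[OF \<nu>]]
      v'(3)[OF \<nu>] u'(3)[OF cont_distD(2)[OF sp(2,3) v'(2) \<nu>]] by simp
  then show "(Cmp QInt p q r v u, Cmp QInt p q r v' u') \<in> open_rel Q p r"
    using dist_comp_cont_dist[OF sp u'(1) v'(1)] dist_comp_cont_dist[OF sp u'(2) v'(2)]
    by (simp add: eqs open_rel_iff[OF sp(3)])
next
  fix p q A
  assume o: "p \<in> Obj QInt" "q \<in> Obj QInt" and A: "A \<subseteq> open_rel Q p q"
  obtain X a Y b where eqs: "p = (X, a)" "q = (Y, b)"
    by (metis surj_pair)
  have sp: "interior_space Q X a" "interior_space Q Y b"
    using o by (simp_all add: eqs)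
  note cats = sp[THEN interior_space_qcategory]
  have rel: "fst x \<in> cont_dist Q X a Y b" "snd x \<in> cont_dist Q X a Y b"
    "\<And>\<nu>. \<nu> \<in> open_pts Q Y b \<Longrightarrow> kan_pull Q X Y (fst x) \<nu> = kan_pull Q X Y (snd x) \<nu>" if "x \<in> A" for x
  proof -
    have "(fst x, snd x) \<in> open_rel Q (X, a) (Y, b)"
      using that A eqs by auto
    then show "fst x \<in> cont_dist Q X a Y b" "snd x \<in> cont_dist Q X a Y b"
      "\<And>\<nu>. \<nu> \<in> open_pts Q Y b \<Longrightarrow> kan_pull Q X Y (fst x) \<nu> = kan_pull Q X Y (snd x) \<nu>"
      unfolding open_rel_iff[OF sp(2)] by blast+
  qed
  have sub: "fst ` A \<subseteq> cont_dist Q X a Y b" "snd ` A \<subseteq> cont_dist Q X a Y b"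
    using rel by auto
  have "kan_pull Q X Y (dist_Sup X Y (fst ` A)) \<nu> = kan_pull Q X Y (dist_Sup X Y (snd ` A)) \<nu>"
    if \<nu>: "\<nu> \<in> open_pts Q Y b" for \<nu>
  proof (rule prod_eqI)
    have "(\<lambda>\<phi>. snd (kan_pull Q X Y \<phi> \<nu>)) ` fst ` A = (\<lambda>\<phi>. snd (kan_pull Q X Y \<phi> \<nu>)) ` snd ` A"
      unfolding image_image using rel(3)[OF _ \<nu>] by (intro image_cong) auto
    then show "snd (kan_pull Q X Y (dist_Sup X Y (fst ` A)) \<nu>) = snd (kan_pull Q X Y (dist_Sup X Y (snd ` A)) \<nu>)"
      using snd_kan_pull_Sup[OF cats cont_dist_subset[OF sp sub(1)] open_psh[OF \<nu>]]
        snd_kan_pull_Sup[OF cats cont_dist_subset[OF sp sub(2)] open_psh[OF \<nu>]] by simp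
  qed (simp add: open_psh[OF \<nu>])
  then show "(\<Squnion>\<^bsub>Hom QInt p q\<^esub> (fst ` A), \<Squnion>\<^bsub>Hom QInt p q\<^esub> (snd ` A)) \<in> open_rel Q p q"
    using int_Sup[OF sp sub(1)] int_Sup[OF sp sub(2)] dist_Sup_cont_dist[OF sp sub(1)] dist_Sup_cont_dist[OF sp sub(2)]
    by (simp add: eqs open_rel_iff[OF sp(2)])
qed

sublocale Dist: quantaloid QDist
  by (rule quantaloid_qdist)

sublocale Diag: quotient_quantaloid "QArr" "diag_rel QDist"
  by (rule quantaloid.quotient_quantaloid_diag[OF quantaloid_qdist])

sublocale Int: quotient_quantaloid QInt "open_rel Q"
  by (intro quotient_quantaloid.intro quantaloid_int quotient_quantaloid_axioms.intro open_rel_congruence)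

end

section \<open>The two homomorphisms\<close>

context set_universe
begin

lemma code_eq_iff: "small A \<Longrightarrow> small B \<Longrightarrow> code A = code B \<longleftrightarrow> A = B"
  using code_inj by (auto simp: inj_on_def)

lemma kpair_eq_iff [simp]: "kpair code x y = kpair code x' y' \<longleftrightarrow> x = x' \<and> y = y'"
  by (auto simp: kpair_def code_eq_iff small_finite doubleton_eq_iff)

text \<open>The coded graph determines the values on \<open>pts X\<close>, and extensionality fixes
  the function elsewhere.\<close>

lemma inj_on_psh_code:
  assumes "small (pts X)"
  shows "inj_on (psh_code code X) (psh_pts Q X)"
proof (rule inj_onI)
  fix \<mu> \<nu> assume \<mu>: "\<mu> \<in> psh_pts Q X" and \<nu>: "\<nu> \<in> psh_pts Q X"
    and eq: "psh_code code X \<mu> = psh_code code X \<nu>"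
  obtain q m r n where eqs: "\<mu> = (q, m)" "\<nu> = (r, n)"
    by fastforce
  have q: "q = r" and img: "(\<lambda>x. kpair code x (m (x, ()))) ` pts X = (\<lambda>x. kpair code x (n (x, ()))) ` pts X"
    using eq assms by (simp_all add: psh_code_def eqs code_eq_iff small_image)
  have "m (x, ()) = n (x, ())" if "x \<in> pts X" for x
  proof -
    have "kpair code x (m (x, ())) \<in> (\<lambda>x. kpair code x (n (x, ()))) ` pts X"
      using that img by blast
    then show ?thesis
      by auto
  qed
  moreover have "m \<in> extensional (pts X \<times> {()})" "n \<in> extensional (pts X \<times> {()})"
    using \<mu> \<nu> by (auto simp: eqs psh_pts_def dist_def one_cat_def PiE_def)
  ultimately have "m = n"
    by (intro extensionalityI[of m "pts X \<times> {()}" n]) auto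
  then show "\<mu> = \<nu>"
    by (simp add: eqs q)
qed

end

context small_base
begin

text \<open>A presheaf is coded by its type and its graph, and a graph is a subset of the set
  \<open>?T\<close> of pairs of a point of X and an arrow of Q. Smallness of Q makes both
  \<open>?T\<close> and the collection of types sets.\<close>

lemma small_psh_code:
  assumes X: "qcategory Q X" and s: "small (pts X)"
  shows "small (psh_code code X ` psh_pts Q X)"
proof -
  let ?A = "\<Union>p\<in>Obj Q. \<Union>q\<in>Obj Q. arrows Q p q"
  let ?T = "\<Union>x\<in>pts X. kpair code x ` ?A"
  have "small ?A"
    by (intro small_UN small_Obj small_arrows)
  then have "small ?T"
    by (intro small_UN[OF s] small_image)
  then have "small (code ` Pow ?T)"
    by (rule small_Pow)
  then have "small (\<Union>q\<in>Obj Q. kpair code q ` code ` Pow ?T)"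
    by (rule small_UN[OF small_Obj small_image])
  moreover have "psh_code code X ` psh_pts Q X \<subseteq> (\<Union>q\<in>Obj Q. kpair code q ` code ` Pow ?T)"
  proof (rule image_subsetI)
    fix \<mu> assume \<mu>: "\<mu> \<in> psh_pts Q X"
    let ?G = "(\<lambda>x. kpair code x (pval \<mu> x)) ` pts X"
    have val: "pval \<mu> x \<in> ?A" if "x \<in> pts X" for x
      using pval_arrow[OF \<mu> that] qcat_tp[OF X that] psh_ptsD(1)[OF \<mu>] by blast
    have G: "?G \<in> Pow ?T"
      by (rule PowI, rule image_subsetI) (rule UN_I, assumption, rule imageI, erule val)
    have code_eq: "psh_code code X \<mu> = kpair code (fst \<mu>) (code ?G)"
      by (simp add: psh_code_def pval_def case_prod_beta)
    show "psh_code code X \<mu> \<in> (\<Union>q\<in>Obj Q. kpair code q ` code ` Pow ?T)"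
      unfolding code_eq by (intro UN_I[OF psh_ptsD(1)[OF \<mu>]] imageI G)
  qed
  ultimately show ?thesis
    by (rule small_subset)
qed

section \<open>The homomorphism from interior spaces to diagonals\<close>

abbreviation coded_opens :: "('u, 'u, 'u) qcat \<Rightarrow> ('u, 'u, 'u) psh_op \<Rightarrow> ('u, 'u, 'u) qcat" where
  "coded_opens X a \<equiv> relabel_cat (psh_code code X) (open_cat Q X a)"

abbreviation coded_kappa :: "('u, 'u, 'u) qcat \<Rightarrow> ('u, 'u, 'u) psh_op \<Rightarrow> 'u \<times> 'u \<Rightarrow> 'u" where
  "coded_kappa X a \<equiv>
     relabel_dist (pts X) (\<lambda>x. x) (open_pts Q X a) (psh_code code X) (kappa Q X a)"

lemma inj_on_psh_code_open: "small (pts X) \<Longrightarrow> inj_on (psh_code code X) (open_pts Q X a)"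
  by (rule inj_on_subset[OF inj_on_psh_code[where Q = Q]]) (auto simp: open_psh)

lemma coded_opens_obj:
  assumes X: "qcategory Q X" and s: "small (pts X)"
  shows "qcategory Q (coded_opens X a)" "small (pts (coded_opens X a))"
proof -
  have inj: "inj_on (psh_code code X) (pts (open_cat Q X a))"
    using inj_on_psh_code_open[OF s] by simp
  show "qcategory Q (coded_opens X a)"
    by (rule qcategory_relabel_cat[OF qcategory_open_cat[OF X] inj])
  show "small (pts (coded_opens X a))"
    unfolding relabel_cat_simps(1)[OF inj]
    by (rule small_subset[OF small_psh_code[OF X s]]) (auto simp: open_psh)
qed

lemma coded_into_dist:
  assumes X: "qcategory Q X" and s: "small (pts X)" and Y: "qcategory Q Y"
    and \<phi>: "\<phi> \<in> dist Q Y (open_cat Q X a)"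
  shows "relabel_dist (pts Y) (\<lambda>y. y) (open_pts Q X a) (psh_code code X) \<phi> \<in> dist Q Y (coded_opens X a)"
  using relabel_dist_dist[OF Y _ qcategory_open_cat[OF X] _ \<phi>, of "\<lambda>y. y" "psh_code code X"]
    inj_on_psh_code_open[OF s] relabel_cat_id[OF Y] by simp

lemma coded_from_dist:
  assumes X: "qcategory Q X" and s: "small (pts X)" and Y: "qcategory Q Y"
    and \<phi>: "\<phi> \<in> dist Q (open_cat Q X a) Y"
  shows "relabel_dist (open_pts Q X a) (psh_code code X) (pts Y) (\<lambda>y. y) \<phi> \<in> dist Q (coded_opens X a) Y"
  using relabel_dist_dist[OF qcategory_open_cat[OF X] _ Y _ \<phi>, of "psh_code code X" "\<lambda>y. y"]
    inj_on_psh_code_open[OF s] relabel_cat_id[OF Y] by simp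

lemma coded_kappa_dist:
  assumes "qcategory Q X" "small (pts X)"
  shows "coded_kappa X a \<in> dist Q X (coded_opens X a)"
  by (rule coded_into_dist) (use assms in simp_all)

lemma Ihat_obj_eq: "Ihat_obj code Q (X, a) = (X, coded_kappa X a, coded_opens X a)"
  by (simp add: Ihat_obj_def)

lemma Ihat_obj_Obj:
  assumes "p \<in> Obj QInt"
  shows "Ihat_obj code Q p \<in> Obj QArr"
  using assms coded_opens_obj coded_kappa_dist
  by (cases p) (auto simp: Ihat_obj_eq arr_Obj_iff)

lemma coded_kappa_comp:
  assumes X: "qcategory Q X" and Y: "qcategory Q Y" and s: "small (pts Y)" and \<zeta>: "\<zeta> \<in> dist Q X Y"
  shows "dist_comp Q X Y (coded_opens Y b) (coded_kappa Y b) \<zeta> =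
    relabel_dist (pts X) (\<lambda>x. x) (open_pts Q Y b) (psh_code code Y)
      (dist_comp Q X Y (open_cat Q Y b) (kappa Q Y b) \<zeta>)"
  using dist_comp_relabel[of "\<lambda>x. x" X "\<lambda>y. y" Y "psh_code code Y" "open_cat Q Y b" "kappa Q Y b" \<zeta>]
    inj_on_psh_code_open[OF s] relabel_cat_id[OF X] relabel_cat_id[OF Y] relabel_dist_id[OF \<zeta>]
  by simp

lemma comp_coded_kappa:
  assumes X: "qcategory Q X" and s: "small (pts X)" and B: "inj_on e (pts B)"
  shows "dist_comp Q X (coded_opens X a) (relabel_cat e B)
      (relabel_dist (open_pts Q X a) (psh_code code X) (pts B) e \<eta>) (coded_kappa X a) =
    relabel_dist (pts X) (\<lambda>x. x) (pts B) e (dist_comp Q X (open_cat Q X a) B \<eta> (kappa Q X a))"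
  using dist_comp_relabel[of "\<lambda>x. x" X "psh_code code X" "open_cat Q X a" e B \<eta> "kappa Q X a"]
    inj_on_psh_code_open[OF s] relabel_cat_id[OF X] B by simp

lemma Ihat_rep_eq:
  "Ihat_rep code Q (X, a) (Y, b) \<zeta> = (\<zeta>, relabel_dist (open_pts Q X a) (psh_code code X)
     (open_pts Q Y b) (psh_code code Y) (restricted_cograph Q X a Y b \<zeta>))"
  by (simp add: Ihat_rep_def)

lemma fst_Ihat_rep [simp]: "fst (Ihat_rep code Q p q \<zeta>) = \<zeta>"
  by (cases p; cases q) (simp add: Ihat_rep_eq)

lemma Ihat_rep_arrow:
  assumes p: "p \<in> Obj QInt" and q: "q \<in> Obj QInt" and \<zeta>: "\<zeta> \<in> arrows QInt p q"
  shows "Ihat_rep code Q p q \<zeta> \<in> arrows QArr (Ihat_obj code Q p) (Ihat_obj code Q q)"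
proof -
  obtain X a Y b where eqs: "p = (X, a)" "q = (Y, b)"
    by (metis surj_pair)
  have a: "interior_space Q X a" "small (pts X)" and b: "interior_space Q Y b" "small (pts Y)"
    and \<zeta>': "\<zeta> \<in> cont_dist Q X a Y b"
    using assms by (simp_all add: eqs)
  note X = interior_space_qcategory[OF a(1)] and Y = interior_space_qcategory[OF b(1)]
  note d = cont_distD(1)[OF a(1) b(1) \<zeta>']
  let ?r = "restricted_cograph Q X a Y b \<zeta>"
  let ?rc = "relabel_dist (open_pts Q X a) (psh_code code X) (open_pts Q Y b) (psh_code code Y) ?r"
  have "?rc \<in> dist Q (coded_opens X a) (coded_opens Y b)"
    using relabel_dist_dist[OF qcategory_open_cat[OF X] _ qcategory_open_cat[OF Y] _
        restricted_cograph_dist[OF X Y d], of "psh_code code X" a "psh_code code Y" b]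
      inj_on_psh_code_open[OF a(2)] inj_on_psh_code_open[OF b(2)] by simp
  moreover have "dist_comp Q X (coded_opens X a) (coded_opens Y b) ?rc (coded_kappa X a) =
      dist_comp Q X Y (coded_opens Y b) (coded_kappa Y b) \<zeta>"
    using comp_coded_kappa[OF X a(2), of "psh_code code Y" "open_cat Q Y b" a ?r]
      inj_on_psh_code_open[OF b(2)] coded_kappa_comp[OF X Y b(2) d] restricted_cograph_kappa[OF a(1) b(1) \<zeta>']
    by simp
  ultimately show ?thesis
    using d by (simp add: eqs Ihat_obj_eq Ihat_rep_eq arr_arrow_iff)
qed

text \<open>Before coding, the composite of \<open>kappa\<close> with \<zeta> has at (x, \<nu>) the
  value of \<open>\<zeta>\<^sup>* \<nu>\<close> at x with \<nu> open, and \<zeta>' gives the same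
  value by hypothesis.\<close>

lemma coded_kappa_comp_cong:
  assumes X: "interior_space Q X a" and b: "interior_space Q Y b" and s: "small (pts Y)"
    and rel: "(\<zeta>, \<zeta>') \<in> open_rel Q (X, a) (Y, b)"
  shows "dist_comp Q X Y (coded_opens Y b) (coded_kappa Y b) \<zeta> =
    dist_comp Q X Y (coded_opens Y b) (coded_kappa Y b) \<zeta>'"
proof -
  note X' = interior_space_qcategory[OF X] and Y = interior_space_qcategory[OF b]
  note r = rel[unfolded open_rel_iff[OF b]]
  have d: "\<zeta> \<in> dist Q X Y" "\<zeta>' \<in> dist Q X Y"
    using r cont_distD(1)[OF X b] by simp_all
  have "dist_comp Q X Y (open_cat Q Y b) (kappa Q Y b) \<zeta> = dist_comp Q X Y (open_cat Q Y b) (kappa Q Y b) \<zeta>'"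
    by (rule dist_eqI[of _ X "open_cat Q Y b"])
      (use X' Y d r in \<open>simp_all add: dist_comp_kappa_apply\<close>)
  then show ?thesis
    using coded_kappa_comp[OF X' Y s d(1)] coded_kappa_comp[OF X' Y s d(2)] by simp
qed

text \<open>Each law for \<open>Ihat\<close> is reduced by this rule to a relation between first
  components, so nothing has to be computed with cographs.\<close>

lemma diag_rel_Ihat_objI:
  assumes "p \<in> Obj QInt" "q \<in> Obj QInt" "(fst u, fst v) \<in> open_rel Q p q"
    and "u \<in> arrows QArr (Ihat_obj code Q p) (Ihat_obj code Q q)"
    and "v \<in> arrows QArr (Ihat_obj code Q p) (Ihat_obj code Q q)"
  shows "(u, v) \<in> diag_rel QDist (Ihat_obj code Q p) (Ihat_obj code Q q)"
  using assms coded_kappa_comp_cong[of "fst p" "snd p" "fst q" "snd q" "fst u" "fst v"]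
  by (cases p; cases q; cases u; cases v) (simp add: Ihat_obj_eq diag_rel_iff)

text \<open>\<open>Ihat_rep\<close> is the identity on first components, and first components of
  identities, composites and joins of squares are the corresponding operations on interior spaces.
  Hence reflexivity of \<open>open_rel\<close> settles the three laws.\<close>

sublocale Ihat: quotient_hom QInt "open_rel Q" "QArr" "diag_rel QDist"
  "Ihat small code Q" "Ihat_rep code Q"
proof unfold_locales
  let ?I = "on_obj (Ihat small code Q)"
  have obj: "on_obj (Ihat small code Q) = Ihat_obj code Q"
    by (simp add: Ihat_def)
  show "?I p \<in> Obj QArr" if "p \<in> Obj QInt" for p
    using Ihat_obj_Obj[OF that] by (simp add: obj)
  show "on_arr (Ihat small code Q) p q U = (\<Union>u\<in>U. diag_rel QDist (?I p)
      (?I q) `` {Ihat_rep code Q p q u})" for p q U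
    by (simp add: Ihat_def)
  show "(Ihat_rep code Q p q u, Ihat_rep code Q p q u') \<in>
      diag_rel QDist (?I p) (?I q)"
    if "p \<in> Obj QInt" "q \<in> Obj QInt" "(u, u') \<in> open_rel Q p q" for p q u u'
    unfolding obj
    by (rule diag_rel_Ihat_objI) (use that Int.rel_arrow[OF that] Ihat_rep_arrow in simp_all)
  show "(Ihat_rep code Q p p (Idn QInt p), Idn QArr (?I p)) \<in>
      diag_rel QDist (?I p) (?I p)" if p: "p \<in> Obj QInt" for p
    unfolding obj
  proof (rule diag_rel_Ihat_objI[OF p p])
    have "fst (Idn QArr (Ihat_obj code Q p)) = Idn QInt p"
      by (cases p) (simp add: Ihat_obj_eq arr_Idn)
    then show "(fst (Ihat_rep code Q p p (Idn QInt p)), fst (Idn QArr (Ihat_obj code Q p)))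
        \<in> open_rel Q p p"
      using Int.rel_refl[OF p p Int.idn_arrow[OF p]] by simp
  qed (use p Ihat_rep_arrow Int.idn_arrow Diag.idn_arrow Ihat_obj_Obj in blast)+
  show "(Ihat_rep code Q p r (Cmp QInt p q r v u),
      Cmp QArr (?I p) (?I q)
        (?I r) (Ihat_rep code Q q r v) (Ihat_rep code Q p q u))
      \<in> diag_rel QDist (?I p) (?I r)"
    if p: "p \<in> Obj QInt" and q: "q \<in> Obj QInt" and r: "r \<in> Obj QInt" and u: "u \<in> arrows QInt p q"
      and v: "v \<in> arrows QInt q r" for p q r u v
    unfolding obj
  proof (rule diag_rel_Ihat_objI[OF p r])
    note c = Int.cmp_arrow[OF p q r u v]
    have "fst (Cmp QArr (Ihat_obj code Q p) (Ihat_obj code Q q)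
        (Ihat_obj code Q r) (Ihat_rep code Q q r v) (Ihat_rep code Q p q u)) = Cmp QInt p q r v u"
      by (cases p; cases q; cases r) (simp add: Ihat_obj_eq Ihat_rep_eq arr_Cmp)
    then show "(fst (Ihat_rep code Q p r (Cmp QInt p q r v u)),
        fst (Cmp QArr (Ihat_obj code Q p) (Ihat_obj code Q q)
        (Ihat_obj code Q r) (Ihat_rep code Q q r v) (Ihat_rep code Q p q u))) \<in> open_rel Q p r"
      using Int.rel_refl[OF p r c] by simp
    show "Ihat_rep code Q p r (Cmp QInt p q r v u)
        \<in> arrows QArr (Ihat_obj code Q p) (Ihat_obj code Q r)"
      by (rule Ihat_rep_arrow[OF p r c])
    show "Cmp QArr (Ihat_obj code Q p) (Ihat_obj code Q q)
        (Ihat_obj code Q r) (Ihat_rep code Q q r v) (Ihat_rep code Q p q u)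
        \<in> arrows QArr (Ihat_obj code Q p) (Ihat_obj code Q r)"
      by (rule Diag.cmp_arrow[OF Ihat_obj_Obj[OF p] Ihat_obj_Obj[OF q] Ihat_obj_Obj[OF r]
            Ihat_rep_arrow[OF p q u] Ihat_rep_arrow[OF q r v]])
  qed
  show "(Ihat_rep code Q p q (\<Squnion>\<^bsub>Hom QInt p q\<^esub> A),
      \<Squnion>\<^bsub>Hom QArr (?I p) (?I q)\<^esub>
        (Ihat_rep code Q p q ` A))
      \<in> diag_rel QDist (?I p) (?I q)"
    if p: "p \<in> Obj QInt" and q: "q \<in> Obj QInt" and A: "A \<subseteq> arrows QInt p q" for p q A
    unfolding obj
  proof (rule diag_rel_Ihat_objI[OF p q])
    note s = Int.Sup_arrow[OF p q A]
    obtain X a Y b where eqs: "p = (X, a)" "q = (Y, b)"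
      by (metis surj_pair)
    have im: "Ihat_rep code Q p q ` A \<subseteq> arrows QArr (Ihat_obj code Q p) (Ihat_obj code Q q)"
      using Ihat_rep_arrow[OF p q] A by blast
    have sp: "interior_space Q X a" "interior_space Q Y b" "A \<subseteq> cont_dist Q X a Y b"
      using p q A by (simp_all add: eqs)
    have "fst (\<Squnion>\<^bsub>Hom QArr (Ihat_obj code Q p) (Ihat_obj code Q q)\<^esub> (Ihat_rep code Q p q ` A)) =
        \<Squnion>\<^bsub>Hom QDist X Y\<^esub> (fst ` Ihat_rep code Q p q ` A)"
      using Dist.arr_Sup[OF _ _ im[unfolded eqs Ihat_obj_eq]] Ihat_obj_Obj[OF p] Ihat_obj_Obj[OF q]
      by (simp add: eqs Ihat_obj_eq)
    also have "\<dots> = \<Squnion>\<^bsub>Hom QInt p q\<^esub> A"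
      using sp qdist_Sup[OF _ _ cont_dist_subset[OF sp]] int_Sup[OF sp] by (simp add: image_image eqs)
    finally show "(fst (Ihat_rep code Q p q (\<Squnion>\<^bsub>Hom QInt p q\<^esub> A)),
        fst (\<Squnion>\<^bsub>Hom QArr (Ihat_obj code Q p) (Ihat_obj code Q q)\<^esub> (Ihat_rep code Q p q ` A)))
        \<in> open_rel Q p q"
      using Int.rel_refl[OF p q s] by simp
    show "Ihat_rep code Q p q (\<Squnion>\<^bsub>Hom QInt p q\<^esub> A)
        \<in> arrows QArr (Ihat_obj code Q p) (Ihat_obj code Q q)"
      by (rule Ihat_rep_arrow[OF p q s])
    show "\<Squnion>\<^bsub>Hom QArr (Ihat_obj code Q p) (Ihat_obj code Q q)\<^esub> (Ihat_rep code Q p q ` A)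
        \<in> arrows QArr (Ihat_obj code Q p) (Ihat_obj code Q q)"
      by (rule Diag.Sup_arrow[OF Ihat_obj_Obj[OF p] Ihat_obj_Obj[OF q] im])
  qed
qed

section \<open>The homomorphism from diagonals to interior spaces\<close>

lemma Khat_obj_eq: "Khat_obj Q (X, \<phi>, Y) = (X, kan_op X Y \<phi>)"
  by (simp add: Khat_obj_def)

lemma Khat_obj_Obj: "p \<in> Obj QArr \<Longrightarrow> Khat_obj Q p \<in> Obj QInt"
  by (cases p) (simp add: Khat_obj_eq arr_Obj_iff interior_space_kan)

lemma kan_pull_square:
  assumes cats: "qcategory Q X" "qcategory Q Y" "qcategory Q X'" "qcategory Q Y'"
    and dists: "\<phi> \<in> dist Q X Y" "\<psi> \<in> dist Q X' Y'" "\<zeta> \<in> dist Q X X'" "\<eta> \<in> dist Q Y Y'"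
    and sq: "dist_comp Q X X' Y' \<psi> \<zeta> = dist_comp Q X Y Y' \<eta> \<phi>" and \<nu>: "\<nu> \<in> psh_pts Q Y'"
  shows "kan_pull Q X X' \<zeta> (kan_pull Q X' Y' \<psi> \<nu>) = kan_pull Q X Y \<phi> (kan_pull Q Y Y' \<eta> \<nu>)"
  using assms kan_pull_comp[of X X' Y' \<zeta> \<psi> \<nu>] kan_pull_comp[of X Y Y' \<phi> \<eta> \<nu>] by simp

lemma fst_arr_cont_dist:
  assumes p: "p \<in> Obj QArr" and q: "q \<in> Obj QArr" and u: "u \<in> arrows QArr p q"
  shows "fst u \<in> arrows QInt (Khat_obj Q p) (Khat_obj Q q)"
proof -
  obtain X \<phi> Y X' \<psi> Y' \<zeta> \<eta> where eqs: "p = (X, \<phi>, Y)" "q = (X', \<psi>, Y')" "u = (\<zeta>, \<eta>)"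
    by (metis prod_cases3 surj_pair)
  note h = p[unfolded eqs arr_Obj_iff qdist_simps] q[unfolded eqs arr_Obj_iff qdist_simps]
    u[unfolded eqs arr_arrow_iff qdist_simps]
  have "kan_pull Q X X' \<zeta> \<nu> \<in> open_pts Q X (kan_op X Y \<phi>)" if \<nu>: "\<nu> \<in> open_pts Q X' (kan_op X' Y' \<psi>)" for \<nu>
  proof -
    obtain \<rho> where \<rho>: "\<rho> \<in> psh_pts Q Y'" "\<nu> = kan_pull Q X' Y' \<psi> \<rho>"
      using \<nu> h by (auto simp: open_pts_kan)
    then have "kan_pull Q X X' \<zeta> \<nu> = kan_pull Q X Y \<phi> (kan_pull Q Y Y' \<eta> \<rho>)"
      using h by (simp add: kan_pull_square)
    then show ?thesis
      using h \<rho> by (simp add: open_pts_kan)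
  qed
  then show ?thesis
    using h by (simp add: eqs Khat_obj_eq cont_dist_iff interior_space_kan)
qed

text \<open>An open \<nu> has the form \<open>\<psi>\<^sup>* \<rho>\<close>, and
  \<open>\<zeta>\<^sup>* \<psi>\<^sup>* \<rho>\<close> is the pullback of \<rho> along \<psi>
  \<circ> \<zeta>, so it depends on \<zeta> only through that composite.\<close>

lemma diag_rel_open_rel:
  assumes p: "p \<in> Obj QArr" and q: "q \<in> Obj QArr" and u: "(u, u') \<in> diag_rel QDist p q"
  shows "(fst u, fst u') \<in> open_rel Q (Khat_obj Q p) (Khat_obj Q q)"
proof -
  obtain X \<phi> Y X' \<psi> Y' \<zeta> \<eta> \<zeta>' \<eta>' where
    eqs: "p = (X, \<phi>, Y)" "q = (X', \<psi>, Y')" "u = (\<zeta>, \<eta>)" "u' = (\<zeta>', \<eta>')"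
    by (metis prod_cases3 surj_pair)
  note h = p[unfolded eqs arr_Obj_iff qdist_simps] q[unfolded eqs arr_Obj_iff qdist_simps]
  note r = u[unfolded eqs diag_rel_iff arr_arrow_iff qdist_simps]
  have int: "interior_space Q X' (kan_op X' Y' \<psi>)"
    using h by (simp add: interior_space_kan)
  have "kan_pull Q X X' \<zeta> \<nu> = kan_pull Q X X' \<zeta>' \<nu>" if \<nu>: "\<nu> \<in> open_pts Q X' (kan_op X' Y' \<psi>)" for \<nu>
  proof -
    obtain \<rho> where \<rho>: "\<rho> \<in> psh_pts Q Y'" "\<nu> = kan_pull Q X' Y' \<psi> \<rho>"
      using \<nu> h by (auto simp: open_pts_kan)
    have "kan_pull Q X Y' (dist_comp Q X X' Y' \<psi> \<zeta>) \<rho> = kan_pull Q X X' \<zeta> \<nu>"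
      "kan_pull Q X Y' (dist_comp Q X X' Y' \<psi> \<zeta>') \<rho> = kan_pull Q X X' \<zeta>' \<nu>"
      unfolding \<rho>(2) using h r \<rho>(1) by (intro kan_pull_comp; blast)+
    then show ?thesis
      using r by metis
  qed
  moreover have "u \<in> arrows QArr p q" "u' \<in> arrows QArr p q"
    using Diag.rel_arrow[OF p q u] by simp_all
  ultimately show ?thesis
    using fst_arr_cont_dist[OF p q, of u] fst_arr_cont_dist[OF p q, of u']
    by (simp add: eqs Khat_obj_eq open_rel_iff[OF int])
qed

text \<open>The first projection preserves identities, composites and joins strictly. The content
  lies in its continuity and its compatibility with the congruences, both shown above.\<close>

sublocale Khat: quotient_hom "QArr" "diag_rel QDist" QInt "open_rel Q" "Khat Q" "\<lambda>p q. fst"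
proof unfold_locales
  let ?K = "on_obj (Khat Q)"
  have obj: "on_obj (Khat Q) = Khat_obj Q"
    by (simp add: Khat_def)
  show "?K p \<in> Obj QInt" if "p \<in> Obj QArr" for p
    using Khat_obj_Obj[OF that] by (simp add: obj)
  show "on_arr (Khat Q) p q U = (\<Union>u\<in>U. open_rel Q (?K p) (?K q) `` {fst u})" for p q U
    by (simp add: Khat_def case_prod_beta)
  show "(fst u, fst u') \<in> open_rel Q (?K p) (?K q)"
    if "p \<in> Obj QArr" "q \<in> Obj QArr" "(u, u') \<in> diag_rel QDist p q" for p q u u'
    unfolding obj by (rule diag_rel_open_rel[OF that])
  show "(fst (Idn QArr p), Idn QInt (?K p))
      \<in> open_rel Q (?K p) (?K p)" if p: "p \<in> Obj QArr" for p
  proof -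
    have "fst (Idn QArr p) = Idn QInt (Khat_obj Q p)"
      by (cases p) (simp add: arr_Idn Khat_obj_eq)
    then show ?thesis
      using Int.rel_refl[OF Khat_obj_Obj[OF p] Khat_obj_Obj[OF p] Int.idn_arrow[OF Khat_obj_Obj[OF p]]]
      by (simp add: obj)
  qed
  show "(fst (Cmp QArr p q r v u),
      Cmp QInt (?K p) (?K q) (?K r) (fst v) (fst u))
      \<in> open_rel Q (?K p) (?K r)"
    if p: "p \<in> Obj QArr" and q: "q \<in> Obj QArr" and r: "r \<in> Obj QArr"
      and u: "u \<in> arrows QArr p q" and v: "v \<in> arrows QArr q r" for p q r u v
  proof -
    have "fst (Cmp QArr p q r v u) =
        Cmp QInt (Khat_obj Q p) (Khat_obj Q q) (Khat_obj Q r) (fst v) (fst u)"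
      by (cases p; cases q; cases r; cases u; cases v) (simp add: arr_Cmp Khat_obj_eq)
    then show ?thesis
      using Int.rel_refl[OF Khat_obj_Obj[OF p] Khat_obj_Obj[OF r]
          fst_arr_cont_dist[OF p r Diag.cmp_arrow[OF p q r u v]]]
      by (simp add: obj)
  qed
  show "(fst (\<Squnion>\<^bsub>Hom QArr p q\<^esub> A), \<Squnion>\<^bsub>Hom QInt (?K p) (?K q)\<^esub> (fst ` A))
      \<in> open_rel Q (?K p) (?K q)"
    if p: "p \<in> Obj QArr" and q: "q \<in> Obj QArr"
      and A: "A \<subseteq> arrows QArr p q" for p q A
  proof -
    obtain X \<phi> Y X' \<psi> Y' where eqs: "p = (X, \<phi>, Y)" "q = (X', \<psi>, Y')"
      by (metis prod_cases3)
    have sp: "interior_space Q X (kan_op X Y \<phi>)" "interior_space Q X' (kan_op X' Y' \<psi>)"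
      using Khat_obj_Obj[OF p] Khat_obj_Obj[OF q] by (simp_all add: eqs Khat_obj_eq)
    have im: "fst ` A \<subseteq> cont_dist Q X (kan_op X Y \<phi>) X' (kan_op X' Y' \<psi>)"
      using fst_arr_cont_dist[OF p q] A by (auto simp: eqs Khat_obj_eq)
    have "fst (\<Squnion>\<^bsub>Hom QArr p q\<^esub> A) = \<Squnion>\<^bsub>Hom QInt (Khat_obj Q p) (Khat_obj Q q)\<^esub> (fst ` A)"
      using Dist.arr_Sup[OF p[unfolded eqs] q[unfolded eqs] A[unfolded eqs]] sp
        qdist_Sup[OF _ _ cont_dist_subset[OF sp im]] int_Sup[OF sp im]
      by (simp add: eqs Khat_obj_eq)
    then show ?thesis
      using Int.rel_refl[OF Khat_obj_Obj[OF p] Khat_obj_Obj[OF q]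
          fst_arr_cont_dist[OF p q Diag.Sup_arrow[OF p q A]]]
      by (simp add: obj)
  qed
qed

end

section \<open>The equivalence\<close>

context small_base
begin

section \<open>The composite on interior spaces\<close>

lemma coded_opens_simps:
  assumes "small (pts X)"
  shows "pts (coded_opens X a) = psh_code code X ` open_pts Q X a"
    and "\<mu> \<in> open_pts Q X a \<Longrightarrow> tp (coded_opens X a) (psh_code code X \<mu>) = fst \<mu>"
    and "x \<in> pts X \<Longrightarrow> \<mu> \<in> open_pts Q X a \<Longrightarrow> coded_kappa X a (x, psh_code code X \<mu>) = pval \<mu> x"
  using relabel_cat_simps[of "psh_code code X" "open_cat Q X a"] inj_on_psh_code_open[OF assms, of a]
    relabel_dist_apply[of "\<lambda>x. x" "pts X" "psh_code code X" "open_pts Q X a" x \<mu> "kappa Q X a"]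
  by simp_all

text \<open>The pullback is the join, over the open presheaves \<mu> with code z, of \<nu>(z)
  \<circ> \<mu>. It suffices to put every joinand below the interior of the whole, which
  \<open>kan_pull_le_iff\<close> then collects.\<close>

lemma pull_coded_kappa_open:
  assumes a: "interior_space Q X a" and s: "small (pts X)" and \<nu>: "\<nu> \<in> psh_pts Q (coded_opens X a)"
  shows "kan_pull Q X (coded_opens X a) (coded_kappa X a) \<nu> \<in> open_pts Q X a"
proof (rule open_ptsI[OF a])
  note X = interior_space_qcategory[OF a]
  note Z = coded_opens_obj(1)[OF X s]
  note \<kappa> = coded_kappa_dist[OF X s]
  let ?Z = "coded_opens X a"
  let ?k = "kan_pull Q X ?Z (coded_kappa X a) \<nu>"
  show k: "?k \<in> psh_pts Q X"
    using X Z \<kappa> \<nu> by simp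
  note ak = interior_psh[OF a k]
  have "Cmp Q (tp X x) (tp ?Z z) (fst \<nu>) (pval \<nu> z) (coded_kappa X a (x, z))
      \<sqsubseteq>\<^bsub>Hom Q (tp X x) (fst \<nu>)\<^esub> pval (a ?k) x" if x: "x \<in> pts X" and z: "z \<in> pts ?Z" for x z
  proof -
    obtain \<mu> where \<mu>: "\<mu> \<in> open_pts Q X a" "z = psh_code code X \<mu>"
      using z by (auto simp: coded_opens_simps[OF s])
    note \<mu>' = open_psh[OF \<mu>(1)]
    have v: "pval \<nu> z \<in> arrows Q (fst \<mu>) (fst ?k)"
      using pval_arrow[OF \<nu> z] \<mu> \<nu> by (simp add: coded_opens_simps[OF s])
    \<comment> \<open>\<open>\<nu> z\<close> lies below the hom-arrow from \<open>\<mu>\<close> to \<open>?k\<close>, which \<open>a\<close> does not decrease.\<close>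
    have "Cmp Q (tp X x) (fst \<mu>) (fst ?k) (pval \<nu> z) (pval \<mu> x) \<sqsubseteq>\<^bsub>Hom Q (tp X x) (fst ?k)\<^esub> pval ?k x"
      if "x \<in> pts X" for x
      using kan_pull_upper[OF X Z \<kappa> \<nu> that z] that \<mu> \<nu> by (simp add: coded_opens_simps[OF s])
    then have 1: "pval \<nu> z \<sqsubseteq>\<^bsub>Hom Q (fst \<mu>) (fst ?k)\<^esub> hm (psh Q X) (\<mu>, ?k)"
      using le_psh_hm_iff[OF X \<mu>' k v] by simp
    have 2: "hm (psh Q X) (\<mu>, ?k) \<sqsubseteq>\<^bsub>Hom Q (fst \<mu>) (fst ?k)\<^esub> hm (psh Q X) (\<mu>, a ?k)"
    proof -
      have "qfunctor Q (psh Q X) (psh Q X) a"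
        using a unfolding interior_space_def by blast
      from qfunctor_hm[OF this, of \<mu> ?k] show ?thesis
        using \<mu>' k \<mu>(1) unfolding open_pts_iff by (simp only: psh_simps)
    qed
    have h: "hm (psh Q X) (\<mu>, ?k) \<in> arrows Q (fst \<mu>) (fst ?k)" "hm (psh Q X) (\<mu>, a ?k) \<in> arrows Q (fst \<mu>) (fst ?k)"
      using psh_hm_arrow[OF X \<mu>' k] psh_hm_arrow[OF X \<mu>' ak] fst_interior[OF a k] by simp_all
    have "pval \<nu> z \<sqsubseteq>\<^bsub>Hom Q (fst \<mu>) (fst ?k)\<^esub> hm (psh Q X) (\<mu>, a ?k)"
      by (rule hom_trans[OF psh_ptsD(1)[OF \<mu>'] psh_ptsD(1)[OF k] v h 1 2])
    then have "Cmp Q (tp X x) (fst \<mu>) (fst ?k) (pval \<nu> z) (pval \<mu> x) \<sqsubseteq>\<^bsub>Hom Q (tp X x) (fst ?k)\<^esub> pval (a ?k) x"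
      using le_psh_hm_iff[OF X \<mu>' ak, of "pval \<nu> z"] v x fst_interior[OF a k] by simp
    then show ?thesis
      using \<mu> \<nu> x by (simp add: coded_opens_simps[OF s])
  qed
  moreover have "pval (a ?k) x \<in> arrows Q (tp X x) (fst \<nu>)" if "x \<in> pts X" for x
    using pval_arrow[OF ak that] fst_interior[OF a k] \<nu> by simp
  ultimately have "pval ?k x \<sqsubseteq>\<^bsub>Hom Q (tp X x) (fst \<nu>)\<^esub> pval (a ?k) x" if "x \<in> pts X" for x
    using kan_pull_le_iff[OF X Z \<kappa> \<nu> that] that by blast
  then show "qle Q (psh Q X) ?k (a ?k)"
    unfolding qle_psh_iff[OF X k ak] using fst_interior[OF a k] \<nu> by simp
qed

text \<open>For the inclusion from right to left, an open \<mu> is the column of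
  \<open>coded_kappa\<close> at its own code, hence the pullback of the representable presheaf at
  that code.\<close>

lemma open_pts_coded_kappa:
  assumes a: "interior_space Q X a" and s: "small (pts X)"
  shows "kan_pull Q X (coded_opens X a) (coded_kappa X a) ` psh_pts Q (coded_opens X a) = open_pts Q X a"
proof (intro equalityI subsetI)
  fix \<mu> assume "\<mu> \<in> kan_pull Q X (coded_opens X a) (coded_kappa X a) ` psh_pts Q (coded_opens X a)"
  then show "\<mu> \<in> open_pts Q X a"
    using pull_coded_kappa_open[OF a s] by blast
next
  note X = interior_space_qcategory[OF a]
  note Z = coded_opens_obj(1)[OF X s]
  note \<kappa> = coded_kappa_dist[OF X s]
  let ?Z = "coded_opens X a"
  fix \<mu> assume \<mu>: "\<mu> \<in> open_pts Q X a"
  let ?z = "psh_code code X \<mu>"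
  have z: "?z \<in> pts ?Z"
    using \<mu> by (simp add: coded_opens_simps[OF s])
  have "column X ?Z (coded_kappa X a) ?z = \<mu>"
    by (rule psh_eqI[OF column_psh[OF X Z \<kappa> z] open_psh[OF \<mu>]])
      (use \<mu> in \<open>simp_all add: coded_opens_simps[OF s]\<close>)
  then have "\<mu> = kan_pull Q X ?Z (coded_kappa X a) (column ?Z ?Z (hm ?Z) ?z)"
    using kan_pull_column_hm[OF X Z \<kappa> z] by simp
  then show "\<mu> \<in> kan_pull Q X ?Z (coded_kappa X a) ` psh_pts Q ?Z"
    using column_psh[OF Z Z hm_dist[OF Z] z] by (rule image_eqI)
qed

lemma Khat_obj_Ihat_obj:
  assumes "p \<in> Obj QInt"
  shows "Khat_obj Q (Ihat_obj code Q p) = p"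
proof -
  obtain X a where p: "p = (X, a)"
    by fastforce
  have a: "interior_space Q X a" and s: "small (pts X)"
    using assms by (simp_all add: p)
  note X = interior_space_qcategory[OF a]
  note Z = coded_opens_obj(1)[OF X s]
  note \<kappa> = coded_kappa_dist[OF X s]
  have "kan_op X (coded_opens X a) (coded_kappa X a) = a"
    by (rule interior_eqI[OF interior_space_kan[OF X Z \<kappa>] a])
      (simp only: open_pts_kan[OF X Z \<kappa>] open_pts_coded_kappa[OF a s])
  then show ?thesis
    by (simp add: p Ihat_obj_eq Khat_obj_eq)
qed

lemma qmap_simps [simp]:
  "on_obj (Khat Q) = Khat_obj Q" "on_obj (Ihat small code Q) = Ihat_obj code Q"
  "on_obj id_map p = p" "on_obj (comp_map G F) p = on_obj G (on_obj F p)"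
  "on_arr id_map p q u = u"
  "on_arr (comp_map G F) p q u = on_arr G (on_obj F p) (on_obj F q) (on_arr F p q u)"
  by (simp_all add: Khat_def Ihat_def id_map_def comp_map_def)

text \<open>On arrows the composite is the identity too, as \<open>Ihat_rep\<close> keeps \<zeta> as
  its first component and \<open>Khat\<close> projects to it. Objects are fixed strictly, so
  identities have the right type to be the components.\<close>

lemma Khat_Ihat_naturally_isomorphic:
  "naturally_isomorphic Int.CR Int.CR (comp_map (Khat Q) (Ihat small code Q)) id_map"
proof (rule Int.naturally_isomorphic_quotientI[where \<tau> = "Idn QInt" and \<sigma> = "Idn QInt"])
  let ?KI = "comp_map (Khat Q) (Ihat small code Q)"
  fix p q U assume p: "p \<in> Obj Int.CR" and q: "q \<in> Obj Int.CR" and U: "U \<in> arrows Int.CR p q"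
  obtain u where u: "u \<in> arrows QInt p q" "U = Int.cls p q u"
    using U by (rule Int.arrow_quotientE)
  have o: "p \<in> Obj QInt" "q \<in> Obj QInt"
    using p q by simp_all
  have "on_arr (Khat Q) (Ihat_obj code Q p) (Ihat_obj code Q q) (on_arr (Ihat small code Q) p q U) = U"
    using Ihat.on_arr_cls[OF o u(1)] u(2) Khat_obj_Ihat_obj[OF o(1)] Khat_obj_Ihat_obj[OF o(2)]
      Khat.on_arr_cls[OF Ihat_obj_Obj[OF o(1)] Ihat_obj_Obj[OF o(2)] Ihat_rep_arrow[OF o u(1)]] by simp
  moreover have "Cmp QInt p q q (Idn QInt q) u = Cmp QInt p p q u (Idn QInt p)"
    using Int.cmp_idn_left[OF o u(1)] Int.cmp_idn_right[OF o u(1)] by simp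
  ultimately show "\<exists>g\<in>arrows QInt (on_obj ?KI p)
        (on_obj ?KI q).
      \<exists>h\<in>arrows QInt (on_obj id_map p) (on_obj id_map q).
        on_arr ?KI p q U =
          Int.cls (on_obj ?KI p)
            (on_obj ?KI q) g \<and>
        on_arr id_map p q U = Int.cls (on_obj id_map p) (on_obj id_map q) h \<and>
        (Cmp QInt (on_obj ?KI p)
            (on_obj ?KI q) (on_obj id_map q) (Idn QInt q) g,
         Cmp QInt (on_obj ?KI p) (on_obj id_map p)
            (on_obj id_map q) h (Idn QInt p))
          \<in> open_rel Q (on_obj ?KI p) (on_obj id_map q)"
    using u o Khat_obj_Ihat_obj[OF o(1)] Khat_obj_Ihat_obj[OF o(2)]
      Int.rel_refl[OF o Int.cmp_arrow[OF o(1,1,2) Int.idn_arrow[OF o(1)] u(1)]]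
    by (intro bexI[of _ u]) simp_all
next
  let ?KI = "comp_map (Khat Q) (Ihat small code Q)"
  fix p assume "p \<in> Obj Int.CR"
  then have p: "p \<in> Obj QInt"
    by simp
  note i = Int.idn_arrow[OF p]
  have "(Cmp QInt p p p (Idn QInt p) (Idn QInt p), Idn QInt p) \<in> open_rel Q p p"
    using Int.cmp_idn_left[OF p p i] Int.rel_refl[OF p p i] by simp
  then show
    "(Cmp QInt (on_obj ?KI p) (on_obj id_map p)
        (on_obj ?KI p) (Idn QInt p) (Idn QInt p),
      Idn QInt (on_obj ?KI p))
      \<in> open_rel Q (on_obj ?KI p)
          (on_obj ?KI p)"
    "(Cmp QInt (on_obj id_map p) (on_obj ?KI p) (on_obj id_map p)
        (Idn QInt p) (Idn QInt p), Idn QInt (on_obj id_map p))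
      \<in> open_rel Q (on_obj id_map p) (on_obj id_map p)"
    using Khat_obj_Ihat_obj[OF p] by simp_all
qed (simp_all add: Khat_obj_Ihat_obj Int.idn_arrow)

section \<open>The composite on diagonals\<close>

definition codomain_iso :: "'u arr_obj \<Rightarrow> ('u \<times> 'u \<Rightarrow> 'u) \<times> ('u \<times> 'u \<Rightarrow> 'u)" where
  "codomain_iso = (\<lambda>(X, \<phi>, Y). (hm X, relabel_dist (open_pts Q X (kan_op X Y \<phi>)) (psh_code code X)
     (pts Y) (\<lambda>y. y) (to_codomain X Y \<phi>)))"

definition codomain_iso_inv :: "'u arr_obj \<Rightarrow> ('u \<times> 'u \<Rightarrow> 'u) \<times> ('u \<times> 'u \<Rightarrow> 'u)" where
  "codomain_iso_inv = (\<lambda>(X, \<phi>, Y). (hm X, relabel_dist (pts Y) (\<lambda>y. y)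
     (open_pts Q X (kan_op X Y \<phi>)) (psh_code code X) (from_codomain X Y \<phi>)))"

text \<open>Both edges starting at X compose to \<phi>: one is \<phi> after \<open>hm X\<close>, the
  other is \<open>to_codomain_kappa\<close> transported to the coded presheaves.\<close>

lemma codomain_iso_arrow:
  assumes "p \<in> Obj QArr"
  shows "codomain_iso p \<in> arrows QArr (Ihat_obj code Q (Khat_obj Q p)) p"
proof -
  obtain X \<phi> Y where p: "p = (X, \<phi>, Y)"
    by (metis prod_cases3)
  have X: "qcategory Q X" and s: "small (pts X)" and Y: "qcategory Q Y" and \<phi>: "\<phi> \<in> dist Q X Y"
    using assms by (simp_all add: p arr_Obj_iff)
  show ?thesis
    using comp_coded_kappa[OF X s, of "\<lambda>y. y" Y "kan_op X Y \<phi>" "to_codomain X Y \<phi>"]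
      coded_from_dist[OF X s Y to_codomain_dist[OF X Y \<phi>]] relabel_cat_id[OF Y] relabel_dist_id[OF \<phi>]
      to_codomain_kappa[OF X Y \<phi>] X Y \<phi>
    by (simp add: p codomain_iso_def Khat_obj_eq Ihat_obj_eq arr_arrow_iff)
qed

text \<open>Here both composites are the coded \<open>kappa\<close>, by
  \<open>from_codomain_comp\<close>.\<close>

lemma codomain_iso_inv_arrow:
  assumes "p \<in> Obj QArr"
  shows "codomain_iso_inv p \<in> arrows QArr p (Ihat_obj code Q (Khat_obj Q p))"
proof -
  obtain X \<phi> Y where p: "p = (X, \<phi>, Y)"
    by (metis prod_cases3)
  have X: "qcategory Q X" and s: "small (pts X)" and Y: "qcategory Q Y" and \<phi>: "\<phi> \<in> dist Q X Y"
    using assms by (simp_all add: p arr_Obj_iff)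
  let ?e = "psh_code code X" and ?O = "open_cat Q X (kan_op X Y \<phi>)"
  have "dist_comp Q X Y (coded_opens X (kan_op X Y \<phi>))
      (relabel_dist (pts Y) (\<lambda>y. y) (open_pts Q X (kan_op X Y \<phi>)) ?e (from_codomain X Y \<phi>)) \<phi> =
      coded_kappa X (kan_op X Y \<phi>)"
    using dist_comp_relabel[of "\<lambda>x. x" X "\<lambda>y. y" Y ?e ?O "from_codomain X Y \<phi>" \<phi>]
      inj_on_psh_code_open[OF s] relabel_cat_id[OF X] relabel_cat_id[OF Y] relabel_dist_id[OF \<phi>]
      from_codomain_comp[OF X Y \<phi>] by simp
  then show ?thesis
    using coded_into_dist[OF X s Y from_codomain_dist[OF X Y \<phi>]] coded_kappa_dist[OF X s]
      coded_opens_obj(1)[OF X s] X Y \<phi>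
    by (simp add: p codomain_iso_inv_def Khat_obj_eq Ihat_obj_eq arr_arrow_iff)
qed

text \<open>Reduces the invertibility and naturality conditions below to equations between first
  components, which follow from the unit laws as \<open>codomain_iso\<close> and
  \<open>codomain_iso_inv\<close> both have first component \<open>hm X\<close>.\<close>

lemma diag_relI:
  assumes "u \<in> arrows QArr p q" "v \<in> arrows QArr p q" "fst u = fst v"
  shows "(u, v) \<in> diag_rel QDist p q"
  using assms by (cases p; cases q; cases u; cases v) (simp add: diag_rel_iff)

lemma fst_Cmp_arr:
  "fst (Cmp QArr p q r v u) = dist_comp Q (fst p) (fst q) (fst r) (fst v) (fst u)"
  by (cases p; cases q; cases r; cases u; cases v) (simp add: arr_Cmp)

lemma fst_arr_dist: "u \<in> arrows QArr p q \<Longrightarrow> fst u \<in> dist Q (fst p) (fst q)"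
  by (cases p; cases q; cases u) (simp add: arr_arrow_iff)

lemma fst_arr_obj: "p \<in> Obj QArr \<Longrightarrow> qcategory Q (fst p)"
  by (cases p) (simp add: arr_Obj_iff)

lemma fst_Ihat_Khat_obj: "fst (Ihat_obj code Q (Khat_obj Q p)) = fst p"
  by (cases p) (simp add: Khat_obj_eq Ihat_obj_eq)

lemma fst_codomain_iso: "fst (codomain_iso p) = hm (fst p)" "fst (codomain_iso_inv p) = hm (fst p)"
  by (cases p; simp add: codomain_iso_def codomain_iso_inv_def)+

lemma fst_Idn_arr: "fst (Idn QArr p) = hm (fst p)"
  by (cases p) (simp add: arr_Idn)

lemma Ihat_Khat_naturally_isomorphic:
  "naturally_isomorphic Diag.CR Diag.CR (comp_map (Ihat small code Q) (Khat Q)) id_map"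
proof (rule Diag.naturally_isomorphic_quotientI[where \<tau> = codomain_iso and \<sigma> = codomain_iso_inv])
  let ?IK = "comp_map (Ihat small code Q) (Khat Q)"
  let ?F = "\<lambda>p. Ihat_obj code Q (Khat_obj Q p)"
  note IK = Ihat_obj_Obj[OF Khat_obj_Obj]
  show "on_obj ?IK p \<in> Obj QArr" "on_obj id_map p \<in> Obj QArr"
    "codomain_iso p \<in> arrows QArr (on_obj ?IK p) (on_obj id_map p)"
    "codomain_iso_inv p \<in> arrows QArr (on_obj id_map p) (on_obj ?IK p)"
    if "p \<in> Obj Diag.CR" for p
    using that by (simp_all add: IK codomain_iso_arrow codomain_iso_inv_arrow)
  fix p assume "p \<in> Obj Diag.CR"
  then have p: "p \<in> Obj QArr"
    by simp
  note t = codomain_iso_arrow[OF p] and t' = codomain_iso_inv_arrow[OF p]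
  have "(Cmp QArr (?F p) p (?F p) (codomain_iso_inv p) (codomain_iso p), Idn QArr (?F p)) \<in> diag_rel QDist (?F p) (?F p)"
    by (rule diag_relI[OF Diag.cmp_arrow[OF IK[OF p] p IK[OF p] t t'] Diag.idn_arrow[OF IK[OF p]]])
      (simp add: fst_Cmp_arr fst_Idn_arr fst_codomain_iso fst_Ihat_Khat_obj fst_arr_obj[OF p])
  then show "(Cmp QArr (on_obj ?IK p) (on_obj id_map p)
        (on_obj ?IK p) (codomain_iso_inv p) (codomain_iso p),
      Idn QArr (on_obj ?IK p))
      \<in> diag_rel QDist (on_obj ?IK p)
          (on_obj ?IK p)"
    by simp
  have "(Cmp QArr p (?F p) p (codomain_iso p) (codomain_iso_inv p), Idn QArr p) \<in> diag_rel QDist p p"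
    by (rule diag_relI[OF Diag.cmp_arrow[OF p IK[OF p] p t' t] Diag.idn_arrow[OF p]])
      (simp add: fst_Cmp_arr fst_Idn_arr fst_codomain_iso fst_Ihat_Khat_obj fst_arr_obj[OF p])
  then show "(Cmp QArr (on_obj id_map p) (on_obj ?IK p) (on_obj id_map p)
        (codomain_iso p) (codomain_iso_inv p), Idn QArr (on_obj id_map p))
      \<in> diag_rel QDist (on_obj id_map p) (on_obj id_map p)"
    by simp
next
  let ?IK = "comp_map (Ihat small code Q) (Khat Q)"
  let ?F = "\<lambda>p. Ihat_obj code Q (Khat_obj Q p)"
  note IK = Ihat_obj_Obj[OF Khat_obj_Obj]
  fix p q U assume p': "p \<in> Obj Diag.CR" and q': "q \<in> Obj Diag.CR" and U: "U \<in> arrows Diag.CR p q"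
  obtain u where u: "u \<in> arrows QArr p q" "U = Diag.cls p q u"
    using U by (rule Diag.arrow_quotientE)
  have p: "p \<in> Obj QArr" and q: "q \<in> Obj QArr"
    using p' q' by simp_all
  note o = Khat_obj_Obj[OF p] Khat_obj_Obj[OF q]
  let ?g = "Ihat_rep code Q (Khat_obj Q p) (Khat_obj Q q) (fst u)"
  have g: "?g \<in> arrows QArr (?F p) (?F q)"
    by (rule Ihat_rep_arrow[OF o fst_arr_cont_dist[OF p q u(1)]])
  have arr: "on_arr (Ihat small code Q) (Khat_obj Q p) (Khat_obj Q q) (on_arr (Khat Q) p q U) =
      Diag.cls (?F p) (?F q) ?g"
    using Khat.on_arr_cls[OF p q u(1)] u(2) Ihat.on_arr_cls[OF o fst_arr_cont_dist[OF p q u(1)]] by simp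
  \<comment> \<open>Both composites have first component \<open>fst u\<close>, since
    \<open>?g\<close> has it and the two isomorphisms contribute identities.\<close>
  have nat: "(Cmp QArr (?F p) (?F q) q (codomain_iso q) ?g, Cmp QArr (?F p) p q u (codomain_iso p))
      \<in> diag_rel QDist (?F p) q"
    by (rule diag_relI[OF Diag.cmp_arrow[OF IK[OF p] IK[OF q] q g codomain_iso_arrow[OF q]]
          Diag.cmp_arrow[OF IK[OF p] p q codomain_iso_arrow[OF p] u(1)]])
      (simp add: fst_Cmp_arr fst_codomain_iso fst_Ihat_Khat_obj fst_arr_obj[OF p] fst_arr_obj[OF q]
        fst_arr_dist[OF u(1)])
  show "\<exists>g\<in>arrows QArr (on_obj ?IK p)
        (on_obj ?IK q).
      \<exists>h\<in>arrows QArr (on_obj id_map p) (on_obj id_map q).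
        on_arr ?IK p q U =
          Diag.cls (on_obj ?IK p)
            (on_obj ?IK q) g \<and>
        on_arr id_map p q U = Diag.cls (on_obj id_map p) (on_obj id_map q) h \<and>
        (Cmp QArr (on_obj ?IK p)
            (on_obj ?IK q) (on_obj id_map q) (codomain_iso q) g,
         Cmp QArr (on_obj ?IK p) (on_obj id_map p)
            (on_obj id_map q) h (codomain_iso p))
          \<in> diag_rel QDist (on_obj ?IK p) (on_obj id_map q)"
    by (rule bexI[of _ ?g], rule bexI[of _ u]) (use arr nat g u in simp_all)
qed

lemma Khat_category_equivalence:
  "category_equivalence Diag.CR Int.CR (Khat Q) (Ihat small code Q)"
  unfolding category_equivalence_def
  using Khat.is_functor Ihat.is_functor Ihat_Khat_naturally_isomorphic Khat_Ihat_naturally_isomorphic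
  by blast

end

theorem theorem6p4:
  fixes small :: "'u set \<Rightarrow> bool" and code :: "'u set \<Rightarrow> 'u" and Q :: "('u, 'u) qtld"
  assumes "set_universe small code"
    and "small_quantaloid small Q"
  shows "quantaloid_hom (diag_qtld (qdist_qtld small Q)) (intdist_o_qtld small Q) (Khat Q) \<and>
    quantaloid_hom (intdist_o_qtld small Q) (diag_qtld (qdist_qtld small Q)) (Ihat small code Q) \<and>
    category_equivalence (diag_qtld (qdist_qtld small Q)) (intdist_o_qtld small Q)
      (Khat Q) (Ihat small code Q) \<and>
    equivalent_quantaloids (diag_qtld (qdist_qtld small Q)) (intdist_o_qtld small Q)"
proof -
  interpret small_base small code Q
    using assms by (simp add: small_base_def small_base_axioms_def small_quantaloid_def)
  show ?thesis
    unfolding diag_qtld_def intdist_o_qtld_def equivalent_quantaloids_def quantaloid_equivalence_def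
    using Khat.quantaloid_hom Ihat.quantaloid_hom Khat_category_equivalence by blast
qed

end
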